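(* Let $(x,y)$ be a feasible solution to the linear system (L1)–(L6) below and let $\delta>0$. There is a polynomial time algorithm which finds $\bar x$ satisfying (L2) and (L4) (with $\bar x$ in place of $x$), together with a decomposition as follows. 1. The facility set $F$ is partitioned into two families $\mathcal{S}=(S_1,\dots,S_K)$ and $\mathcal{T}=(T_1,\dots,T_L)$ of mutually disjoint subsets, and the client set is partitioned as $C=C_{\mathrm{del}}\cup C_{\mathcal T}\cup C_{\mathcal S}$ into three disjoint subsets, where $C_{\mathrm{del}}$ is a $(\tilde O(1/\delta),\delta)$-deletable set. 2. Each $S_k\in\mathcal{S}$ is $(\tilde O(1/\delta),1+\delta)$-roundable with respect to $(\bar x,y)$, and every client $j\in C_{\mathcal S}$ satisfies $\sum_{i\in S_1\cup\dots\cup S_K}\sum_{p}\bar x_{ijp}\ge1-\frac{\delta}{100}$. 3. Each $T_\ell$ is an $\tilde O(1/\delta)$-complete neighborhood with a corresponding set $J_\ell$ of clients responsible for it, and $C_{\mathcal T}=\bigcup_{\ell=1}^L J_\ell$.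
   Context: Instance of the Heterogeneous Capacitated $k$-Center problem: finite metric space $(X=F\cup C,d)$ with clients $C$ (each of unit demand $d_j=1$) and facility locations $F$, and capacities $(k_1,c_1),\dots,(k_P,c_P)$ ($k_p$ copies of capacity $c_p$), indexed so that $c_1\le c_2\le\dots\le c_P$. Fix a value $\mathrm{OPT}>0$ and let $G$ be the bipartite graph on $F\cup C$ with edge $(i,j)$ iff $d(i,j)\le\mathrm{OPT}$; $\Gamma(S)$ is the set of $G$-neighbors of $S$ and diameters are hop-diameters in $G$. The system (L1)–(L6) on variables $x_{ijp},y_{ip}$ ($i\in F$, $j\in C$, $p\in[P]$), with $x_{ijp}=0$ whenever $d(i,j)>\mathrm{OPT}$: (L1) $\sum_{i\in F}\sum_{p}x_{ijp}\ge1$ for all $j\in C$; (L2) $\sum_{j\in C}x_{ijp}\le c_py_{ip}$ for all $i,p$; (L3) $\sum_{i\in F}y_{ip}\le k_p$ for all $p$; (L4) $x_{ijp}\le y_{ip}$ for all $i,j,p$; (L5) $\sum_p y_{ip}\le1$ for all $i$; (L6) $x,y\ge0$. A set $S\subseteq F$ is $(a,b)$-roundable with respect to $(x,y)$ if $\mathrm{diam}_G(S)\le a$ and there exist $\bar y_{ip}\in\{0,1\}$ ($i\in S$, $p\in[P]$) with $\sum_{q\ge p}\sum_{i\in S}\bar y_{iq}\le\lfloor\sum_{q\ge p}\sum_{i\in S}y_{iq}\rfloor$ for all $p$, and $\sum_{j\in C}d_j\sum_{i\in S,p\in[P]}x_{ijp}\le b\sum_{i\in S}\sum_p c_p\bar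 y_{ip}$. A set $T\subseteq F$ is a complete neighborhood if some $J\subseteq C$ (said to be responsible for $T$) has $\Gamma(J)\subseteq T$; it is $\alpha$-complete if also $\mathrm{diam}(T)\le\alpha$. $C_{\mathrm{del}}\subseteq C$ is $(\tau,\rho)$-deletable if there exist $\phi_{j,j'}\in[0,1]$ ($j\in C_{\mathrm{del}}$, $j'\in C\setminus C_{\mathrm{del}}$) with $\sum_{j'}\phi_{j,j'}=1$ for each $j\in C_{\mathrm{del}}$, $\sum_{j}\phi_{j,j'}\le\rho$ for each $j'\in C\setminus C_{\mathrm{del}}$, and $\phi_{j,j'}>0$ only if $d(j,j')\le\tau\cdot\mathrm{OPT}$. $\tilde O$ hides polylogarithmic factors. *)

theory Defs
  imports "HOL-Analysis.Analysis" "HOL-Library.Disjoint_Sets" "HOL-Library.Log_Nat"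
begin

section \<open>Instances, the threshold graph and the linear system\<close>

text \<open>
  Points are natural numbers, so that instances and outputs can be written down as data.
  Facility and client sets need not be disjoint: a point may play both roles.
  Capacity types are the indices \<open>p\<close> with \<open>1 \<le> p \<le> num_types\<close>.
\<close>

record instance_hck =
  facs :: "nat set"
  clients :: "nat set"
  distf :: "nat \<Rightarrow> nat \<Rightarrow> real"
  num_types :: nat
  copies :: "nat \<Rightarrow> nat"
  capac :: "nat \<Rightarrow> nat"
  opt :: real

definition points :: "instance_hck \<Rightarrow> nat set" where
  "points I = facs I \<union> clients I"

definition types :: "instance_hck \<Rightarrow> nat set" where
  "types I = {1..num_types I}"

definition wf_instance :: "instance_hck \<Rightarrow> bool" where
  "wf_instance I \<longleftrightarrow>
     finite (points I) \<and> Metric_space (points I) (distf I) \<and> opt I > 0 \<and>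
     (\<forall>p\<in>types I. \<forall>q\<in>types I. p \<le> q \<longrightarrow> capac I p \<le> capac I q)"

text \<open>
  The graph is bipartite even if a point is both a facility and a client: vertices are tagged,
  \<open>Inl i\<close> being the facility \<open>i\<close> and \<open>Inr j\<close> the client \<open>j\<close>.
\<close>

definition adjacent :: "instance_hck \<Rightarrow> nat \<Rightarrow> nat \<Rightarrow> bool" where
  "adjacent I i j \<longleftrightarrow> i \<in> facs I \<and> j \<in> clients I \<and> distf I i j \<le> opt I"

definition graph :: "instance_hck \<Rightarrow> ((nat + nat) \<times> (nat + nat)) set" where
  "graph I = {(Inl i, Inr j) | i j. adjacent I i j} \<union> {(Inr j, Inl i) | i j. adjacent I i j}"

definition hop_dist :: "instance_hck \<Rightarrow> nat + nat \<Rightarrow> nat + nat \<Rightarrow> enat" where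
  "hop_dist I u v = (INF n\<in>{n. (u, v) \<in> graph I ^^ n}. enat n)"

text \<open>Hop-diameter, in the whole graph, of a set of facilities.\<close>

definition diam_G :: "instance_hck \<Rightarrow> nat set \<Rightarrow> enat" where
  "diam_G I S = (SUP i\<in>S. SUP i'\<in>S. hop_dist I (Inl i) (Inl i'))"

definition nbrs :: "instance_hck \<Rightarrow> nat set \<Rightarrow> nat set" where
  "nbrs I J = {i. \<exists>j\<in>J. adjacent I i j}"

type_synonym xvars = "nat \<Rightarrow> nat \<Rightarrow> nat \<Rightarrow> real"
type_synonym yvars = "nat \<Rightarrow> nat \<Rightarrow> real"

definition L1 :: "instance_hck \<Rightarrow> xvars \<Rightarrow> bool" where
  "L1 I x \<longleftrightarrow> (\<forall>j\<in>clients I. (\<Sum>i\<in>facs I. \<Sum>p\<in>types I. x i j p) \<ge> 1)"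

definition L2 :: "instance_hck \<Rightarrow> xvars \<Rightarrow> yvars \<Rightarrow> bool" where
  "L2 I x y \<longleftrightarrow>
     (\<forall>i\<in>facs I. \<forall>p\<in>types I. (\<Sum>j\<in>clients I. x i j p) \<le> real (capac I p) * y i p)"

definition L3 :: "instance_hck \<Rightarrow> yvars \<Rightarrow> bool" where
  "L3 I y \<longleftrightarrow> (\<forall>p\<in>types I. (\<Sum>i\<in>facs I. y i p) \<le> real (copies I p))"

definition L4 :: "instance_hck \<Rightarrow> xvars \<Rightarrow> yvars \<Rightarrow> bool" where
  "L4 I x y \<longleftrightarrow> (\<forall>i\<in>facs I. \<forall>j\<in>clients I. \<forall>p\<in>types I. x i j p \<le> y i p)"

definition L5 :: "instance_hck \<Rightarrow> yvars \<Rightarrow> bool" where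
  "L5 I y \<longleftrightarrow> (\<forall>i\<in>facs I. (\<Sum>p\<in>types I. y i p) \<le> 1)"

definition nonneg_x :: "instance_hck \<Rightarrow> xvars \<Rightarrow> bool" where
  "nonneg_x I x \<longleftrightarrow> (\<forall>i\<in>facs I. \<forall>j\<in>clients I. \<forall>p\<in>types I. x i j p \<ge> 0)"

definition nonneg_y :: "instance_hck \<Rightarrow> yvars \<Rightarrow> bool" where
  "nonneg_y I y \<longleftrightarrow> (\<forall>i\<in>facs I. \<forall>p\<in>types I. y i p \<ge> 0)"

definition supported :: "instance_hck \<Rightarrow> xvars \<Rightarrow> bool" where
  "supported I x \<longleftrightarrow>
     (\<forall>i\<in>facs I. \<forall>j\<in>clients I. \<forall>p\<in>types I. distf I i j > opt I \<longrightarrow> x i j p = 0)"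

definition feasible :: "instance_hck \<Rightarrow> xvars \<Rightarrow> yvars \<Rightarrow> bool" where
  "feasible I x y \<longleftrightarrow>
     supported I x \<and> L1 I x \<and> L2 I x y \<and> L3 I y \<and> L4 I x y \<and> L5 I y \<and> nonneg_x I x \<and> nonneg_y I y"


section \<open>Roundable sets, complete neighborhoods, deletable sets\<close>

text \<open>Clients have unit demand, so the demand factors are omitted.\<close>

definition roundable :: "instance_hck \<Rightarrow> xvars \<Rightarrow> yvars \<Rightarrow> real \<Rightarrow> real \<Rightarrow> nat set \<Rightarrow> bool" where
  "roundable I x y a b S \<longleftrightarrow>
     S \<subseteq> facs I \<and> ereal_of_enat (diam_G I S) \<le> ereal a \<and>
     (\<exists>ybar :: yvars.
        (\<forall>i\<in>S. \<forall>p\<in>types I. ybar i p \<in> {0, 1}) \<and>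
        (\<forall>p\<in>types I. (\<Sum>q\<in>{p..num_types I}. \<Sum>i\<in>S. ybar i q)
                      \<le> of_int \<lfloor>\<Sum>q\<in>{p..num_types I}. \<Sum>i\<in>S. y i q\<rfloor>) \<and>
        (\<Sum>j\<in>clients I. \<Sum>i\<in>S. \<Sum>p\<in>types I. x i j p)
          \<le> b * (\<Sum>i\<in>S. \<Sum>p\<in>types I. real (capac I p) * ybar i p))"

definition responsible :: "instance_hck \<Rightarrow> nat set \<Rightarrow> nat set \<Rightarrow> bool" where
  "responsible I J T \<longleftrightarrow> J \<subseteq> clients I \<and> nbrs I J \<subseteq> T"

definition complete_nbhd :: "instance_hck \<Rightarrow> real \<Rightarrow> nat set \<Rightarrow> bool" where
  "complete_nbhd I \<alpha> T \<longleftrightarrow>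
     T \<subseteq> facs I \<and> (\<exists>J. responsible I J T) \<and> ereal_of_enat (diam_G I T) \<le> ereal \<alpha>"

definition deletable :: "instance_hck \<Rightarrow> real \<Rightarrow> real \<Rightarrow> nat set \<Rightarrow> bool" where
  "deletable I \<tau> \<rho> D \<longleftrightarrow>
     D \<subseteq> clients I \<and>
     (\<exists>\<phi> :: nat \<Rightarrow> nat \<Rightarrow> real.
        (\<forall>j\<in>D. \<forall>j'\<in>clients I - D. 0 \<le> \<phi> j j' \<and> \<phi> j j' \<le> 1) \<and>
        (\<forall>j\<in>D. (\<Sum>j'\<in>clients I - D. \<phi> j j') = 1) \<and>
        (\<forall>j'\<in>clients I - D. (\<Sum>j\<in>D. \<phi> j j') \<le> \<rho>) \<and>
        (\<forall>j\<in>D. \<forall>j'\<in>clients I - D. \<phi> j j' > 0 \<longrightarrow> distf I j j' \<le> \<tau> * opt I))"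

text \<open>
  The output. The list \<open>T_fam\<close> consists of the pairs \<open>(T\<^sub>l, J\<^sub>l)\<close>.
\<close>

record decomposition =
  xbar :: xvars
  S_fam :: "nat set list"
  T_fam :: "(nat set \<times> nat set) list"
  C_del :: "nat set"
  C_T :: "nat set"
  C_S :: "nat set"

text \<open>
  The parameter \<open>r\<close> stands for the common bound on the three quantities that are
  soft-O of \<open>1 / \<delta>\<close>. The function \<open>xbar\<close> ranges over the same variables as \<open>x\<close>, i.e. it is
  nonnegative and vanishes on non-edges.
\<close>

definition is_decomposition ::
  "instance_hck \<Rightarrow> yvars \<Rightarrow> real \<Rightarrow> real \<Rightarrow> decomposition \<Rightarrow> bool" where
  "is_decomposition I y \<delta> r D \<longleftrightarrow>
     supported I (xbar D) \<and> nonneg_x I (xbar D) \<and> L2 I (xbar D) y \<and> L4 I (xbar D) y \<and>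
     distinct (S_fam D @ map fst (T_fam D)) \<and>
     partition_on (facs I) (set (S_fam D @ map fst (T_fam D))) \<and>
     clients I = C_del D \<union> C_T D \<union> C_S D \<and>
     C_del D \<inter> C_T D = {} \<and> C_del D \<inter> C_S D = {} \<and> C_T D \<inter> C_S D = {} \<and>
     deletable I r \<delta> (C_del D) \<and>
     (\<forall>S\<in>set (S_fam D). roundable I (xbar D) y r (1 + \<delta>) S) \<and>
     (\<forall>j\<in>C_S D. (\<Sum>i\<in>\<Union>(set (S_fam D)). \<Sum>p\<in>types I. xbar D i j p) \<ge> 1 - \<delta> / 100) \<and>
     (\<forall>(T, J)\<in>set (T_fam D). complete_nbhd I r T \<and> responsible I J T) \<and>
     C_T D = (\<Union>(T, J)\<in>set (T_fam D). J)"

text \<open>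
  A function \<open>g\<close> is soft-O of \<open>1 / \<delta>\<close> if it is at most \<open>A * (1 / \<delta>) * ln (2 + 1 / \<delta>) ^ e\<close> for some
  constants \<open>A, e\<close>. The summand \<open>2\<close> makes the bound meaningful for all \<open>\<delta> > 0\<close>, not
  only in the limit; the logarithm is that of \<open>1 / \<delta>\<close>, so the bound does not depend on the
  size of the instance.
\<close>

definition soft_O_bound :: "real \<Rightarrow> nat \<Rightarrow> real \<Rightarrow> real" where
  "soft_O_bound A e \<delta> = A * (1 / \<delta>) * ln (2 + 1 / \<delta>) ^ e"


section \<open>Programs and their running time\<close>

text \<open>
  A first-order language over binary trees with rational leaves. Every operation is charged the
  bit-length of its argument and of its result (logarithmic cost), so running times are
  polynomially related to those of Turing machines. Operations applied to arguments of the
  wrong shape return \<open>VNil\<close>, which also represents the truth value false.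
\<close>

datatype val = VNil | VNum rat | VCons val val

datatype oper = OId | OFst | OSnd | OAdd | OSub | OMul | ODiv | OFloor | OLess | OEq

datatype prog =
    Op oper
  | Lit val
  | Fork prog prog
  | Comp prog prog
  | Cond prog prog prog
  | Loop prog prog

definition rat_bits :: "rat \<Rightarrow> nat" where
  "rat_bits q = (case quotient_of q of (a, b) \<Rightarrow> floorlog 2 (nat \<bar>a\<bar>) + floorlog 2 (nat b))"

fun vsize :: "val \<Rightarrow> nat" where
  "vsize VNil = 1"
| "vsize (VNum q) = 1 + rat_bits q"
| "vsize (VCons u v) = 1 + vsize u + vsize v"

definition val_of_bool :: "bool \<Rightarrow> val" where
  "val_of_bool b = (if b then VNum 1 else VNil)"

fun exec_op :: "oper \<Rightarrow> val \<Rightarrow> val" where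
  "exec_op OId v = v"
| "exec_op OFst (VCons u v) = u"
| "exec_op OSnd (VCons u v) = v"
| "exec_op OAdd (VCons (VNum a) (VNum b)) = VNum (a + b)"
| "exec_op OSub (VCons (VNum a) (VNum b)) = VNum (a - b)"
| "exec_op OMul (VCons (VNum a) (VNum b)) = VNum (a * b)"
| "exec_op ODiv (VCons (VNum a) (VNum b)) = VNum (a / b)"
| "exec_op OFloor (VNum a) = VNum (of_int \<lfloor>a\<rfloor>)"
| "exec_op OLess (VCons (VNum a) (VNum b)) = val_of_bool (a < b)"
| "exec_op OEq (VCons u v) = val_of_bool (u = v)"
| "exec_op _ _ = VNil"

text \<open>
  \<open>run P v w t\<close>: on input \<open>v\<close> the program \<open>P\<close> halts with output \<open>w\<close> after time \<open>t\<close>.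
  \<open>Comp P Q\<close> runs \<open>P\<close> first.
\<close>

inductive run :: "prog \<Rightarrow> val \<Rightarrow> val \<Rightarrow> nat \<Rightarrow> bool" where
  run_op: "run (Op f) v (exec_op f v) (vsize v + vsize (exec_op f v))"
| run_lit: "run (Lit w) v w (vsize v + vsize w)"
| run_fork: "run P v u s \<Longrightarrow> run Q v w t \<Longrightarrow> run (Fork P Q) v (VCons u w) (s + t + 1)"
| run_comp: "run P v u s \<Longrightarrow> run Q u w t \<Longrightarrow> run (Comp P Q) v w (s + t + 1)"
| run_cond_true: "run B v b s \<Longrightarrow> b \<noteq> VNil \<Longrightarrow> run P v w t \<Longrightarrow> run (Cond B P Q) v w (s + t + 1)"
| run_cond_false: "run B v VNil s \<Longrightarrow> run Q v w t \<Longrightarrow> run (Cond B P Q) v w (s + t + 1)"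
| run_loop_stop: "run B v VNil s \<Longrightarrow> run (Loop B P) v v (s + 1)"
| run_loop_step: "run B v b s \<Longrightarrow> b \<noteq> VNil \<Longrightarrow> run P v u t \<Longrightarrow> run (Loop B P) u w t' \<Longrightarrow>
    run (Loop B P) v w (s + t + t' + 1)"

lemma run_deterministic:
  "run P v w t \<Longrightarrow> run P v w' t' \<Longrightarrow> w = w' \<and> t = t'"
proof (induction arbitrary: w' t' rule: run.induct)
  case (run_op f v)
  from run_op.prems show ?case by (cases rule: run.cases) auto
next
  case (run_lit w v)
  from run_lit.prems show ?case by (cases rule: run.cases) auto
next
  case (run_fork P v u s Q w t)
  from run_fork.prems show ?case by (cases rule: run.cases) (auto dest: run_fork.IH)
next
  case (run_comp P v u s Q w t)
  from run_comp.prems show ?case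
    by (cases rule: run.cases) (use run_comp.IH in blast)
next
  case (run_cond_true B v b s P w t Q)
  from run_cond_true.prems show ?case
    by (cases rule: run.cases) (use run_cond_true.IH run_cond_true.hyps in blast)+
next
  case (run_cond_false B v s Q w t P)
  from run_cond_false.prems show ?case
    by (cases rule: run.cases) (use run_cond_false.IH run_cond_false.hyps in blast)+
next
  case (run_loop_stop B v s P)
  from run_loop_stop.prems show ?case
    by (cases rule: run.cases) (use run_loop_stop.IH run_loop_stop.hyps in blast)+
next
  case (run_loop_step B v b s P u t w t1)
  from run_loop_step.prems show ?case
  proof (cases rule: run.cases)
    case (run_loop_stop s')
    then show ?thesis using run_loop_step.IH(1) run_loop_step.hyps by blast
  next
    case (run_loop_step b' s' u' t2 t3)
    then show ?thesis using run_loop_step.IH by blast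
  qed
qed


section \<open>Encoding of inputs and outputs\<close>

text \<open>
  Sets are written as increasing lists, and functions are tabulated along these lists.
  \<open>enc_real\<close> is meaningful on rational arguments only.
\<close>

definition enc_list :: "('a \<Rightarrow> val) \<Rightarrow> 'a list \<Rightarrow> val" where
  "enc_list f xs = foldr (\<lambda>a v. VCons (f a) v) xs VNil"

definition enc_nat :: "nat \<Rightarrow> val" where
  "enc_nat n = VNum (of_nat n)"

definition enc_real :: "real \<Rightarrow> val" where
  "enc_real r = VNum (inv real_of_rat r)"

definition enc_set :: "nat set \<Rightarrow> val" where
  "enc_set A = enc_list enc_nat (sorted_list_of_set A)"

definition enc_table :: "nat set \<Rightarrow> (nat \<Rightarrow> val) \<Rightarrow> val" where
  "enc_table A f = enc_list f (sorted_list_of_set A)"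

definition enc_x :: "instance_hck \<Rightarrow> xvars \<Rightarrow> val" where
  "enc_x I x =
     enc_table (facs I) (\<lambda>i. enc_table (clients I) (\<lambda>j. enc_table (types I) (\<lambda>p. enc_real (x i j p))))"

definition enc_y :: "instance_hck \<Rightarrow> yvars \<Rightarrow> val" where
  "enc_y I y = enc_table (facs I) (\<lambda>i. enc_table (types I) (\<lambda>p. enc_real (y i p)))"

definition enc_instance :: "instance_hck \<Rightarrow> val" where
  "enc_instance I = enc_list id
     [enc_set (facs I), enc_set (clients I),
      enc_table (points I) (\<lambda>u. enc_table (points I) (\<lambda>v. enc_real (distf I u v))),
      enc_table (types I) (\<lambda>p. VCons (enc_nat (copies I p)) (enc_nat (capac I p))),
      enc_real (opt I)]"

definition enc_input :: "instance_hck \<Rightarrow> xvars \<Rightarrow> yvars \<Rightarrow> real \<Rightarrow> val" where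
  "enc_input I x y \<delta> = enc_list id [enc_instance I, enc_x I x, enc_y I y, enc_real \<delta>]"

definition enc_output :: "instance_hck \<Rightarrow> decomposition \<Rightarrow> val" where
  "enc_output I D = enc_list id
     [enc_x I (xbar D),
      enc_list enc_set (S_fam D),
      enc_list (\<lambda>(T, J). VCons (enc_set T) (enc_set J)) (T_fam D),
      enc_set (C_del D), enc_set (C_T D), enc_set (C_S D)]"

definition rational_x :: "instance_hck \<Rightarrow> xvars \<Rightarrow> bool" where
  "rational_x I x \<longleftrightarrow> (\<forall>i\<in>facs I. \<forall>j\<in>clients I. \<forall>p\<in>types I. x i j p \<in> \<rat>)"

definition rational_input :: "instance_hck \<Rightarrow> xvars \<Rightarrow> yvars \<Rightarrow> real \<Rightarrow> bool" where
  "rational_input I x y \<delta> \<longleftrightarrow>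
     (\<forall>u\<in>points I. \<forall>v\<in>points I. distf I u v \<in> \<rat>) \<and> opt I \<in> \<rat> \<and>
     rational_x I x \<and> (\<forall>i\<in>facs I. \<forall>p\<in>types I. y i p \<in> \<rat>) \<and> \<delta> \<in> \<rat>"

text \<open>\<open>P\<close> outputs \<open>D\<close> within time \<open>a * n ^ b\<close>, where \<open>n\<close> is the bit-length of the input.\<close>

definition computes_within ::
  "prog \<Rightarrow> nat \<Rightarrow> nat \<Rightarrow> instance_hck \<Rightarrow> xvars \<Rightarrow> yvars \<Rightarrow> real \<Rightarrow> decomposition \<Rightarrow> bool" where
  "computes_within P a b I x y \<delta> D \<longleftrightarrow>
     rational_x I (xbar D) \<and>
     (\<exists>t. run P (enc_input I x y \<delta>) (enc_output I D) t \<and> t \<le> a * vsize (enc_input I x y \<delta>) ^ b)"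

end

theory Submission
  imports Defs
begin

text \<open>
  Let \<open>N = \<lceil>1 / \<delta>\<rceil>\<close> and link two clients if they share a facility. If the next layer of some
  ball of radius below \<open>h = O(N log N)\<close> has at most a fraction \<open>1 / N\<close> of the size of the ball, then
  the facilities around the ball are a complete neighborhood for which the ball is responsible,
  and the layer is deleted at the expense of the ball. Once no such ball is left, balls of radius
  \<open>h\<close> exceed balls of radius \<open>1\<close> by a factor that is polynomial in \<open>N\<close>.

  The remaining facilities are clustered around sinks, chosen greedily by decreasing size of the
  \<open>h\<close>-ball. In a cluster \<open>S\<close> the assignments of type \<open>p\<close> are dropped if
  \<open>\<Sum>q\<ge>p. y(S, q) < N + 1\<close>; for the other types rounding the tail sums down costs at most a
  factor \<open>1 + 1 / N\<close>, and summation by parts bounds the load by the capacity. The dropped types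
  have \<open>y\<close>-mass at most \<open>N + 1\<close> in \<open>S\<close>, so by (L4) the clients that lose more than
  \<open>1 / (100 N)\<close> number only \<open>O(N\<^sup>2)\<close> times the maximal degree of a facility in \<open>S\<close>. They are
  deleted and charged to the ball around the sink, which is much larger by the growth of balls.

  This charging needs that facilities at the boundary of the charged ball have small degree.
  A sink where this fails has a much heavier sink nearby, its parent. If the children of a parent
  are together large compared to each single one, they form one cluster and share the charge.
  Otherwise the ball of each child becomes a complete neighborhood, and the parent pays for the
  layers around these balls.
\<close>

section \<open>Polynomial-time computability\<close>

text \<open>The bound soft-O of \<open>1 / \<delta>\<close> leaves no room for the size of the
  instance, so balls cannot simply be grown until they become thin. What remains is the growth
  between the radii 1 and \<open>horizon N\<close>. It is useful because all remaining clients of a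
  facility adjacent to \<open>j\<close> lie in the 1-ball of \<open>j\<close>, so that its degree is
  a tiny fraction of the \<open>horizon N\<close>-ball of \<open>j\<close>.

  The obstacle is that the clients charged must survive themselves. If clients of a charged region
  could lose mass to several clusters, the whole region might turn bad. Hence every facility
  adjacent to the region of an open sink joins its cluster (\<open>forced\<close>): a bad client of
  the region then charges this region only, and as the total charge is a small fraction of the
  region, at least half of it survives. The price is that such boundary facilities ignore their
  heavy home sink, and their clients stick out of the region. Parentless sinks, groups of children
  and closed sinks are the three situations in which the degree bound can be restored or avoided. A
  closed sink may itself be a parent: its ball is a core, never deleted, and can be charged.\<close>

definition poly_bounded :: "'a set \<Rightarrow> ('a \<Rightarrow> val) \<Rightarrow> ('a \<Rightarrow> nat) \<Rightarrow> bool" where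
  "poly_bounded D e f \<longleftrightarrow> (\<exists>a b. \<forall>x\<in>D. f x \<le> a * vsize (e x) ^ b)"

text \<open>The program turns the code \<open>e x\<close> into the code \<open>f x\<close>; the
  object \<open>x\<close> itself is never represented. The same function can thus be the output of
  one program and the input encoding of the next, so that composition becomes transitivity, and side
  conditions on objects are carried by \<open>D\<close>.\<close>

definition poly_time :: "'a set \<Rightarrow> ('a \<Rightarrow> val) \<Rightarrow> ('a \<Rightarrow> val) \<Rightarrow> bool" where
  "poly_time D e f \<longleftrightarrow>
     (\<exists>P T. poly_bounded D e T \<and> (\<forall>x\<in>D. \<exists>t\<le>T x. run P (e x) (f x) t))"

lemma vsize_pos [simp]: "vsize v > 0" "vsize v \<ge> 1" "vsize v \<noteq> 0" "Suc 0 \<le> vsize v"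
  by (induction v) auto

lemma run_size: "run P v w t \<Longrightarrow> vsize v \<le> t \<and> vsize w \<le> t"
  by (induction rule: run.induct) auto

lemma poly_boundedI: "(\<And>x. x \<in> D \<Longrightarrow> f x \<le> a * vsize (e x) ^ b) \<Longrightarrow> poly_bounded D e f"
  unfolding poly_bounded_def by blast

lemma poly_bounded_mono:
  assumes "poly_bounded D e g" "\<And>x. x \<in> D \<Longrightarrow> f x \<le> g x"
  shows "poly_bounded D e f"
  using assms unfolding poly_bounded_def by (meson le_trans)

lemma poly_bounded_const: "poly_bounded D e (\<lambda>_. c)"
  by (rule poly_boundedI[where a = c and b = 0]) auto

lemma poly_bounded_vsize: "poly_bounded D e (\<lambda>x. vsize (e x))"
  by (rule poly_boundedI[where a = 1 and b = 1]) auto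

lemma poly_bounded_add:
  assumes "poly_bounded D e f" "poly_bounded D e g"
  shows "poly_bounded D e (\<lambda>x. f x + g x)"
proof -
  obtain a b where ab: "\<And>x. x \<in> D \<Longrightarrow> f x \<le> a * vsize (e x) ^ b"
    using assms(1) unfolding poly_bounded_def by blast
  obtain c d where cd: "\<And>x. x \<in> D \<Longrightarrow> g x \<le> c * vsize (e x) ^ d"
    using assms(2) unfolding poly_bounded_def by blast
  show ?thesis
  proof (rule poly_boundedI[where a = "a + c" and b = "b + d"])
    fix x assume x: "x \<in> D"
    have "vsize (e x) ^ b \<le> vsize (e x) ^ (b + d)" "vsize (e x) ^ d \<le> vsize (e x) ^ (b + d)"
      by (auto intro: power_increasing)
    then have "a * vsize (e x) ^ b + c * vsize (e x) ^ d \<le> (a + c) * vsize (e x) ^ (b + d)"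
      by (auto simp: distrib_right intro!: add_mono mult_le_mono2)
    then show "f x + g x \<le> (a + c) * vsize (e x) ^ (b + d)"
      using ab[OF x] cd[OF x] by linarith
  qed
qed

lemma poly_bounded_mult:
  assumes "poly_bounded D e f" "poly_bounded D e g"
  shows "poly_bounded D e (\<lambda>x. f x * g x)"
proof -
  obtain a b where ab: "\<And>x. x \<in> D \<Longrightarrow> f x \<le> a * vsize (e x) ^ b"
    using assms(1) unfolding poly_bounded_def by blast
  obtain c d where cd: "\<And>x. x \<in> D \<Longrightarrow> g x \<le> c * vsize (e x) ^ d"
    using assms(2) unfolding poly_bounded_def by blast
  show ?thesis
  proof (rule poly_boundedI[where a = "a * c" and b = "b + d"])
    fix x assume x: "x \<in> D"
    have "f x * g x \<le> (a * vsize (e x) ^ b) * (c * vsize (e x) ^ d)"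
      using ab[OF x] cd[OF x] by (rule mult_le_mono)
    then show "f x * g x \<le> (a * c) * vsize (e x) ^ (b + d)"
      by (simp add: power_add ac_simps)
  qed
qed

lemma poly_bounded_Suc: "poly_bounded D e f \<Longrightarrow> poly_bounded D e (\<lambda>x. Suc (f x))"
  using poly_bounded_add[of D e f "\<lambda>_. 1"] by (simp add: poly_bounded_const)

lemma poly_bounded_power: "poly_bounded D e f \<Longrightarrow> poly_bounded D e (\<lambda>x. f x ^ n)"
  by (induction n) (auto intro: poly_bounded_const poly_bounded_mult)

lemmas poly_bounded_intros = poly_bounded_const poly_bounded_vsize poly_bounded_add
  poly_bounded_mult poly_bounded_Suc poly_bounded_power

lemma poly_bounded_trans:
  assumes "poly_bounded D e (\<lambda>x. vsize (f x))" "poly_bounded D f g"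
  shows "poly_bounded D e g"
proof -
  obtain a b where ab: "\<And>x. x \<in> D \<Longrightarrow> g x \<le> a * vsize (f x) ^ b"
    using assms(2) unfolding poly_bounded_def by blast
  have "poly_bounded D e (\<lambda>x. a * vsize (f x) ^ b)"
    by (intro poly_bounded_intros assms(1))
  then show ?thesis by (rule poly_bounded_mono) (rule ab)
qed

lemma poly_bounded_reindex:
  assumes "poly_bounded D e f" "\<And>z. z \<in> D' \<Longrightarrow> u z \<in> D"
  shows "poly_bounded D' (\<lambda>z. e (u z)) (\<lambda>z. f (u z))"
  using assms unfolding poly_bounded_def by blast

lemma poly_timeI:
  assumes "poly_bounded D e T" "\<And>x. x \<in> D \<Longrightarrow> \<exists>t\<le>T x. run P (e x) (f x) t"
  shows "poly_time D e f"
  using assms unfolding poly_time_def by blast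

lemma poly_time_size: "poly_time D e f \<Longrightarrow> poly_bounded D e (\<lambda>x. vsize (f x))"
proof -
  assume "poly_time D e f"
  then obtain P T where P: "poly_bounded D e T" "\<And>x. x \<in> D \<Longrightarrow> \<exists>t\<le>T x. run P (e x) (f x) t"
    unfolding poly_time_def by blast
  show ?thesis
    by (rule poly_bounded_mono[OF P(1)]) (use P(2) run_size le_trans in blast)
qed

lemma poly_time_cong:
  assumes "poly_time D e g" "\<And>x. x \<in> D \<Longrightarrow> f x = g x"
  shows "poly_time D e f"
proof -
  obtain P T where P: "poly_bounded D e T" "\<And>x. x \<in> D \<Longrightarrow> \<exists>t\<le>T x. run P (e x) (g x) t"
    using assms(1) unfolding poly_time_def by blast
  show ?thesis by (rule poly_timeI[OF P(1), of P]) (use P(2) assms(2) in simp)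
qed

lemma poly_time_subset: "poly_time D e f \<Longrightarrow> D' \<subseteq> D \<Longrightarrow> poly_time D' e f"
  unfolding poly_time_def poly_bounded_def by blast

lemma poly_time_reindex:
  assumes "poly_time D e f" "\<And>z. z \<in> D' \<Longrightarrow> u z \<in> D"
  shows "poly_time D' (\<lambda>z. e (u z)) (\<lambda>z. f (u z))"
proof -
  obtain P T where P: "poly_bounded D e T" "\<And>x. x \<in> D \<Longrightarrow> \<exists>t\<le>T x. run P (e x) (f x) t"
    using assms(1) unfolding poly_time_def by blast
  have "poly_bounded D' (\<lambda>z. e (u z)) (\<lambda>z. T (u z))"
    by (rule poly_bounded_reindex[OF P(1) assms(2)])
  then show ?thesis by (rule poly_timeI[where P = P]) (rule P(2)[OF assms(2)])
qed

lemma poly_time_trans: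
  assumes "poly_time D e f" "poly_time D f g"
  shows "poly_time D e g"
proof -
  obtain P T where P: "poly_bounded D e T" "\<And>x. x \<in> D \<Longrightarrow> \<exists>t\<le>T x. run P (e x) (f x) t"
    using assms(1) unfolding poly_time_def by blast
  obtain Q U where Q: "poly_bounded D f U" "\<And>x. x \<in> D \<Longrightarrow> \<exists>t\<le>U x. run Q (f x) (g x) t"
    using assms(2) unfolding poly_time_def by blast
  have "poly_bounded D e U"
    using poly_time_size[OF assms(1)] Q(1) by (rule poly_bounded_trans)
  then have b: "poly_bounded D e (\<lambda>x. T x + U x + 1)" by (intro poly_bounded_intros P(1))
  show ?thesis
  proof (rule poly_timeI[OF b])
    fix x assume x: "x \<in> D"
    obtain s t where "s \<le> T x" "run P (e x) (f x) s" "t \<le> U x" "run Q (f x) (g x) t"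
      using P(2)[OF x] Q(2)[OF x] by blast
    then show "\<exists>t\<le>T x + U x + 1. run (Comp P Q) (e x) (g x) t"
      by (intro exI[of _ "s + t + 1"]) (auto intro: run_comp[simplified])
  qed
qed

lemma poly_time_op:
  assumes "poly_bounded D e (\<lambda>x. vsize (exec_op f (e x)))"
  shows "poly_time D e (\<lambda>x. exec_op f (e x))"
  by (rule poly_timeI[of D e "\<lambda>x. vsize (e x) + vsize (exec_op f (e x))" "Op f"])
     (auto intro!: poly_bounded_intros assms run_op)

lemma poly_time_id: "poly_time D e e"
  using poly_time_op[of D e OId] by (simp add: poly_bounded_vsize)

lemma poly_time_const: "poly_time D e (\<lambda>_. c)"
  by (rule poly_timeI[of D e "\<lambda>x. vsize (e x) + vsize c" "Lit c"]) (auto intro!: poly_bounded_intros run_lit)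

lemma poly_time_pair:
  assumes "poly_time D e f" "poly_time D e g"
  shows "poly_time D e (\<lambda>x. VCons (f x) (g x))"
proof -
  obtain P T where P: "poly_bounded D e T" "\<And>x. x \<in> D \<Longrightarrow> \<exists>t\<le>T x. run P (e x) (f x) t"
    using assms(1) unfolding poly_time_def by blast
  obtain Q U where Q: "poly_bounded D e U" "\<And>x. x \<in> D \<Longrightarrow> \<exists>t\<le>U x. run Q (e x) (g x) t"
    using assms(2) unfolding poly_time_def by blast
  have b: "poly_bounded D e (\<lambda>x. T x + U x + 1)" by (intro poly_bounded_intros P Q)
  show ?thesis
  proof (rule poly_timeI[OF b])
    fix x assume x: "x \<in> D"
    obtain s t where "s \<le> T x" "run P (e x) (f x) s" "t \<le> U x" "run Q (e x) (g x) t"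
      using P(2)[OF x] Q(2)[OF x] by blast
    then show "\<exists>t\<le>T x + U x + 1. run (Fork P Q) (e x) (VCons (f x) (g x)) t"
      by (intro exI[of _ "s + t + 1"]) (auto intro: run_fork[simplified])
  qed
qed

lemma poly_time_op_comp:
  assumes "poly_time D e f" "\<And>x. x \<in> D \<Longrightarrow> g x = exec_op oper (f x)"
    and "poly_bounded D f (\<lambda>x. vsize (g x))"
  shows "poly_time D e g"
proof -
  have "poly_time D f (\<lambda>x. exec_op oper (f x))"
    by (rule poly_time_op, rule poly_bounded_mono[OF assms(3)]) (simp add: assms(2))
  then have "poly_time D f g" by (rule poly_time_cong) (rule assms(2))
  with assms(1) show ?thesis by (rule poly_time_trans)
qed

lemma poly_time_fst: "poly_time D e (\<lambda>x. VCons (f x) (g x)) \<Longrightarrow> poly_time D e f"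
  by (erule poly_time_op_comp[where oper = OFst])
     (auto intro: poly_boundedI[where a = 1 and b = 1])

lemma poly_time_snd: "poly_time D e (\<lambda>x. VCons (f x) (g x)) \<Longrightarrow> poly_time D e g"
  by (erule poly_time_op_comp[where oper = OSnd])
     (auto intro: poly_boundedI[where a = 1 and b = 1])

text \<open>Each branch has to be computable only where it is taken. Table lookups, for example,
  make sense only after a membership test.\<close>

lemma poly_time_cond:
  assumes "poly_time D e (\<lambda>x. val_of_bool (c x))"
    and "poly_time {x\<in>D. c x} e f" "poly_time {x\<in>D. \<not> c x} e g"
  shows "poly_time D e (\<lambda>x. if c x then f x else g x)"
proof -
  obtain B S where B: "poly_bounded D e S" "\<And>x. x \<in> D \<Longrightarrow> \<exists>t\<le>S x. run B (e x) (val_of_bool (c x)) t"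
    using assms(1) unfolding poly_time_def by blast
  obtain P T where P: "poly_bounded {x\<in>D. c x} e T"
    "\<And>x. x \<in> {x\<in>D. c x} \<Longrightarrow> \<exists>t\<le>T x. run P (e x) (f x) t"
    using assms(2) unfolding poly_time_def by blast
  obtain Q U where Q: "poly_bounded {x\<in>D. \<not> c x} e U"
    "\<And>x. x \<in> {x\<in>D. \<not> c x} \<Longrightarrow> \<exists>t\<le>U x. run Q (e x) (g x) t"
    using assms(3) unfolding poly_time_def by blast
  define T' where "T' x = (if c x then T x else U x)" for x
  have "poly_bounded D e T'"
  proof -
    obtain a b where ab: "\<And>x. x \<in> D \<Longrightarrow> c x \<Longrightarrow> T x \<le> a * vsize (e x) ^ b"
      using P(1) unfolding poly_bounded_def by blast
    obtain a' b' where ab': "\<And>x. x \<in> D \<Longrightarrow> \<not> c x \<Longrightarrow> U x \<le> a' * vsize (e x) ^ b'"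
      using Q(1) unfolding poly_bounded_def by blast
    have "poly_bounded D e (\<lambda>x. a * vsize (e x) ^ b + a' * vsize (e x) ^ b')"
      by (intro poly_bounded_intros)
    then show ?thesis
      by (rule poly_bounded_mono) (auto simp: T'_def dest: ab ab')
  qed
  then have b: "poly_bounded D e (\<lambda>x. S x + T' x + 1)" by (intro poly_bounded_intros B(1))
  show ?thesis
  proof (rule poly_timeI[OF b])
    fix x assume x: "x \<in> D"
    obtain s where s: "s \<le> S x" "run B (e x) (val_of_bool (c x)) s" using B(2)[OF x] by blast
    show "\<exists>t\<le>S x + T' x + 1. run (Cond B P Q) (e x) (if c x then f x else g x) t"
    proof (cases "c x")
      case True
      then obtain t where "t \<le> T x" "run P (e x) (f x) t" using P(2) x by blast
      with s True show ?thesis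
        by (intro exI[of _ "s + t + 1"]) (auto simp: T'_def val_of_bool_def intro: run_cond_true[simplified])
    next
      case False
      then obtain t where "t \<le> U x" "run Q (e x) (g x) t" using Q(2) x by blast
      with s False show ?thesis
        by (intro exI[of _ "s + t + 1"]) (auto simp: T'_def val_of_bool_def intro: run_cond_false[simplified])
    qed
  qed
qed

lemma poly_time_if:
  assumes "poly_time D e (\<lambda>x. val_of_bool (c x))" "poly_time D e f" "poly_time D e g"
  shows "poly_time D e (\<lambda>x. if c x then f x else g x)"
  using assms by (intro poly_time_cond) (auto elim: poly_time_subset)

text \<open>
  The loop passes through the states \<open>s x 0, \<dots>, s x (K x)\<close>; \<open>gd\<close> is the value of the guard.
\<close>

lemma poly_time_loop:
  assumes init: "poly_time D e (\<lambda>x. s x 0)"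
    and guard: "poly_time {(x, k). x \<in> D \<and> k \<le> K x} (\<lambda>(x, k). s x k) (\<lambda>(x, k). gd x k)"
    and gd: "\<And>x k. x \<in> D \<Longrightarrow> k \<le> K x \<Longrightarrow> gd x k \<noteq> VNil \<longleftrightarrow> k < K x"
    and body: "poly_time {(x, k). x \<in> D \<and> k < K x} (\<lambda>(x, k). s x k) (\<lambda>(x, k). s x (Suc k))"
    and K: "poly_bounded D e K"
    and Z: "poly_bounded D e Z" "\<And>x k. x \<in> D \<Longrightarrow> k \<le> K x \<Longrightarrow> vsize (s x k) \<le> Z x"
  shows "poly_time D e (\<lambda>x. s x (K x))"
proof -
  obtain B S where B: "poly_bounded {(x, k). x \<in> D \<and> k \<le> K x} (\<lambda>(x, k). s x k) S"
    "\<And>z. z \<in> {(x, k). x \<in> D \<and> k \<le> K x} \<Longrightarrow>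
       \<exists>t\<le>S z. run B (case z of (x, k) \<Rightarrow> s x k) (case z of (x, k) \<Rightarrow> gd x k) t"
    using guard unfolding poly_time_def by blast
  obtain P T where P: "poly_bounded {(x, k). x \<in> D \<and> k < K x} (\<lambda>(x, k). s x k) T"
    "\<And>z. z \<in> {(x, k). x \<in> D \<and> k < K x} \<Longrightarrow>
       \<exists>t\<le>T z. run P (case z of (x, k) \<Rightarrow> s x k) (case z of (x, k) \<Rightarrow> s x (Suc k)) t"
    using body unfolding poly_time_def by blast
  obtain a b where ab: "\<And>x k. x \<in> D \<Longrightarrow> k \<le> K x \<Longrightarrow> S (x, k) \<le> a * vsize (s x k) ^ b"
    using B(1) unfolding poly_bounded_def by auto
  obtain a' b' where ab': "\<And>x k. x \<in> D \<Longrightarrow> k < K x \<Longrightarrow> T (x, k) \<le> a' * vsize (s x k) ^ b'"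
    using P(1) unfolding poly_bounded_def by auto
  \<comment> \<open>The cost of one round is bounded through the bound \<open>Z\<close> on all
    states. A polynomial-time body alone could square the size of the state in every round.\<close>
  define W where "W x = a * Z x ^ b + a' * Z x ^ b' + 1" for x
  have W: "poly_bounded D e W" unfolding W_def by (intro poly_bounded_intros Z(1))
  have loop: "\<exists>t\<le>(K x - k + 1) * W x. run (Loop B P) (s x k) (s x (K x)) t"
    if x: "x \<in> D" and k: "k \<le> K x" for x k
    using k
  proof (induction "K x - k" arbitrary: k)
    case 0
    then have k: "k = K x" by simp
    obtain t where t: "t \<le> S (x, k)" "run B (s x k) (gd x k) t" using B(2)[of "(x, k)"] x 0 by auto
    have "gd x k = VNil" using gd[OF x, of k] k by simp
    moreover have "S (x, k) \<le> a * Z x ^ b"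
      using ab[OF x 0(2)] Z(2)[OF x 0(2)] by (meson le_trans mult_le_mono2 power_mono zero_le)
    ultimately show ?case using t k
      by (intro exI[of _ "t + 1"]) (auto simp: W_def intro: run_loop_stop[simplified])
  next
    case (Suc m)
    then have k: "k < K x" by simp
    obtain t where t: "t \<le> S (x, k)" "run B (s x k) (gd x k) t"
      using B(2)[of "(x, k)"] x k by auto
    obtain u where u: "u \<le> T (x, k)" "run P (s x k) (s x (Suc k)) u"
      using P(2)[of "(x, k)"] x k by auto
    have "m = K x - Suc k" "Suc k \<le> K x" using Suc by auto
    from Suc(1)[OF this] obtain v where
      v: "v \<le> (K x - Suc k + 1) * W x" "run (Loop B P) (s x (Suc k)) (s x (K x)) v" by blast
    have "S (x, k) \<le> a * Z x ^ b"
      using ab[OF x less_imp_le[OF k]] Z(2)[OF x less_imp_le[OF k]]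
      by (meson le_trans mult_le_mono2 power_mono zero_le)
    moreover have "T (x, k) \<le> a' * Z x ^ b'"
      using ab'[OF x k] Z(2)[OF x less_imp_le[OF k]]
      by (meson le_trans mult_le_mono2 power_mono zero_le)
    ultimately have "t + u + v + 1 \<le> W x + (K x - Suc k + 1) * W x"
      using t u v unfolding W_def by linarith
    also have "\<dots> = (K x - k + 1) * W x" using k by (auto simp: Suc_diff_Suc[symmetric])
    finally show ?case
      using t u v gd[OF x less_imp_le[OF k]] k
      by (intro exI[of _ "t + u + v + 1"]) (auto intro: run_loop_step[simplified])
  qed
  obtain Q U where Q: "poly_bounded D e U" "\<And>x. x \<in> D \<Longrightarrow> \<exists>t\<le>U x. run Q (e x) (s x 0) t"
    using init unfolding poly_time_def by blast
  have bd: "poly_bounded D e (\<lambda>x. U x + (K x + 1) * W x + 1)" by (intro poly_bounded_intros Q K W)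
  show ?thesis
  proof (rule poly_timeI[OF bd])
    fix x assume x: "x \<in> D"
    obtain s1 t where "s1 \<le> U x" "run Q (e x) (s x 0) s1" "t \<le> (K x + 1) * W x"
      "run (Loop B P) (s x 0) (s x (K x)) t"
      using Q(2)[OF x] loop[OF x, of 0] by auto
    then show "\<exists>t\<le>U x + (K x + 1) * W x + 1. run (Comp Q (Loop B P)) (e x) (s x (K x)) t"
      by (intro exI[of _ "s1 + t + 1"]) (auto intro: run_comp[simplified])
  qed
qed

lemma poly_time_lift:
  "poly_time D e f \<Longrightarrow> poly_time (Sigma D A) (\<lambda>z. VCons (e (fst z)) (d z)) (\<lambda>z. f (fst z))"
  by (rule poly_time_trans[OF poly_time_fst[OF poly_time_id]], rule poly_time_reindex) auto

lemma poly_time_var: "poly_time D (\<lambda>z. VCons (e z) (d z)) d"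
  by (rule poly_time_snd[OF poly_time_id])

lemma poly_time_subst:
  assumes "poly_time D' e' h" "poly_time D e (\<lambda>x. e' (u x))" "\<And>x. x \<in> D \<Longrightarrow> u x \<in> D'"
  shows "poly_time D e (\<lambda>x. h (u x))"
  by (rule poly_time_trans[OF assms(2)], rule poly_time_reindex[OF assms(1)]) (rule assms(3))

subsection \<open>Lists\<close>

lemma enc_list_simps [simp]:
  "enc_list d [] = VNil" "enc_list d (a # xs) = VCons (d a) (enc_list d xs)"
  by (simp_all add: enc_list_def)

lemma enc_list_map: "enc_list d (map f xs) = enc_list (\<lambda>a. d (f a)) xs"
  by (induction xs) auto

lemma enc_list_eq_VNil: "enc_list d xs = VNil \<longleftrightarrow> xs = []"
  by (cases xs) auto

lemma vsize_enc_list: "vsize (enc_list d xs) = 1 + (\<Sum>a\<leftarrow>xs. 1 + vsize (d a))"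
  by (induction xs) auto

lemma vsize_enc_list_append:
  "vsize (enc_list d (xs @ ys)) + 1 = vsize (enc_list d xs) + vsize (enc_list d ys)"
  by (simp add: vsize_enc_list)

lemma length_le_vsize: "length xs \<le> vsize (enc_list d xs)"
  by (induction xs) auto

lemma vsize_elem: "a \<in> set xs \<Longrightarrow> vsize (d a) \<le> vsize (enc_list d xs)"
  by (induction xs) auto

lemma vsize_drop: "vsize (enc_list d (drop k xs)) \<le> vsize (enc_list d xs)"
  using vsize_enc_list_append[of d "take k xs" "drop k xs"] vsize_pos(2)[of "enc_list d (take k xs)"]
  by (simp del: vsize_pos)

lemma vsize_enc_list_le:
  assumes "\<And>a. a \<in> set xs \<Longrightarrow> vsize (d a) \<le> B"
  shows "vsize (enc_list d xs) \<le> 1 + length xs * (1 + B)"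
  using assms by (induction xs) fastforce+

text \<open>The loop state consists of the context, the unread suffix of the list and the
  accumulator; the suffix doubles as the guard, being \<open>VNil\<close> exactly at the end.
  Indexing the accumulator by the position makes its relation to the prefix read so far part of its
  definition.\<close>

lemma poly_time_foldi:
  fixes xs :: "'x \<Rightarrow> 'a list" and acc :: "'x \<Rightarrow> nat \<Rightarrow> val"
  assumes xs: "poly_time D e (\<lambda>x. enc_list (d x) (xs x))"
    and init: "poly_time D e (\<lambda>x. acc x 0)"
    and step: "poly_time (Sigma D (\<lambda>x. {..<length (xs x)}))
                 (\<lambda>z. VCons (e (fst z)) (VCons (d (fst z) (xs (fst z) ! snd z)) (acc (fst z) (snd z))))
                 (\<lambda>z. acc (fst z) (Suc (snd z)))"
    and Z: "poly_bounded D e Z" "\<And>x k. x \<in> D \<Longrightarrow> k \<le> length (xs x) \<Longrightarrow> vsize (acc x k) \<le> Z x"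
  shows "poly_time D e (\<lambda>x. acc x (length (xs x)))"
proof -
  define s where
    "s x k = VCons (e x) (VCons (enc_list (d x) (drop k (xs x))) (acc x k))" for x k
  have *: "poly_time D' (\<lambda>(x, k). s x k) (\<lambda>(x, k). e x)"
     "poly_time D' (\<lambda>(x, k). s x k) (\<lambda>(x, k). enc_list (d x) (drop k (xs x)))"
     "poly_time D' (\<lambda>(x, k). s x k) (\<lambda>(x, k). acc x k)" for D'
    by (simp_all add: s_def case_prod_beta' poly_time_fst[OF poly_time_id]
        poly_time_fst[OF poly_time_snd[OF poly_time_id]]
        poly_time_snd[OF poly_time_snd[OF poly_time_id]])
  have "poly_time D e (\<lambda>x. s x (length (xs x)))"
  proof (rule poly_time_loop)
    show "poly_time D e (\<lambda>x. s x 0)"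
      unfolding s_def using xs init by (intro poly_time_pair poly_time_id) simp_all
    show "poly_time {(x, k). x \<in> D \<and> k \<le> length (xs x)} (\<lambda>(x, k). s x k)
            (\<lambda>(x, k). enc_list (d x) (drop k (xs x)))" by (rule *)
    show "enc_list (d x) (drop k (xs x)) \<noteq> VNil \<longleftrightarrow> k < length (xs x)"
      if "k \<le> length (xs x)" for x k
      using that by (cases "k < length (xs x)") (auto simp: Cons_nth_drop_Suc[symmetric])
    show "poly_time {(x, k). x \<in> D \<and> k < length (xs x)} (\<lambda>(x, k). s x k) (\<lambda>(x, k). s x (Suc k))"
    proof -
      let ?D = "{(x, k). x \<in> D \<and> k < length (xs x)}"
      have c: "poly_time ?D (\<lambda>(x, k). s x k)
          (\<lambda>z. VCons (d (fst z) (xs (fst z) ! snd z)) (enc_list (d (fst z)) (drop (Suc (snd z)) (xs (fst z)))))"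
        by (rule poly_time_cong[OF *(2)]) (auto simp: Cons_nth_drop_Suc[symmetric])
      have a: "poly_time ?D (\<lambda>(x, k). s x k) (\<lambda>z. acc (fst z) (Suc (snd z)))"
        using *(1) *(3)
        by (intro poly_time_subst[OF step, where u = "\<lambda>z. z"] poly_time_pair poly_time_fst[OF c])
          (auto simp: case_prod_beta')
      show ?thesis
        unfolding s_def case_prod_beta'
        using *(1) poly_time_snd[OF c] a
        by (intro poly_time_pair) (auto simp: s_def case_prod_beta')
    qed
    show "poly_bounded D e (\<lambda>x. length (xs x))"
      by (rule poly_bounded_mono[OF poly_time_size[OF xs]]) (rule length_le_vsize)
    show "poly_bounded D e (\<lambda>x. 2 + vsize (e x) + vsize (enc_list (d x) (xs x)) + Z x)"
      by (intro poly_bounded_intros poly_time_size[OF xs] Z)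
    show "vsize (s x k) \<le> 2 + vsize (e x) + vsize (enc_list (d x) (xs x)) + Z x"
      if "x \<in> D" "k \<le> length (xs x)" for x k
      using Z(2)[OF that] vsize_drop[of "d x" k "xs x"] by (simp add: s_def)
  qed
  then show ?thesis unfolding s_def by (rule poly_time_snd[OF poly_time_snd])
qed

text \<open>\<open>I\<close> is an invariant of the intermediate results. It and the size bound are
  demanded only for prefixes of the actual list, so partial results may be compared with the full
  one.\<close>

lemma poly_time_fold:
  assumes xs: "poly_time D e (\<lambda>x. enc_list (d x) (xs x))"
    and init: "poly_time D e (\<lambda>x. ds x (s0 x))"
    and step: "poly_time (Sigma D (\<lambda>x. set (xs x) \<times> I x))
                 (\<lambda>z. VCons (e (fst z)) (VCons (d (fst z) (fst (snd z))) (ds (fst z) (snd (snd z)))))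
                 (\<lambda>z. ds (fst z) (f (fst z) (fst (snd z)) (snd (snd z))))"
    and I: "\<And>x ys zs. x \<in> D \<Longrightarrow> xs x = ys @ zs \<Longrightarrow> fold (f x) ys (s0 x) \<in> I x"
    and Z: "poly_bounded D e Z"
      "\<And>x ys zs. x \<in> D \<Longrightarrow> xs x = ys @ zs \<Longrightarrow> vsize (ds x (fold (f x) ys (s0 x))) \<le> Z x"
  shows "poly_time D e (\<lambda>x. ds x (fold (f x) (xs x) (s0 x)))"
proof -
  define acc where "acc x k = ds x (fold (f x) (take k (xs x)) (s0 x))" for x k
  have "poly_time D e (\<lambda>x. acc x (length (xs x)))"
  proof (rule poly_time_foldi[OF xs _ _ Z(1)])
    show "poly_time D e (\<lambda>x. acc x 0)" using init by (simp add: acc_def)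
    let ?u = "\<lambda>z. (fst z, xs (fst z) ! snd z, fold (f (fst z)) (take (snd z) (xs (fst z))) (s0 (fst z)))"
    let ?D = "Sigma D (\<lambda>x. {..<length (xs x)})"
    have "poly_time ?D
       (\<lambda>z. VCons (e (fst (?u z))) (VCons (d (fst (?u z)) (fst (snd (?u z)))) (ds (fst (?u z)) (snd (snd (?u z))))))
       (\<lambda>z. ds (fst (?u z)) (f (fst (?u z)) (fst (snd (?u z))) (snd (snd (?u z)))))"
      by (rule poly_time_reindex[OF step, where u = ?u]) (auto intro!: I append_take_drop_id[symmetric])
    then have "poly_time ?D
       (\<lambda>z. VCons (e (fst z)) (VCons (d (fst z) (xs (fst z) ! snd z)) (acc (fst z) (snd z))))
       (\<lambda>z. ds (fst z) (f (fst z) (xs (fst z) ! snd z)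
          (fold (f (fst z)) (take (snd z) (xs (fst z))) (s0 (fst z)))))"
      by (simp add: acc_def)
    then show "poly_time ?D
       (\<lambda>z. VCons (e (fst z)) (VCons (d (fst z) (xs (fst z) ! snd z)) (acc (fst z) (snd z))))
       (\<lambda>z. acc (fst z) (Suc (snd z)))"
      by (rule poly_time_cong) (auto simp: acc_def take_Suc_conv_app_nth)
    show "vsize (acc x k) \<le> Z x" if "x \<in> D" for x k
      unfolding acc_def by (rule Z(2)[OF that append_take_drop_id[symmetric]])
  qed
  then show ?thesis by (simp add: acc_def)
qed

lemma poly_time_rev:
  assumes "poly_time D e (\<lambda>x. enc_list (d x) (xs x))"
  shows "poly_time D e (\<lambda>x. enc_list (d x) (rev (xs x)))"
proof -
  have "poly_time D e (\<lambda>x. enc_list (d x) (fold (#) (xs x) []))"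
  proof (rule poly_time_fold[OF assms, where I = "\<lambda>_. UNIV" and Z = "\<lambda>x. vsize (enc_list (d x) (xs x))"])
    show "vsize (enc_list (d x) (fold (#) us [])) \<le> vsize (enc_list (d x) (xs x))"
      if "xs x = us @ zs" for x us zs
      by (simp add: that fold_Cons_rev vsize_enc_list rev_map[symmetric] sum_list_rev)
  qed (auto intro: poly_time_const poly_time_snd poly_time_id poly_time_size[OF assms])
  then show ?thesis by (simp add: fold_Cons_rev)
qed

lemma poly_time_map:
  assumes xs: "poly_time D e (\<lambda>x. enc_list (d x) (xs x))"
    and g: "poly_time (Sigma D (\<lambda>x. set (xs x))) (\<lambda>z. VCons (e (fst z)) (d (fst z) (snd z)))
              (\<lambda>z. g (fst z) (snd z))"
  shows "poly_time D e (\<lambda>x. enc_list (g x) (xs x))"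
proof -
  obtain a b where ab: "\<And>z. z \<in> Sigma D (\<lambda>x. set (xs x)) \<Longrightarrow>
      vsize (g (fst z) (snd z)) \<le> a * vsize (VCons (e (fst z)) (d (fst z) (snd z))) ^ b"
    using poly_time_size[OF g] unfolding poly_bounded_def by blast
  define B where "B x = a * (1 + vsize (e x) + vsize (enc_list (d x) (xs x))) ^ b" for x
  have B: "vsize (g x c) \<le> B x" if "x \<in> D" "c \<in> set (xs x)" for x c
  proof -
    have "vsize (g x c) \<le> a * vsize (VCons (e x) (d x c)) ^ b" using ab[of "(x, c)"] that by simp
    also have "\<dots> \<le> B x"
      unfolding B_def using vsize_elem[OF that(2), of "d x"] by (intro mult_le_mono2 power_mono) auto
    finally show ?thesis .
  qed
  \<comment> \<open>Folding with Cons copies the list in reverse; writing the copy with the encoding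
    \<open>g\<close> instead of \<open>d\<close> turns copying into mapping.\<close>
  have "poly_time D e (\<lambda>x. enc_list (g x) (fold (#) (xs x) []))"
  proof (rule poly_time_fold[OF xs, where I = "\<lambda>_. UNIV"
        and Z = "\<lambda>x. 1 + vsize (enc_list (d x) (xs x)) * (1 + B x)"])
    show "poly_bounded D e (\<lambda>x. 1 + vsize (enc_list (d x) (xs x)) * (1 + B x))"
      unfolding B_def by (intro poly_bounded_intros poly_time_size[OF xs])
    show "vsize (enc_list (g x) (fold (#) ys [])) \<le> 1 + vsize (enc_list (d x) (xs x)) * (1 + B x)"
      if "x \<in> D" "xs x = ys @ zs" for x ys zs
    proof -
      have "vsize (enc_list (g x) (rev ys)) \<le> 1 + length (rev ys) * (1 + B x)"
        by (rule vsize_enc_list_le) (use B that in auto)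
      also have "length (rev ys) \<le> vsize (enc_list (d x) (xs x))"
        using length_le_vsize[of "xs x" "d x"] that by simp
      finally show ?thesis by (simp only: fold_Cons_rev append_Nil2 mult_le_mono1 add_left_mono)
    qed
    let ?D = "Sigma D (\<lambda>x. set (xs x) \<times> UNIV)"
    let ?e = "\<lambda>z. VCons (e (fst z)) (VCons (d (fst z) (fst (snd z))) (enc_list (g (fst z)) (snd (snd z))))"
    have *: "poly_time ?D ?e (\<lambda>z. g (fst z) (fst (snd z)))"
      by (rule poly_time_subst[OF g, where u = "\<lambda>z. (fst z, fst (snd z))", simplified fst_conv snd_conv])
         (auto intro!: poly_time_pair poly_time_fst[OF poly_time_id]
          poly_time_fst[OF poly_time_snd[OF poly_time_id]])
    show "poly_time ?D ?e (\<lambda>z. enc_list (g (fst z)) (fst (snd z) # snd (snd z)))"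
      using * by (auto intro!: poly_time_pair poly_time_snd[OF poly_time_snd[OF poly_time_id]])
  qed (auto intro: poly_time_const)
  then have "poly_time D e (\<lambda>x. enc_list (g x) (rev (xs x)))" by (simp add: fold_Cons_rev)
  from poly_time_rev[OF this] show ?thesis by simp
qed

lemma poly_time_filter:
  assumes xs: "poly_time D e (\<lambda>x. enc_list (d x) (xs x))"
    and P: "poly_time (Sigma D (\<lambda>x. set (xs x))) (\<lambda>z. VCons (e (fst z)) (d (fst z) (snd z)))
              (\<lambda>z. val_of_bool (P (fst z) (snd z)))"
  shows "poly_time D e (\<lambda>x. enc_list (d x) (filter (P x) (xs x)))"
proof -
  have f: "fold (\<lambda>a s. if p a then a # s else s) ys s = rev (filter p ys) @ s" for p :: "'b \<Rightarrow> bool" and ys s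
    by (induction ys arbitrary: s) auto
  have fs: "vsize (enc_list c (filter p ys)) \<le> vsize (enc_list c ys)" for c p and ys :: "'b list"
    by (induction ys) auto
  have "poly_time D e (\<lambda>x. enc_list (d x) (fold (\<lambda>a s. if P x a then a # s else s) (xs x) []))"
  proof (rule poly_time_fold[OF xs, where I = "\<lambda>_. UNIV" and Z = "\<lambda>x. vsize (enc_list (d x) (xs x))"])
    show "poly_bounded D e (\<lambda>x. vsize (enc_list (d x) (xs x)))" by (rule poly_time_size[OF xs])
    show "vsize (enc_list (d x) (fold (\<lambda>a s. if P x a then a # s else s) ys [])) \<le> vsize (enc_list (d x) (xs x))"
      if "xs x = ys @ zs" for x ys zs
    proof -
      have "vsize (enc_list (d x) (rev (filter (P x) ys))) = vsize (enc_list (d x) (filter (P x) ys))"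
        by (simp add: vsize_enc_list rev_map[symmetric] sum_list_rev)
      also have "\<dots> \<le> vsize (enc_list (d x) ys)" by (rule fs)
      also have "\<dots> \<le> vsize (enc_list (d x) (xs x))" by (simp add: that vsize_enc_list)
      finally show ?thesis by (simp add: f)
    qed
    let ?D = "Sigma D (\<lambda>x. set (xs x) \<times> UNIV)"
    let ?e = "\<lambda>z. VCons (e (fst z)) (VCons (d (fst z) (fst (snd z))) (enc_list (d (fst z)) (snd (snd z))))"
    have *: "poly_time ?D ?e (\<lambda>z. val_of_bool (P (fst z) (fst (snd z))))"
      by (rule poly_time_subst[OF P, where u = "\<lambda>z. (fst z, fst (snd z))", simplified fst_conv snd_conv])
         (auto intro!: poly_time_pair poly_time_fst[OF poly_time_id]
          poly_time_fst[OF poly_time_snd[OF poly_time_id]])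
    have "poly_time ?D ?e (\<lambda>z. if P (fst z) (fst (snd z))
        then VCons (d (fst z) (fst (snd z))) (enc_list (d (fst z)) (snd (snd z)))
        else enc_list (d (fst z)) (snd (snd z)))"
      by (rule poly_time_if[OF *])
         (auto intro!: poly_time_snd[OF poly_time_id] poly_time_snd[OF poly_time_snd[OF poly_time_id]])
    then show "poly_time ?D ?e (\<lambda>z. enc_list (d (fst z))
        (if P (fst z) (fst (snd z)) then fst (snd z) # snd (snd z) else snd (snd z)))"
      by (rule poly_time_cong) auto
  qed (auto intro: poly_time_const)
  then have "poly_time D e (\<lambda>x. enc_list (d x) (rev (filter (P x) (xs x))))" by (simp add: f)
  from poly_time_rev[OF this] show ?thesis by simp
qed

lemma poly_time_append:
  assumes "poly_time D e (\<lambda>x. enc_list (d x) (xs x))" "poly_time D e (\<lambda>x. enc_list (d x) (ys x))"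
  shows "poly_time D e (\<lambda>x. enc_list (d x) (xs x @ ys x))"
proof -
  have "poly_time D e (\<lambda>x. enc_list (d x) (fold (#) (rev (xs x)) (ys x)))"
  proof (rule poly_time_fold[OF poly_time_rev[OF assms(1)], where I = "\<lambda>_. UNIV"
        and Z = "\<lambda>x. vsize (enc_list (d x) (xs x)) + vsize (enc_list (d x) (ys x))"])
    show "vsize (enc_list (d x) (fold (#) us (ys x))) \<le> vsize (enc_list (d x) (xs x)) + vsize (enc_list (d x) (ys x))"
      if "rev (xs x) = us @ zs" for x us zs
    proof -
      have "xs x = rev zs @ rev us" using that by (metis rev_append rev_rev_ident)
      then show ?thesis by (simp add: fold_Cons_rev vsize_enc_list)
    qed
    show "poly_bounded D e (\<lambda>x. vsize (enc_list (d x) (xs x)) + vsize (enc_list (d x) (ys x)))"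
      by (intro poly_bounded_intros poly_time_size assms)
  qed (auto intro: assms poly_time_snd poly_time_id)
  then show ?thesis by (simp add: fold_Cons_rev)
qed

lemma poly_time_bex_list:
  assumes xs: "poly_time D e (\<lambda>x. enc_list (d x) (xs x))"
    and P: "poly_time (Sigma D (\<lambda>x. set (xs x))) (\<lambda>z. VCons (e (fst z)) (d (fst z) (snd z)))
              (\<lambda>z. val_of_bool (P (fst z) (snd z)))"
  shows "poly_time D e (\<lambda>x. val_of_bool (\<exists>a\<in>set (xs x). P x a))"
proof -
  have *: "poly_time D e (\<lambda>x. enc_list (d x) (filter (P x) (xs x)))"
    by (rule poly_time_filter[OF assms])
  have "poly_time D e (\<lambda>x. if \<exists>a\<in>set (xs x). P x a then VNum 1 else VNil)"
  proof (rule poly_time_cong)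
    show "poly_time D e (\<lambda>x. if \<not> (filter (P x) (xs x) = []) then VNum 1 else VNil)"
    proof (rule poly_time_if[OF _ poly_time_const poly_time_const])
      have "poly_time D e (\<lambda>x. val_of_bool (enc_list (d x) (filter (P x) (xs x)) = VNil))"
        by (rule poly_time_op_comp[OF poly_time_pair[OF * poly_time_const[where c = VNil]], where oper = OEq])
           (auto simp: val_of_bool_def intro!: poly_boundedI[where a = "1 + vsize (VNum 1)" and b = 0])
      then have "poly_time D e (\<lambda>x. if enc_list (d x) (filter (P x) (xs x)) = VNil then VNil else VNum 1)"
        by (rule poly_time_if) (rule poly_time_const)+
      then show "poly_time D e (\<lambda>x. val_of_bool (\<not> (filter (P x) (xs x) = [])))"
        by (rule poly_time_cong) (simp add: val_of_bool_def enc_list_eq_VNil)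
    qed
  qed (auto simp: filter_empty_conv)
  then show ?thesis by (simp add: val_of_bool_def)
qed

subsection \<open>Numbers\<close>

lemma floorlog_upper: "n < 2 ^ floorlog 2 n"
  using floorlog_bounds[of n 2] by (cases "n = 0") auto

lemma floorlog_le_self: "floorlog 2 n \<le> n"
  by (rule floorlog_leI) auto

lemma floorlog_mult_le: "floorlog 2 (m * n) \<le> floorlog 2 m + floorlog 2 n"
proof (rule floorlog_leI)
  show "m * n < 2 ^ (floorlog 2 m + floorlog 2 n)"
    unfolding power_add by (rule mult_strict_mono'[OF floorlog_upper floorlog_upper]) auto
qed auto

lemma floorlog_add_le: "floorlog 2 (m + n) \<le> floorlog 2 m + floorlog 2 n + 1"
proof (rule floorlog_leI)
  have "(2::nat) ^ floorlog 2 m \<le> 2 ^ (floorlog 2 m + floorlog 2 n)"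
    "(2::nat) ^ floorlog 2 n \<le> 2 ^ (floorlog 2 m + floorlog 2 n)"
    by (auto intro: power_increasing)
  then show "m + n < 2 ^ (floorlog 2 m + floorlog 2 n + 1)"
    using floorlog_upper[of m] floorlog_upper[of n] unfolding power_add power_one_right by linarith
qed auto

text \<open>Reduction can only shorten a fraction: the reduced denominator divides \<open>b\<close>,
  and the numerator shrinks by the same factor. Bit bounds may therefore be read off from any
  fraction.\<close>

lemma rat_bits_fraction:
  assumes "q = of_int a / of_int b" "b > 0"
  shows "rat_bits q \<le> floorlog 2 (nat \<bar>a\<bar>) + floorlog 2 (nat b)"
proof -
  obtain c d where cd: "quotient_of q = (c, d)" by fastforce
  have d: "d > 0" "coprime c d" "q = of_int c / of_int d"
    using quotient_of_denom_pos[OF cd] quotient_of_coprime[OF cd] quotient_of_div[OF cd] by auto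
  have "of_int (c * b) = (of_int (a * d) :: rat)"
    using assms d by (simp add: field_simps)
  then have eq: "c * b = a * d" by (rule of_int_eq_iff[THEN iffD1])
  then have "d dvd c * b" by simp
  then have "d dvd b" using d(2) by (simp add: coprime_commute coprime_dvd_mult_right_iff)
  then obtain k where k: "b = d * k" by (rule dvdE)
  have "k > 0" using k assms(2) d(1) by (simp add: zero_less_mult_iff)
  have "a = c * k" using eq k d(1) by simp
  then have "\<bar>c\<bar> \<le> \<bar>a\<bar>" using \<open>k > 0\<close> by (simp add: abs_mult mult_le_cancel_left1)
  moreover have "d \<le> b" using k \<open>k > 0\<close> d(1) by (simp add: mult_le_cancel_left1)
  ultimately show ?thesis
    unfolding rat_bits_def cd by (auto intro!: add_mono floorlog_mono)
qed

lemma rat_bits_of_int: "rat_bits (of_int k) \<le> floorlog 2 (nat \<bar>k\<bar>) + 1"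
  using rat_bits_fraction[of "of_int k" k 1] by (simp add: floorlog_def)

lemma vsize_enc_nat: "vsize (enc_nat n) \<le> floorlog 2 n + 2"
  using rat_bits_of_int[of "int n"] by (simp add: enc_nat_def)

lemma vsize_enc_nat_le: "vsize (enc_nat n) \<le> n + 2"
  using vsize_enc_nat[of n] floorlog_le_self[of n] by linarith

lemma rat_bitsE:
  obtains a b where "q = of_int a / of_int b" "b > 0"
    "floorlog 2 (nat \<bar>a\<bar>) + floorlog 2 (nat b) = rat_bits q"
proof -
  obtain c d where cd: "quotient_of q = (c, d)" by fastforce
  show thesis
    by (rule that[of c d]) (use cd quotient_of_denom_pos quotient_of_div in \<open>auto simp: rat_bits_def\<close>)
qed

lemma rat_bits_add: "rat_bits (p + q) \<le> 2 * (rat_bits p + rat_bits q) + 1"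
proof -
  obtain a b where ab: "p = of_int a / of_int b" "b > 0"
    "floorlog 2 (nat \<bar>a\<bar>) + floorlog 2 (nat b) = rat_bits p" by (rule rat_bitsE)
  obtain c d where cd: "q = of_int c / of_int d" "d > 0"
    "floorlog 2 (nat \<bar>c\<bar>) + floorlog 2 (nat d) = rat_bits q" by (rule rat_bitsE)
  have "p + q = of_int (a * d + c * b) / of_int (b * d)"
    using ab cd by (simp add: field_simps)
  then have 1: "rat_bits (p + q) \<le> floorlog 2 (nat \<bar>a * d + c * b\<bar>) + floorlog 2 (nat (b * d))"
    by (rule rat_bits_fraction) (use ab cd in simp)
  have 2: "floorlog 2 (nat \<bar>a * d + c * b\<bar>) \<le> floorlog 2 (nat \<bar>a\<bar> * nat d + nat \<bar>c\<bar> * nat b)"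
  proof (rule floorlog_mono)
    have "\<bar>a * d + c * b\<bar> \<le> \<bar>a\<bar> * d + \<bar>c\<bar> * b"
      using ab cd abs_triangle_ineq[of "a * d" "c * b"] by (simp add: abs_mult)
    then have "nat \<bar>a * d + c * b\<bar> \<le> nat (\<bar>a\<bar> * d + \<bar>c\<bar> * b)" by (rule nat_mono)
    also have "\<dots> = nat \<bar>a\<bar> * nat d + nat \<bar>c\<bar> * nat b"
      using ab cd by (simp add: nat_add_distrib nat_mult_distrib)
    finally show "nat \<bar>a * d + c * b\<bar> \<le> nat \<bar>a\<bar> * nat d + nat \<bar>c\<bar> * nat b" .
  qed
  have 3: "floorlog 2 (nat (b * d)) \<le> floorlog 2 (nat b) + floorlog 2 (nat d)"
    using ab cd by (simp add: nat_mult_distrib floorlog_mult_le)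
  have arith: "r \<le> 2 * (p' + q') + 1"
    if "r \<le> u + v" "u \<le> w" "v \<le> b' + d'" "w \<le> k + l + 1" "k \<le> a' + d'" "l \<le> c' + b'"
      "a' + b' = p'" "c' + d' = q'" for r u v w k l a' b' c' d' p' q' :: nat
  proof -
    have "r \<le> (a' + d') + (c' + b') + 1 + (b' + d')" using that(1-6) by linarith
    also have "\<dots> \<le> 2 * (p' + q') + 1" unfolding that(7,8)[symmetric] by simp
    finally show ?thesis .
  qed
  show ?thesis
    by (rule arith[OF 1 2 3 floorlog_add_le floorlog_mult_le floorlog_mult_le ab(3) cd(3)])
qed

lemma rat_bits_mult: "rat_bits (p * q) \<le> rat_bits p + rat_bits q"
proof -
  obtain a b where ab: "p = of_int a / of_int b" "b > 0"
    "floorlog 2 (nat \<bar>a\<bar>) + floorlog 2 (nat b) = rat_bits p" by (rule rat_bitsE)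
  obtain c d where cd: "q = of_int c / of_int d" "d > 0"
    "floorlog 2 (nat \<bar>c\<bar>) + floorlog 2 (nat d) = rat_bits q" by (rule rat_bitsE)
  have "p * q = of_int (a * c) / of_int (b * d)"
    using ab cd by simp
  then have "rat_bits (p * q) \<le> floorlog 2 (nat \<bar>a * c\<bar>) + floorlog 2 (nat (b * d))"
    by (rule rat_bits_fraction) (use ab cd in simp)
  also have "nat \<bar>a * c\<bar> = nat \<bar>a\<bar> * nat \<bar>c\<bar>" by (simp add: abs_mult nat_mult_distrib)
  also have "nat (b * d) = nat b * nat d" using ab by (simp add: nat_mult_distrib)
  finally show ?thesis
    using floorlog_mult_le[of "nat \<bar>a\<bar>" "nat \<bar>c\<bar>"] floorlog_mult_le[of "nat b" "nat d"] ab cd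
    by linarith
qed

lemma rat_bits_inverse: "rat_bits (inverse p) \<le> rat_bits p + 1"
proof -
  obtain a b where ab: "p = of_int a / of_int b" "b > 0"
    "floorlog 2 (nat \<bar>a\<bar>) + floorlog 2 (nat b) = rat_bits p" by (rule rat_bitsE)
  show ?thesis
  proof (cases "a = 0")
    case True
    then show ?thesis using ab rat_bits_of_int[of 0] by (simp add: floorlog_def)
  next
    case False
    have "inverse p = of_int (sgn a * b) / of_int \<bar>a\<bar>"
      using False unfolding ab(1) by (auto simp: divide_simps sgn_if abs_if)
    then have "rat_bits (inverse p) \<le> floorlog 2 (nat \<bar>sgn a * b\<bar>) + floorlog 2 (nat \<bar>a\<bar>)"
      using False by (intro rat_bits_fraction) auto
    also have "\<bar>sgn a * b\<bar> = b" using False ab(2) by (simp add: abs_mult abs_sgn_eq)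
    finally show ?thesis using ab by linarith
  qed
qed

text \<open>Iterating \<open>rat_bits_add\<close> would double the bound with every summand. Here
  the sum is written over the product of all denominators, so that the exponents \<open>P\<close>
  add up; the extra 1 per summand absorbs the factor 2 that arises from adding two products.\<close>

lemma rat_bits_sum_list:
  "rat_bits (\<Sum>q\<leftarrow>qs. f q) \<le> 2 * (1 + (\<Sum>q\<leftarrow>qs. 1 + rat_bits (f q)))"
proof -
  define P where "P qs = 1 + (\<Sum>q\<leftarrow>qs. 1 + rat_bits (f q))" for qs
  have "\<exists>a b. (\<Sum>q\<leftarrow>qs. f q) = of_int a / of_int b \<and> b > 0 \<and> nat \<bar>a\<bar> < 2 ^ P qs \<and> nat b < 2 ^ P qs"
  proof (induction qs)
    case Nil
    show ?case by (rule exI[of _ 0], rule exI[of _ 1]) (simp add: P_def)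
  next
    case (Cons q qs)
    then obtain a b where ab: "(\<Sum>q\<leftarrow>qs. f q) = of_int a / of_int b" "b > 0"
      "nat \<bar>a\<bar> < 2 ^ P qs" "nat b < 2 ^ P qs" by blast
    obtain c d where cd: "f q = of_int c / of_int d" "d > 0"
      "floorlog 2 (nat \<bar>c\<bar>) + floorlog 2 (nat d) = rat_bits (f q)" by (rule rat_bitsE)
    have c: "nat \<bar>c\<bar> < 2 ^ rat_bits (f q)" "nat d < 2 ^ rat_bits (f q)"
      using floorlog_upper[of "nat \<bar>c\<bar>"] floorlog_upper[of "nat d"]
      by (auto simp: cd(3)[symmetric] elim!: order.strict_trans2 intro!: power_increasing)
    have "(\<Sum>q\<leftarrow>q # qs. f q) = of_int (c * b + a * d) / of_int (b * d)"
      using ab cd by (simp add: field_simps)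
    moreover have "b * d > 0" using ab cd by simp
    moreover have "nat \<bar>c * b + a * d\<bar> < 2 ^ P (q # qs)"
    proof -
      have "\<bar>c * b + a * d\<bar> \<le> \<bar>c\<bar> * b + \<bar>a\<bar> * d"
        using ab cd abs_triangle_ineq[of "c * b" "a * d"] by (simp add: abs_mult)
      then have "nat \<bar>c * b + a * d\<bar> \<le> nat (\<bar>c\<bar> * b + \<bar>a\<bar> * d)" by (rule nat_mono)
      also have "\<dots> = nat \<bar>c\<bar> * nat b + nat \<bar>a\<bar> * nat d"
        using ab cd by (simp add: nat_add_distrib nat_mult_distrib)
      also have "\<dots> < 2 ^ rat_bits (f q) * 2 ^ P qs + 2 ^ P qs * 2 ^ rat_bits (f q)"
        using ab c by (intro add_strict_mono mult_strict_mono') auto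
      also have "\<dots> = 2 ^ P (q # qs)" by (simp add: P_def power_add)
      finally show ?thesis .
    qed
    moreover have "nat (b * d) < 2 ^ P (q # qs)"
    proof -
      have "nat (b * d) = nat b * nat d" using ab by (simp add: nat_mult_distrib)
      also have "\<dots> < 2 ^ P qs * 2 ^ rat_bits (f q)" using ab c by (intro mult_strict_mono') auto
      also have "\<dots> \<le> 2 ^ P (q # qs)" by (simp add: P_def power_add)
      finally show ?thesis .
    qed
    ultimately show ?case by blast
  qed
  then obtain a b where ab: "(\<Sum>q\<leftarrow>qs. f q) = of_int a / of_int b" "b > 0"
    "nat \<bar>a\<bar> < 2 ^ P qs" "nat b < 2 ^ P qs" by blast
  have "rat_bits (\<Sum>q\<leftarrow>qs. f q) \<le> floorlog 2 (nat \<bar>a\<bar>) + floorlog 2 (nat b)"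
    by (rule rat_bits_fraction[OF ab(1,2)])
  also have "\<dots> \<le> P qs + P qs" using ab by (intro add_mono floorlog_leI) auto
  finally show ?thesis by (simp add: P_def)
qed

subsection \<open>Arithmetic and truth values\<close>

lemma poly_time_add:
  assumes "poly_time D e (\<lambda>x. VNum (f x))" "poly_time D e (\<lambda>x. VNum (g x))"
  shows "poly_time D e (\<lambda>x. VNum (f x + g x))"
proof (rule poly_time_op_comp[OF poly_time_pair[OF assms], where oper = OAdd])
  show "poly_bounded D (\<lambda>x. VCons (VNum (f x)) (VNum (g x))) (\<lambda>x. vsize (VNum (f x + g x)))"
  proof (rule poly_boundedI[where a = 2 and b = 1])
    fix x
    show "vsize (VNum (f x + g x)) \<le> 2 * vsize (VCons (VNum (f x)) (VNum (g x))) ^ 1"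
      using rat_bits_add[of "f x" "g x"] by simp
  qed
qed auto

lemma poly_time_mult:
  assumes "poly_time D e (\<lambda>x. VNum (f x))" "poly_time D e (\<lambda>x. VNum (g x))"
  shows "poly_time D e (\<lambda>x. VNum (f x * g x))"
proof (rule poly_time_op_comp[OF poly_time_pair[OF assms], where oper = OMul])
  show "poly_bounded D (\<lambda>x. VCons (VNum (f x)) (VNum (g x))) (\<lambda>x. vsize (VNum (f x * g x)))"
    by (rule poly_boundedI[where a = 1 and b = 1]) (auto intro: le_SucI[OF le_SucI[OF rat_bits_mult]])
qed auto

lemma poly_time_diff:
  assumes "poly_time D e (\<lambda>x. VNum (f x))" "poly_time D e (\<lambda>x. VNum (g x))"
  shows "poly_time D e (\<lambda>x. VNum (f x - g x))"
proof -
  have "poly_time D e (\<lambda>x. VNum (f x + (- 1) * g x))"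
    by (intro poly_time_add poly_time_mult assms poly_time_const)
  then show ?thesis by simp
qed

lemma poly_time_divide:
  assumes "poly_time D e (\<lambda>x. VNum (f x))" "poly_time D e (\<lambda>x. VNum (g x))"
  shows "poly_time D e (\<lambda>x. VNum (f x / g x))"
proof (rule poly_time_op_comp[OF poly_time_pair[OF assms], where oper = ODiv])
  have "rat_bits (p / q) \<le> rat_bits p + rat_bits q + 1" for p q
    using rat_bits_mult[of p "inverse q"] rat_bits_inverse[of q] by (simp add: divide_inverse)
  then show "poly_bounded D (\<lambda>x. VCons (VNum (f x)) (VNum (g x))) (\<lambda>x. vsize (VNum (f x / g x)))"
    by (intro poly_boundedI[where a = 1 and b = 1]) (simp add: le_SucI)
qed auto

lemma poly_time_floor:
  assumes "poly_time D e (\<lambda>x. VNum (f x))"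
  shows "poly_time D e (\<lambda>x. VNum (of_int \<lfloor>f x\<rfloor>))"
proof (rule poly_time_op_comp[OF assms, where oper = OFloor])
  have *: "rat_bits (of_int \<lfloor>q\<rfloor>) \<le> rat_bits q + 2" for q
  proof -
    obtain a b where ab: "q = of_int a / of_int b" "b > 0"
      "floorlog 2 (nat \<bar>a\<bar>) + floorlog 2 (nat b) = rat_bits q" by (rule rat_bitsE)
    have f: "\<lfloor>q\<rfloor> = a div b" using ab by (simp add: floor_divide_of_int_eq)
    have "\<bar>a div b\<bar> \<le> \<bar>a\<bar> + 1"
    proof (cases "a \<ge> 0")
      case True
      have "a div b \<le> a" "a div b \<ge> 0"
        using True ab(2) zdiv_mono2[of a 1 b] by (auto simp: pos_imp_zdiv_nonneg_iff)
      then show ?thesis using True by linarith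
    next
      case False
      have "a div b < 0" using False ab(2) by (simp add: pos_imp_zdiv_neg_iff)
      moreover have "a div b \<ge> a" using False ab(2) zdiv_mono2_neg[of a 1 b] by simp
      ultimately show ?thesis using False by linarith
    qed
    then have "nat \<bar>a div b\<bar> \<le> nat \<bar>a\<bar> + 1" by linarith
    then have "floorlog 2 (nat \<bar>a div b\<bar>) \<le> floorlog 2 (nat \<bar>a\<bar> + 1)" by (rule floorlog_mono)
    also have "\<dots> \<le> floorlog 2 (nat \<bar>a\<bar>) + 1"
    proof (rule floorlog_leI)
      show "nat \<bar>a\<bar> + 1 < 2 ^ (floorlog 2 (nat \<bar>a\<bar>) + 1)"
        using floorlog_upper[of "nat \<bar>a\<bar>"] one_le_power[of "2::nat" "floorlog 2 (nat \<bar>a\<bar>)"]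
        unfolding power_add power_one_right by linarith
    qed auto
    finally have "floorlog 2 (nat \<bar>a div b\<bar>) \<le> floorlog 2 (nat \<bar>a\<bar>) + 1" .
    moreover have "rat_bits (of_int \<lfloor>q\<rfloor>) \<le> floorlog 2 (nat \<bar>a div b\<bar>) + 1"
      unfolding f by (rule rat_bits_of_int)
    moreover have "r \<le> q' + 2" if "l \<le> k + 1" "r \<le> l + 1" "k + m = q'" for r l k m q' :: nat
      using that by linarith
    ultimately show ?thesis using ab(3) by blast
  qed
  show "poly_bounded D (\<lambda>x. VNum (f x)) (\<lambda>x. vsize (VNum (of_int \<lfloor>f x\<rfloor>)))"
  proof (rule poly_boundedI[where a = 3 and b = 1])
    fix x
    show "vsize (VNum (of_int \<lfloor>f x\<rfloor>)) \<le> 3 * vsize (VNum (f x)) ^ 1"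
      using *[of "f x"] by simp
  qed
qed auto

lemma poly_bounded_val_of_bool: "poly_bounded D e (\<lambda>x. vsize (val_of_bool (c x)))"
  by (rule poly_boundedI[where a = "1 + vsize (VNum 1)" and b = 0]) (simp add: val_of_bool_def)

lemma poly_time_less:
  assumes "poly_time D e (\<lambda>x. VNum (f x))" "poly_time D e (\<lambda>x. VNum (g x))"
  shows "poly_time D e (\<lambda>x. val_of_bool (f x < g x))"
  by (rule poly_time_op_comp[OF poly_time_pair[OF assms], where oper = OLess])
     (auto intro: poly_bounded_val_of_bool)

lemma poly_time_eq:
  assumes "poly_time D e f" "poly_time D e g"
  shows "poly_time D e (\<lambda>x. val_of_bool (f x = g x))"
  by (rule poly_time_op_comp[OF poly_time_pair[OF assms], where oper = OEq])
     (auto intro: poly_bounded_val_of_bool)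

lemma poly_time_not:
  assumes "poly_time D e (\<lambda>x. val_of_bool (c x))"
  shows "poly_time D e (\<lambda>x. val_of_bool (\<not> c x))"
proof -
  have "poly_time D e (\<lambda>x. if c x then val_of_bool False else val_of_bool True)"
    by (rule poly_time_if[OF assms]) (rule poly_time_const)+
  then show ?thesis by (rule poly_time_cong) simp
qed

lemma poly_time_conj:
  assumes "poly_time D e (\<lambda>x. val_of_bool (c x))" "poly_time D e (\<lambda>x. val_of_bool (d x))"
  shows "poly_time D e (\<lambda>x. val_of_bool (c x \<and> d x))"
proof -
  have "poly_time D e (\<lambda>x. if c x then val_of_bool (d x) else val_of_bool False)"
    by (rule poly_time_if[OF assms]) (rule poly_time_const)
  then show ?thesis by (rule poly_time_cong) simp
qed

lemma poly_time_disj: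
  assumes "poly_time D e (\<lambda>x. val_of_bool (c x))" "poly_time D e (\<lambda>x. val_of_bool (d x))"
  shows "poly_time D e (\<lambda>x. val_of_bool (c x \<or> d x))"
  using poly_time_not[OF poly_time_conj[OF poly_time_not[OF assms(1)] poly_time_not[OF assms(2)]]]
  by simp

lemma poly_time_le:
  assumes "poly_time D e (\<lambda>x. VNum (f x))" "poly_time D e (\<lambda>x. VNum (g x))"
  shows "poly_time D e (\<lambda>x. val_of_bool (f x \<le> g x))"
  using poly_time_not[OF poly_time_less[OF assms(2,1)]] by (simp add: not_less)

lemma poly_time_nat_add:
  assumes "poly_time D e (\<lambda>x. enc_nat (f x))" "poly_time D e (\<lambda>x. enc_nat (g x))"
  shows "poly_time D e (\<lambda>x. enc_nat (f x + g x))"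
  using poly_time_add assms unfolding enc_nat_def by auto

lemma poly_time_nat_mult:
  assumes "poly_time D e (\<lambda>x. enc_nat (f x))" "poly_time D e (\<lambda>x. enc_nat (g x))"
  shows "poly_time D e (\<lambda>x. enc_nat (f x * g x))"
  using poly_time_mult assms unfolding enc_nat_def by auto

lemma poly_time_nat_less:
  assumes "poly_time D e (\<lambda>x. enc_nat (f x))" "poly_time D e (\<lambda>x. enc_nat (g x))"
  shows "poly_time D e (\<lambda>x. val_of_bool (f x < g x))"
  using poly_time_less[OF assms[unfolded enc_nat_def]] by simp

lemma poly_time_nat_le:
  assumes "poly_time D e (\<lambda>x. enc_nat (f x))" "poly_time D e (\<lambda>x. enc_nat (g x))"
  shows "poly_time D e (\<lambda>x. val_of_bool (f x \<le> g x))"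
  using poly_time_le[OF assms[unfolded enc_nat_def]] by simp

lemma poly_time_nat_eq:
  assumes "poly_time D e (\<lambda>x. enc_nat (f x))" "poly_time D e (\<lambda>x. enc_nat (g x))"
  shows "poly_time D e (\<lambda>x. val_of_bool (f x = g x))"
  using poly_time_eq[OF assms] by (simp add: enc_nat_def)

lemma poly_time_nat_min:
  assumes "poly_time D e (\<lambda>x. enc_nat (f x))" "poly_time D e (\<lambda>x. enc_nat (g x))"
  shows "poly_time D e (\<lambda>x. enc_nat (min (f x) (g x)))"
proof -
  have "poly_time D e (\<lambda>x. if f x \<le> g x then enc_nat (f x) else enc_nat (g x))"
    by (intro poly_time_if poly_time_nat_le assms)
  then show ?thesis by (rule poly_time_cong) (simp add: min_def)
qed

text \<open>The counter is kept in binary, so a polynomial bound on the number of rounds is a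
  separate assumption. \<open>I\<close> confines the iterates to objects with short codes.\<close>

lemma poly_time_funpow:
  assumes n: "poly_time D e (\<lambda>x. enc_nat (n x))" "poly_bounded D e n"
    and init: "poly_time D e (\<lambda>x. ds x (s0 x))"
    and step: "poly_time (Sigma D I) (\<lambda>z. VCons (e (fst z)) (ds (fst z) (snd z)))
                 (\<lambda>z. ds (fst z) (f (fst z) (snd z)))"
    and I: "\<And>x. x \<in> D \<Longrightarrow> s0 x \<in> I x" "\<And>x s. x \<in> D \<Longrightarrow> s \<in> I x \<Longrightarrow> f x s \<in> I x"
    and Z: "poly_bounded D e Z" "\<And>x s. x \<in> D \<Longrightarrow> s \<in> I x \<Longrightarrow> vsize (ds x s) \<le> Z x"
  shows "poly_time D e (\<lambda>x. ds x ((f x ^^ n x) (s0 x)))"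
proof -
  define st where "st x k = (f x ^^ k) (s0 x)" for x k
  have st: "st x k \<in> I x" if "x \<in> D" for x k
    unfolding st_def by (induction k) (use I that in auto)
  define s where "s x k = VCons (e x) (VCons (enc_nat (n x - k)) (ds x (st x k)))" for x k
  have *: "poly_time D' (\<lambda>(x, k). s x k) (\<lambda>z. e (fst z))"
     "poly_time D' (\<lambda>(x, k). s x k) (\<lambda>z. enc_nat (n (fst z) - snd z))"
     "poly_time D' (\<lambda>(x, k). s x k) (\<lambda>z. ds (fst z) (st (fst z) (snd z)))" for D'
    by (simp_all add: s_def case_prod_beta' poly_time_fst[OF poly_time_id]
        poly_time_fst[OF poly_time_snd[OF poly_time_id]]
        poly_time_snd[OF poly_time_snd[OF poly_time_id]])
  have "poly_time D e (\<lambda>x. s x (n x))"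
  proof (rule poly_time_loop)
    show "poly_time D e (\<lambda>x. s x 0)"
      unfolding s_def st_def using n init by (intro poly_time_pair poly_time_id) simp_all
    have "poly_time {(x, k). x \<in> D \<and> k \<le> n x} (\<lambda>(x, k). s x k)
        (\<lambda>z. val_of_bool (0 < n (fst z) - snd z))"
      by (intro poly_time_nat_less poly_time_const *)
    then show "poly_time {(x, k). x \<in> D \<and> k \<le> n x} (\<lambda>(x, k). s x k)
        (\<lambda>(x, k). val_of_bool (0 < n x - k))" by (simp add: case_prod_beta')
    show "val_of_bool (0 < n x - k) \<noteq> VNil \<longleftrightarrow> k < n x" for x k
      by (simp add: val_of_bool_def)
    show "poly_time {(x, k). x \<in> D \<and> k < n x} (\<lambda>(x, k). s x k) (\<lambda>(x, k). s x (Suc k))"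
    proof -
      let ?D = "{(x, k). x \<in> D \<and> k < n x}"
      have "poly_time ?D (\<lambda>(x, k). s x k) (\<lambda>z. VNum (of_nat (n (fst z) - snd z) - 1))"
        by (intro poly_time_diff poly_time_const *(2)[unfolded enc_nat_def])
      then have 1: "poly_time ?D (\<lambda>(x, k). s x k) (\<lambda>z. enc_nat (n (fst z) - Suc (snd z)))"
        by (rule poly_time_cong) (auto simp: enc_nat_def of_nat_diff)
      have "poly_time ?D (\<lambda>(x, k). s x k) (\<lambda>z. ds (fst z) (f (fst z) (st (fst z) (snd z))))"
        by (rule poly_time_subst[OF step, where u = "\<lambda>z. (fst z, st (fst z) (snd z))", simplified fst_conv snd_conv])
           (auto intro!: poly_time_pair * st)
      then have 2: "poly_time ?D (\<lambda>(x, k). s x k) (\<lambda>z. ds (fst z) (st (fst z) (Suc (snd z))))"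
        by (simp add: st_def)
      have "poly_time ?D (\<lambda>(x, k). s x k) (\<lambda>z. s (fst z) (Suc (snd z)))"
        using * 1 2 unfolding s_def[of "fst _" "Suc _"] by (intro poly_time_pair)
      then show ?thesis by (simp add: case_prod_beta')
    qed
    show "poly_bounded D e (\<lambda>x. 4 + vsize (e x) + n x + Z x)"
      by (intro poly_bounded_intros n Z)
    show "vsize (s x k) \<le> 4 + vsize (e x) + n x + Z x" if "x \<in> D" "k \<le> n x" for x k
      using Z(2)[OF that(1) st[OF that(1)], of k] vsize_enc_nat_le[of "n x - k"]
      by (simp add: s_def)
  qed (rule n)
  then have "poly_time D e (\<lambda>x. ds x (st x (n x)))"
    unfolding s_def by (rule poly_time_snd[OF poly_time_snd])
  then show ?thesis by (simp add: st_def)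
qed

lemma poly_time_sum_list:
  assumes xs: "poly_time D e (\<lambda>x. enc_list (d x) (xs x))"
    and g: "poly_time (Sigma D (\<lambda>x. set (xs x))) (\<lambda>z. VCons (e (fst z)) (d (fst z) (snd z)))
              (\<lambda>z. VNum (g (fst z) (snd z)))"
  shows "poly_time D e (\<lambda>x. VNum (\<Sum>a\<leftarrow>xs x. g x a))"
proof -
  \<comment> \<open>The summands are tabulated first; the length of this table then bounds the
    partial sums.\<close>
  define h where "h x a = VNum (g x a)" for x a
  have ys: "poly_time D e (\<lambda>x. enc_list (h x) (xs x))"
    unfolding h_def by (rule poly_time_map[OF xs g])
  have f: "fold (\<lambda>a s. g x a + s) ys s = (\<Sum>a\<leftarrow>ys. g x a) + s" for x ys s
    by (induction ys arbitrary: s) (auto simp: ac_simps)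
  have "poly_time D e (\<lambda>x. VNum (fold (\<lambda>a s. g x a + s) (xs x) 0))"
  proof (rule poly_time_fold[OF ys, where I = "\<lambda>_. UNIV" and Z = "\<lambda>x. 3 + 2 * vsize (enc_list (h x) (xs x))"])
    show "poly_bounded D e (\<lambda>x. 3 + 2 * vsize (enc_list (h x) (xs x)))"
      by (intro poly_bounded_intros poly_time_size ys)
    show "vsize (VNum (fold (\<lambda>a s. g x a + s) ys 0)) \<le> 3 + 2 * vsize (enc_list (h x) (xs x))"
      if "xs x = ys @ zs" for x ys zs
    proof -
      have "(\<Sum>q\<leftarrow>ys. 1 + rat_bits (g x q)) \<le> (\<Sum>q\<leftarrow>xs x. 1 + vsize (h x q))"
        unfolding that h_def by (simp add: sum_list_mono trans_le_add1)
      then show ?thesis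
        using rat_bits_sum_list[of "g x" ys] by (simp add: f vsize_enc_list)
    qed
    show "poly_time (SIGMA x:D. set (xs x) \<times> UNIV)
       (\<lambda>z. VCons (e (fst z)) (VCons (h (fst z) (fst (snd z))) (VNum (snd (snd z)))))
       (\<lambda>z. VNum (g (fst z) (fst (snd z)) + snd (snd z)))"
      unfolding h_def
      by (intro poly_time_add poly_time_fst[OF poly_time_snd[OF poly_time_id]]
          poly_time_snd[OF poly_time_snd[OF poly_time_id]])
  qed (rule poly_time_const, simp)
  then show ?thesis by (simp add: f)
qed

section \<open>The algorithm\<close>

text \<open>Adjacency of clients in the square of the bipartite graph: one link stands for two
  hops.\<close>

definition linked :: "instance_hck \<Rightarrow> nat \<Rightarrow> nat \<Rightarrow> bool" where
  "linked I j j' \<longleftrightarrow> (\<exists>i\<in>facs I. adjacent I i j \<and> adjacent I i j')"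

definition spread :: "instance_hck \<Rightarrow> nat set \<Rightarrow> nat set \<Rightarrow> nat set" where
  "spread I C B = {j\<in>C. j \<in> B \<or> (\<exists>j'\<in>B. linked I j' j)}"

definition client_ball :: "instance_hck \<Rightarrow> nat set \<Rightarrow> nat \<Rightarrow> nat \<Rightarrow> nat set" where
  "client_ball I C t j = (spread I C ^^ t) {j}"

text \<open>Chosen such that \<open>(1 + 1 / N) ^ (horizon N - 1)\<close> exceeds \<open>plenty_const N * jump_const N\<close>.\<close>

definition horizon :: "nat \<Rightarrow> nat" where
  "horizon N = 1 + N * (22 + 7 * floorlog 2 N)"

definition thin :: "instance_hck \<Rightarrow> nat \<Rightarrow> nat set \<Rightarrow> nat set \<Rightarrow> bool" where
  "thin I N C B \<longleftrightarrow> N * card (spread I C B) \<le> (N + 1) * card B"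

definition grow :: "instance_hck \<Rightarrow> nat \<Rightarrow> nat set \<Rightarrow> nat set \<Rightarrow> nat set" where
  "grow I N C B = (if thin I N C B then B else spread I C B)"

text \<open>
  \<open>horizon N\<close> may be exponential in the bit-length of the input; as \<open>grow\<close> stops at the latest when
  all clients are reached, the minimum makes no difference to the result.
\<close>

definition core :: "instance_hck \<Rightarrow> nat \<Rightarrow> nat set \<Rightarrow> nat \<Rightarrow> nat set" where
  "core I N C j = (grow I N C ^^ min (horizon N) (card (clients I))) {j}"

text \<open>Taking the least eligible client makes the procedure deterministic. The ball is recorded
  without the layer that is removed together with it.\<close>

definition carve :: "instance_hck \<Rightarrow> nat \<Rightarrow> nat set \<times> nat set list \<Rightarrow> nat set \<times> nat set list" where
  "carve I N s =
     (if {j\<in>fst s. thin I N (fst s) (core I N (fst s) j)} = {} then s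
      else (let J = core I N (fst s) (Min {j\<in>fst s. thin I N (fst s) (core I N (fst s) j)})
            in (fst s - spread I (fst s) J, J # snd s)))"

definition carved :: "instance_hck \<Rightarrow> nat \<Rightarrow> nat set \<times> nat set list" where
  "carved I N = (carve I N ^^ card (clients I)) (clients I, [])"

definition rest :: "instance_hck \<Rightarrow> nat \<Rightarrow> nat set" where
  "rest I N = fst (carved I N)"

definition rball :: "instance_hck \<Rightarrow> nat \<Rightarrow> nat \<Rightarrow> nat \<Rightarrow> nat set" where
  "rball I N t j = client_ball I (rest I N) t j"

text \<open>\<open>k = 0\<close> gives the size by which clients are ranked. \<open>k = 1\<close>
  and \<open>k = 2\<close> add one or two layers, which is where the clients of boundary facilities
  lie.\<close>

definition weight :: "instance_hck \<Rightarrow> nat \<Rightarrow> nat \<Rightarrow> nat \<Rightarrow> nat" where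
  "weight I N k j = card (rball I N (horizon N + k) j)"

text \<open>
  A cluster is charged at most \<open>load_const N\<close> times the maximal degree of a facility. If degrees are
  at most \<open>1 / plenty_const N\<close> of a region, this is a fraction \<open>1 / (4 * N)\<close> of the region;
  \<open>jump_const\<close> serves the same purpose for the layers around closed sinks.
\<close>

definition load_const :: "nat \<Rightarrow> nat" where
  "load_const N = 100 * N * (N + 1)"

definition plenty_const :: "nat \<Rightarrow> nat" where
  "plenty_const N = 4 * N * load_const N"

definition jump_const :: "nat \<Rightarrow> nat" where
  "jump_const N = 4 * N * plenty_const N"

text \<open>The separation leaves balls of radius \<open>horizon N + 2\<close> around different
  sinks unlinked, for which a distance exceeding \<open>2 * (horizon N + 2) + 1\<close> is
  sufficient.\<close>

definition add_sink :: "instance_hck \<Rightarrow> nat \<Rightarrow> nat set \<Rightarrow> nat set" where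
  "add_sink I N A =
     (let X = {j\<in>rest I N. \<forall>a\<in>A. a \<notin> rball I N (2 * horizon N + 6) j}
      in if X = {} then A
         else insert (Min {j\<in>X. \<forall>k\<in>X. weight I N 0 k \<le> weight I N 0 j}) A)"

definition sinks :: "instance_hck \<Rightarrow> nat \<Rightarrow> nat set" where
  "sinks I N = (add_sink I N ^^ card (clients I)) {}"

definition home :: "instance_hck \<Rightarrow> nat \<Rightarrow> nat \<Rightarrow> nat" where
  "home I N j =
     Min {a\<in>sinks I N. a \<in> rball I N (2 * horizon N + 6) j \<and> weight I N 0 j \<le> weight I N 0 a}"

text \<open>The radius is the sum of \<open>horizon N + 2\<close> and
  \<open>2 * horizon N + 6\<close>: the home of every client within \<open>horizon N + 2\<close> of
  \<open>a\<close> is a candidate. The comparison is with \<open>weight I N 2 a\<close> because this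
  is the size of the region of a parentless sink.\<close>

definition parents :: "instance_hck \<Rightarrow> nat \<Rightarrow> nat \<Rightarrow> nat set" where
  "parents I N a =
     {b\<in>sinks I N. b \<in> rball I N (3 * horizon N + 8) a \<and>
        jump_const N * weight I N 2 a \<le> weight I N 0 b}"

definition children :: "instance_hck \<Rightarrow> nat \<Rightarrow> nat \<Rightarrow> nat set" where
  "children I N b = {a\<in>sinks I N. parents I N a \<noteq> {} \<and> Min (parents I N a) = b}"

text \<open>The regions of children have radius \<open>horizon N + 1\<close>, whereas facilities
  adjacent to such a region have their remaining clients within \<open>horizon N + 2\<close>; hence
  the different offsets on the two sides.\<close>

definition plentiful :: "instance_hck \<Rightarrow> nat \<Rightarrow> nat \<Rightarrow> bool" where
  "plentiful I N b \<longleftrightarrow>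
     (\<forall>a\<in>children I N b. plenty_const N * weight I N 2 a \<le> (\<Sum>c\<in>children I N b. weight I N 1 c))"

definition closed_sinks :: "instance_hck \<Rightarrow> nat \<Rightarrow> nat set" where
  "closed_sinks I N =
     {a\<in>sinks I N. parents I N a \<noteq> {} \<and> \<not> plentiful I N (Min (parents I N a))}"

text \<open>The children of a plentiful sink \<open>b\<close> are represented by one of themselves
  and not by \<open>b\<close>, since \<open>b\<close> carries a label in its own right and may have
  to pay for other clients.\<close>

definition label :: "instance_hck \<Rightarrow> nat \<Rightarrow> nat \<Rightarrow> nat" where
  "label I N a =
     (if parents I N a \<noteq> {} \<and> plentiful I N (Min (parents I N a))
      then Min (children I N (Min (parents I N a))) else a)"

text \<open>Without a parent, nearby weights are controlled by the ball of radius
  \<open>horizon N + 2\<close>, so this ball has to be the region; for grouped children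
  \<open>plentiful\<close> refers to radius \<open>horizon N + 1\<close>.\<close>

definition radius :: "instance_hck \<Rightarrow> nat \<Rightarrow> nat \<Rightarrow> nat" where
  "radius I N a = horizon N + (if parents I N a = {} then 2 else 1)"

definition live :: "instance_hck \<Rightarrow> nat \<Rightarrow> nat set" where
  "live I N = {j\<in>rest I N. \<forall>a\<in>closed_sinks I N. j \<notin> rball I N (horizon N + 1) a}"

definition open_facs :: "instance_hck \<Rightarrow> nat \<Rightarrow> nat set" where
  "open_facs I N =
     {i\<in>facs I. (\<exists>j\<in>rest I N. adjacent I i j) \<and>
        (\<forall>a\<in>closed_sinks I N. \<forall>j\<in>rball I N (horizon N) a. \<not> adjacent I i j)}"

text \<open>All clients of such a facility lie in layers removed by carving, so it receives no
  assignment and can form a part by itself.\<close>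

definition lone_facs :: "instance_hck \<Rightarrow> nat \<Rightarrow> nat set" where
  "lone_facs I N =
     {i\<in>facs I. (\<forall>j\<in>rest I N. \<not> adjacent I i j) \<and>
        (\<forall>J\<in>set (snd (carved I N)). \<forall>j\<in>J. \<not> adjacent I i j)}"

text \<open>These sinks have priority over the home sink, so that clients inside a region lose mass
  to one cluster only. By the separation of sinks there is at most one of them.\<close>

definition forced :: "instance_hck \<Rightarrow> nat \<Rightarrow> nat \<Rightarrow> nat set" where
  "forced I N i =
     {a\<in>sinks I N. a \<notin> closed_sinks I N \<and> (\<exists>j\<in>rball I N (radius I N a) a. adjacent I i j)}"

definition centre :: "instance_hck \<Rightarrow> nat \<Rightarrow> nat \<Rightarrow> nat" where
  "centre I N i =
     (if forced I N i = {} then home I N (Min {j\<in>rest I N. adjacent I i j}) else Min (forced I N i))"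

definition cluster :: "instance_hck \<Rightarrow> nat \<Rightarrow> nat \<Rightarrow> nat set" where
  "cluster I N l = {i\<in>open_facs I N. label I N (centre I N i) = l}"

definition kept :: "instance_hck \<Rightarrow> nat \<Rightarrow> yvars \<Rightarrow> nat \<Rightarrow> nat \<Rightarrow> bool" where
  "kept I N y l p \<longleftrightarrow>
     real N + 1 \<le> (\<Sum>q\<in>{p..num_types I}. \<Sum>i\<in>cluster I N l. y i q)"

definition new_x :: "instance_hck \<Rightarrow> nat \<Rightarrow> xvars \<Rightarrow> yvars \<Rightarrow> xvars" where
  "new_x I N x y i j p =
     (if j \<in> live I N \<and> i \<in> open_facs I N \<and> kept I N y (label I N (centre I N i)) p
      then x i j p else 0)"

definition bad :: "instance_hck \<Rightarrow> nat \<Rightarrow> xvars \<Rightarrow> yvars \<Rightarrow> nat set" where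
  "bad I N x y =
     {j\<in>live I N. (\<Sum>i\<in>facs I. \<Sum>p\<in>types I. new_x I N x y i j p) < 1 - 1 / (100 * real N)}"

definition cores :: "instance_hck \<Rightarrow> nat \<Rightarrow> nat set list" where
  "cores I N =
     snd (carved I N) @ map (rball I N (horizon N)) (sorted_list_of_set (closed_sinks I N))"

definition decompose :: "instance_hck \<Rightarrow> nat \<Rightarrow> xvars \<Rightarrow> yvars \<Rightarrow> decomposition" where
  "decompose I N x y =
     \<lparr>xbar = new_x I N x y,
      S_fam = map (cluster I N) (filter (\<lambda>l. cluster I N l \<noteq> {}) (sorted_list_of_set (sinks I N))) @
        map (\<lambda>i. {i}) (sorted_list_of_set (lone_facs I N)),
      T_fam = map (\<lambda>J. (nbrs I J, J)) (cores I N),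
      C_del = clients I - \<Union> (set (cores I N)) - (live I N - bad I N x y),
      C_T = \<Union> (set (cores I N)),
      C_S = live I N - bad I N x y\<rparr>"

section \<open>Balls of clients\<close>

lemma linked_sym: "linked I j j' \<Longrightarrow> linked I j' j"
  by (auto simp: linked_def)

lemma spread_subset: "spread I C B \<subseteq> C"
  by (auto simp: spread_def)

lemma spread_incl: "B \<subseteq> C \<Longrightarrow> B \<subseteq> spread I C B"
  by (auto simp: spread_def)

lemma spread_mono: "B \<subseteq> B' \<Longrightarrow> spread I C B \<subseteq> spread I C B'"
  by (auto simp: spread_def)

lemma client_ball_0 [simp]: "client_ball I C 0 j = {j}"
  by (simp add: client_ball_def)

lemma client_ball_Suc: "client_ball I C (Suc t) j = spread I C (client_ball I C t j)"
  by (simp add: client_ball_def)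

lemma client_ball_subset: "j \<in> C \<Longrightarrow> client_ball I C t j \<subseteq> C"
  using spread_subset by (cases t) (auto simp: client_ball_Suc)

lemma client_ball_mono_Suc: "j \<in> C \<Longrightarrow> client_ball I C t j \<subseteq> client_ball I C (Suc t) j"
  unfolding client_ball_Suc by (rule spread_incl) (rule client_ball_subset)

lemma client_ball_mono: "j \<in> C \<Longrightarrow> s \<le> t \<Longrightarrow> client_ball I C s j \<subseteq> client_ball I C t j"
  by (rule lift_Suc_mono_le[of "\<lambda>t. client_ball I C t j"]) (rule client_ball_mono_Suc)

lemma client_ball_self: "j \<in> C \<Longrightarrow> j \<in> client_ball I C t j"
  using client_ball_mono[of j C 0 t] by fastforce

lemma client_ball_add: "client_ball I C (s + t) j = (spread I C ^^ t) (client_ball I C s j)"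
  unfolding client_ball_def by (subst add.commute) (simp add: funpow_add)

lemma spread_funpow_mono: "B \<subseteq> B' \<Longrightarrow> (spread I C ^^ t) B \<subseteq> (spread I C ^^ t) B'"
  by (induction t) (auto intro: spread_mono[THEN subsetD])

lemma client_ball_trans: "k \<in> client_ball I C s j \<Longrightarrow> l \<in> client_ball I C t k \<Longrightarrow> l \<in> client_ball I C (s + t) j"
  unfolding client_ball_add using spread_funpow_mono[of "{k}" "client_ball I C s j" t I C] by (auto simp: client_ball_def)

lemma client_ball_step: "j \<in> C \<Longrightarrow> k \<in> C \<Longrightarrow> linked I j k \<Longrightarrow> k \<in> client_ball I C 1 j"
  by (auto simp: client_ball_Suc spread_def)

lemma client_ball_sym: "j \<in> C \<Longrightarrow> k \<in> client_ball I C t j \<Longrightarrow> j \<in> client_ball I C t k"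
proof (induction t arbitrary: k)
  case (Suc t)
  have k: "k \<in> C" by (rule subsetD[OF client_ball_subset[OF Suc.prems(1)] Suc.prems(2)])
  from Suc.prems(2) consider "k \<in> client_ball I C t j" | l where "l \<in> client_ball I C t j" "linked I l k"
    unfolding client_ball_Suc spread_def by auto
  then show ?case
  proof cases
    case 1
    from Suc.IH[OF Suc.prems(1) this] show ?thesis using client_ball_mono_Suc[OF k] by blast
  next
    case 2
    have l: "l \<in> C" by (rule subsetD[OF client_ball_subset[OF Suc.prems(1)] 2(1)])
    have "l \<in> client_ball I C 1 k" by (rule client_ball_step[OF k l linked_sym[OF 2(2)]])
    from client_ball_trans[OF this Suc.IH[OF Suc.prems(1) 2(1)]] show ?thesis by simp
  qed
qed auto

subsection \<open>Distances\<close>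

text \<open>\<open>t\<close> counts links; path lengths are even because both ends are
  clients.\<close>

definition hops :: "instance_hck \<Rightarrow> nat \<Rightarrow> nat \<Rightarrow> nat \<Rightarrow> bool" where
  "hops I t j k \<longleftrightarrow> (\<exists>n\<le>t. (Inr j, Inr k) \<in> graph I ^^ (2 * n))"

lemma hops_refl: "hops I t j j"
  unfolding hops_def by (rule exI[of _ 0]) simp

lemma linked_hops: "linked I j k \<Longrightarrow> hops I 1 j k"
proof -
  assume "linked I j k"
  then obtain i where "adjacent I i j" "adjacent I i k" by (auto simp: linked_def)
  then have "(Inr j, Inl i) \<in> graph I" "(Inl i, Inr k) \<in> graph I" by (auto simp: graph_def)
  then have "(Inr j, Inr k) \<in> graph I ^^ (2 * 1)" by (auto simp: numeral_2_eq_2)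
  then show ?thesis unfolding hops_def by blast
qed

lemma hops_trans: "hops I s j k \<Longrightarrow> hops I t k l \<Longrightarrow> hops I (s + t) j l"
proof -
  assume "hops I s j k" "hops I t k l"
  then obtain m n where mn: "m \<le> s" "n \<le> t" "(Inr j, Inr k) \<in> graph I ^^ (2 * m)"
    "(Inr k, Inr l) \<in> graph I ^^ (2 * n)" by (auto simp: hops_def)
  then have "(Inr j, Inr l) \<in> graph I ^^ (2 * m + 2 * n)"
    unfolding relpow_add by (rule_tac relcompI)
  then show ?thesis
    using mn unfolding hops_def by (intro exI[of _ "m + n"]) (simp add: algebra_simps)
qed

lemma hops_mono: "hops I s j k \<Longrightarrow> s \<le> t \<Longrightarrow> hops I t j k"
  by (auto simp: hops_def intro: le_trans)

lemma graph_sym: "sym (graph I)"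
  by (auto simp: sym_def graph_def)

lemma hops_sym: "hops I t j k \<Longrightarrow> hops I t k j"
proof -
  have "(u, v) \<in> graph I ^^ n \<Longrightarrow> (v, u) \<in> graph I ^^ n" for u v n
  proof (induction n arbitrary: v)
    case (Suc n)
    then obtain w where "(u, w) \<in> graph I ^^ n" "(w, v) \<in> graph I" by auto
    then have "(v, w) \<in> graph I" "(w, u) \<in> graph I ^^ n" using Suc graph_sym[of I] by (auto simp: sym_def)
    then show ?case by (rule relpow_Suc_I2)
  qed simp
  then show "hops I t j k \<Longrightarrow> hops I t k j" by (auto simp: hops_def)
qed

lemma client_ball_hops: "k \<in> client_ball I C t j \<Longrightarrow> hops I t j k"
proof (induction t arbitrary: k)
  case (Suc t)
  then consider "k \<in> client_ball I C t j" | l where "l \<in> client_ball I C t j" "linked I l k"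
    unfolding client_ball_Suc spread_def by auto
  then show ?case
  proof cases
    case 1
    then show ?thesis using Suc hops_mono[of I t j k "Suc t"] by simp
  next
    case 2
    then show ?thesis using Suc hops_trans[of I t j l 1 k] linked_hops by simp
  qed
qed (simp add: hops_refl)

lemma hop_dist_le:
  assumes "hops I t j k" "adjacent I i j" "adjacent I i' k"
  shows "hop_dist I (Inl i) (Inl i') \<le> enat (2 * t + 2)"
proof -
  obtain n where n: "n \<le> t" "(Inr j, Inr k) \<in> graph I ^^ (2 * n)"
    using assms(1) by (auto simp: hops_def)
  have "(Inl i, Inr j) \<in> graph I" "(Inr k, Inl i') \<in> graph I" using assms by (auto simp: graph_def)
  then have "(Inl i, Inl i') \<in> graph I ^^ Suc (Suc (2 * n))"
    using n(2) by (intro relpow_Suc_I[of _ "Inr k"] relpow_Suc_I2[of _ "Inr j"])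
  then have "hop_dist I (Inl i) (Inl i') \<le> enat (Suc (Suc (2 * n)))"
    unfolding hop_dist_def by (intro INF_lower) simp
  also have "\<dots> \<le> enat (2 * t + 2)" using n by simp
  finally show ?thesis .
qed

lemma diam_G_le:
  assumes "\<And>i i'. i \<in> S \<Longrightarrow> i' \<in> S \<Longrightarrow> hop_dist I (Inl i) (Inl i') \<le> enat n"
  shows "ereal_of_enat (diam_G I S) \<le> ereal (real n)"
proof -
  have "diam_G I S \<le> enat n" unfolding diam_G_def using assms by (intro SUP_least)
  then have "ereal_of_enat (diam_G I S) \<le> ereal_of_enat (enat n)" by (simp only: ereal_of_enat_le_iff)
  then show ?thesis by simp
qed

lemma hops_dist:
  assumes "wf_instance I" "j \<in> clients I" "hops I t j k"
  shows "k \<in> clients I \<and> distf I j k \<le> 2 * real t * opt I"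
proof -
  interpret Metric_space "points I" "distf I" using assms(1) by (simp add: wf_instance_def)
  have o: "opt I > 0" using assms(1) by (simp add: wf_instance_def)
  have pt: "j' \<in> clients I \<Longrightarrow> j' \<in> points I" "i \<in> facs I \<Longrightarrow> i \<in> points I" for i j'
    by (auto simp: points_def)
  have *: "k \<in> clients I \<and> distf I j k \<le> 2 * real n * opt I"
    if "(Inr j, Inr k) \<in> graph I ^^ (2 * n)" for n k
    using that
  proof (induction n arbitrary: k)
    case 0
    then show ?case using assms(2) pt by simp
  next
    case (Suc n)
    from Suc.prems have "(Inr j, Inr k) \<in> graph I ^^ Suc (Suc (2 * n))" by simp
    then obtain u v where "(Inr j, u) \<in> graph I ^^ (2 * n)" "(u, v) \<in> graph I" "(v, Inr k) \<in> graph I"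
      by (meson relpow_Suc_E)
    then obtain i l where il: "u = Inr l" "adjacent I i l" "adjacent I i k"
      by (auto simp: graph_def)
    then have l: "l \<in> clients I" "distf I j l \<le> 2 * real n * opt I"
      using Suc.IH[of l] \<open>(Inr j, u) \<in> _\<close> by auto
    have a: "i \<in> facs I" "k \<in> clients I" "distf I i l \<le> opt I" "distf I i k \<le> opt I"
      using il by (auto simp: adjacent_def)
    have "distf I j k \<le> distf I j l + distf I l k"
      using assms(2) l a pt by (intro triangle) auto
    moreover have "distf I l k \<le> distf I l i + distf I i k"
      using assms(2) l a pt by (intro triangle) auto
    ultimately show ?case using a l commute[of l i] by (simp add: algebra_simps)
  qed
  obtain n where n: "n \<le> t" "(Inr j, Inr k) \<in> graph I ^^ (2 * n)"
    using assms(3) by (auto simp: hops_def)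
  have "2 * real n * opt I \<le> 2 * real t * opt I" using n o by simp
  then show ?thesis using *[OF n(2)] by linarith
qed

subsection \<open>Growth\<close>

text \<open>Origin of the numbers in \<open>horizon\<close>: the product of the two constants is at
  most \<open>2560000 * N ^ 7\<close>, the coefficient is below \<open>2 ^ 22\<close>, and by
  Bernoulli each block of \<open>N\<close> steps doubles the ball.\<close>

lemma horizon_growth:
  assumes "N \<ge> 1"
  shows "real (plenty_const N * jump_const N) \<le> (1 + 1 / real N) ^ (horizon N - 1)"
proof -
  define l where "l = floorlog 2 N"
  have N: "N \<le> 2 ^ l" using floorlog_upper[of N] unfolding l_def by simp
  have pow: "N ^ 5 = N * N * N * N * N" "N ^ 7 = N * N * N * N * N * N * N"
    by (simp_all add: eval_nat_numeral)
  have "plenty_const N * jump_const N = 640000 * N ^ 5 * ((N + 1) * (N + 1))"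
    by (simp add: plenty_const_def jump_const_def load_const_def pow algebra_simps)
  also have "\<dots> \<le> 640000 * N ^ 5 * ((2 * N) * (2 * N))"
    using assms by (intro mult_le_mono) auto
  also have "\<dots> = 2560000 * N ^ 7" by (simp add: pow)
  also have "\<dots> \<le> 2 ^ 22 * (2 ^ l) ^ 7" by (intro mult_le_mono power_mono N) auto
  also have "\<dots> = 2 ^ (22 + 7 * l)" by (simp add: power_add power_mult[symmetric] mult.commute)
  finally have "real (plenty_const N * jump_const N) \<le> real (2 ^ (22 + 7 * l))"
    by (simp only: of_nat_le_iff)
  also have "\<dots> = 2 ^ (22 + 7 * l)" by simp
  also have "\<dots> \<le> ((1 + 1 / real N) ^ N) ^ (22 + 7 * l)"
  proof (rule power_mono)
    have "1 + real N * (1 / real N) \<le> (1 + 1 / real N) ^ N"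
      by (rule Bernoulli_inequality) (use zero_le_divide_1_iff[of "real N"] in linarith)
    then show "2 \<le> (1 + 1 / real N) ^ N" using assms by simp
  qed simp
  also have "\<dots> = (1 + 1 / real N) ^ (horizon N - 1)"
    by (simp add: horizon_def l_def power_mult)
  finally show ?thesis .
qed

text \<open>Growth is measured from radius 1 and not from radius 0, since it is the 1-ball that
  bounds degrees of facilities. This costs the summand 1 in \<open>horizon\<close>.\<close>

lemma client_ball_growth:
  assumes "finite C" "j \<in> C" "N \<ge> 1" "\<And>t. t < horizon N \<Longrightarrow> \<not> thin I N C (client_ball I C t j)"
  shows "plenty_const N * jump_const N * card (client_ball I C 1 j) \<le> card (client_ball I C (horizon N) j)"
proof -
  have h: "horizon N \<ge> 1" by (simp add: horizon_def)
  have *: "(1 + 1 / real N) ^ t * card (client_ball I C 1 j) \<le> card (client_ball I C (1 + t) j)"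
    if "t < horizon N" for t
    using that
  proof (induction t)
    case (Suc t)
    have "N * card (client_ball I C (Suc (1 + t)) j) > (N + 1) * card (client_ball I C (1 + t) j)"
      using assms(4)[of "1 + t"] Suc.prems by (simp add: thin_def client_ball_Suc)
    then have "real N * card (client_ball I C (Suc (1 + t)) j) \<ge> (real N + 1) * card (client_ball I C (1 + t) j)"
      by (metis (mono_tags) less_imp_le of_nat_1 of_nat_add of_nat_mono of_nat_mult)
    then have "(1 + 1 / real N) * card (client_ball I C (1 + t) j) \<le> card (client_ball I C (Suc (1 + t)) j)"
      using assms(3) by (simp add: field_simps)
    moreover have "(1 + 1 / real N) ^ Suc t * card (client_ball I C 1 j)
        \<le> (1 + 1 / real N) * card (client_ball I C (1 + t) j)"
      using Suc by (simp add: mult.assoc mult_left_mono)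
    ultimately show ?case by simp
  qed simp
  have "real (plenty_const N * jump_const N) * card (client_ball I C 1 j)
      \<le> (1 + 1 / real N) ^ (horizon N - 1) * card (client_ball I C 1 j)"
    by (intro mult_right_mono horizon_growth assms) auto
  also have "\<dots> \<le> card (client_ball I C (horizon N) j)" using *[of "horizon N - 1"] h by simp
  finally have "real (plenty_const N * jump_const N * card (client_ball I C 1 j)) \<le> card (client_ball I C (horizon N) j)"
    by simp
  then show ?thesis by (simp only: of_nat_le_iff)
qed

section \<open>Carving off balls of slow growth\<close>

locale setting =
  fixes I :: instance_hck and x :: xvars and y :: yvars and N :: nat
  assumes wf: "wf_instance I" and feas: "feasible I x y" and N: "N \<ge> 1"
begin

abbreviation "h \<equiv> horizon N"
abbreviation "C0 \<equiv> clients I"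

lemma finite_clients [simp]: "finite C0" and finite_facs [simp]: "finite (facs I)"
  using wf by (auto simp: wf_instance_def points_def)

lemma client_has_facility:
  assumes "j \<in> C0"
  obtains i where "adjacent I i j"
proof -
  have "(\<Sum>i\<in>facs I. \<Sum>p\<in>types I. x i j p) \<ge> 1"
    using feas assms by (auto simp: feasible_def L1_def)
  then have "(\<Sum>i\<in>facs I. \<Sum>p\<in>types I. x i j p) \<noteq> 0" by linarith
  then obtain i where i: "i \<in> facs I" "(\<Sum>p\<in>types I. x i j p) \<noteq> 0"
    by (rule sum.not_neutral_contains_not_neutral)
  from i(2) obtain p where p: "p \<in> types I" "x i j p \<noteq> 0"
    by (rule sum.not_neutral_contains_not_neutral)
  have "\<not> distf I i j > opt I"
    using feas assms i p unfolding feasible_def supported_def by blast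
  then have "adjacent I i j" using i assms by (simp add: adjacent_def)
  then show thesis by (rule that)
qed

lemma linked_refl: "j \<in> C0 \<Longrightarrow> linked I j j"
  by (elim client_has_facility) (auto simp: linked_def adjacent_def)

text \<open>The iteration freezes at the first thin ball, so each iterate is a ball all of whose
  smaller balls are not thin.\<close>

lemma grow_funpow:
  "\<exists>t\<le>m. (grow I N C ^^ m) {j} = client_ball I C t j \<and> (\<forall>s<t. \<not> thin I N C (client_ball I C s j)) \<and>
     (t < m \<longrightarrow> thin I N C (client_ball I C t j))"
proof (induction m)
  case (Suc m)
  then obtain t where t: "t \<le> m" "(grow I N C ^^ m) {j} = client_ball I C t j"
    "\<forall>s<t. \<not> thin I N C (client_ball I C s j)" "t < m \<longrightarrow> thin I N C (client_ball I C t j)"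
    by blast
  have eq: "(grow I N C ^^ Suc m) {j} = grow I N C (client_ball I C t j)" by (simp add: t(2))
  show ?case
  proof (cases "thin I N C (client_ball I C t j)")
    case True
    then show ?thesis using t unfolding eq by (intro exI[of _ t]) (simp add: grow_def)
  next
    case False
    then have "t = m" using t by auto
    then show ?thesis using t False unfolding eq
      by (intro exI[of _ "Suc t"]) (auto simp: grow_def client_ball_Suc less_Suc_eq)
  qed
qed simp

lemma not_thin_card:
  assumes "\<not> thin I N C B"
  shows "card B < card (spread I C B)"
proof (rule ccontr)
  assume "\<not> ?thesis"
  then have "N * card (spread I C B) \<le> (N + 1) * card B" by (intro mult_le_mono) auto
  with assms show False by (simp add: thin_def)
qed

text \<open>If the iteration was cut off at \<open>card C0\<close> rounds and still ends in a ball
  that is not thin, then each round has added a client, and one more round would give more than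
  \<open>card C0\<close> clients. So the cut-off was at the horizon.\<close>

lemma not_thin_core:
  assumes "C \<subseteq> C0" "j \<in> C" "\<not> thin I N C (core I N C j)" "t < h"
  shows "\<not> thin I N C (client_ball I C t j)"
proof -
  define m where "m = min h (card C0)"
  obtain s where s: "s \<le> m" "core I N C j = client_ball I C s j"
    "\<forall>r<s. \<not> thin I N C (client_ball I C r j)" "s < m \<longrightarrow> thin I N C (client_ball I C s j)"
    using grow_funpow[of m C j] unfolding core_def m_def by blast
  have "s = m" using s assms(3) by auto
  then have *: "\<not> thin I N C (client_ball I C r j)" if "r \<le> m" for r
    using that s assms(3) by (auto simp: le_less)
  have "m = h"
  proof (rule ccontr)
    assume "m \<noteq> h"
    then have m: "m = card C0" by (auto simp: m_def min_def split: if_splits)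
    have "r < card (client_ball I C r j)" if "r \<le> m + 1" for r
      using that
    proof (induction r)
      case (Suc r)
      then show ?case using not_thin_card[OF *[of r]] by (auto simp: client_ball_Suc)
    qed simp
    from this[of "m + 1"] have "card C0 < card (client_ball I C (m + 1) j)" using m by simp
    moreover have "card (client_ball I C (m + 1) j) \<le> card C0"
      by (rule card_mono[OF finite_clients subset_trans[OF client_ball_subset[OF assms(2)] assms(1)]])
    ultimately show False by simp
  qed
  then show ?thesis using * assms(4) by simp
qed

text \<open>Recorded balls are unlinked and not merely disjoint, because this makes their sets of
  adjacent facilities disjoint. \<open>lay\<close> assigns to each ball the layer that was deleted
  with it.\<close>

definition carve_inv :: "nat set \<times> nat set list \<Rightarrow> bool" where
  "carve_inv s \<longleftrightarrow> fst s \<subseteq> C0 \<and> distinct (snd s) \<and>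
     (\<forall>J\<in>set (snd s). J \<noteq> {} \<and> J \<subseteq> C0 \<and> J \<inter> fst s = {} \<and> (\<forall>j\<in>J. \<forall>k\<in>J. hops I (2 * h) j k) \<and>
        (\<forall>j\<in>J. \<forall>k\<in>fst s. \<not> linked I j k)) \<and>
     (\<forall>J\<in>set (snd s). \<forall>J'\<in>set (snd s). J \<noteq> J' \<longrightarrow> (\<forall>j\<in>J. \<forall>k\<in>J'. \<not> linked I j k)) \<and>
     (\<exists>lay. C0 - fst s - \<Union> (set (snd s)) \<subseteq> \<Union> (lay ` set (snd s)) \<and>
        (\<forall>J\<in>set (snd s). lay J \<subseteq> C0 \<and> N * card (lay J) \<le> card J \<and>
           (\<forall>j\<in>lay J. \<forall>k\<in>J. hops I (2 * h + 1) j k)))"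

text \<open>Removing the whole of \<open>spread I (fst s) J\<close> leaves no remaining client
  linked to \<open>J\<close>, and thinness bounds the additional layer by
  \<open>card J / N\<close>.\<close>

lemma carve_inv_step:
  assumes inv: "carve_inv s" and j: "j \<in> fst s" and J: "J = core I N (fst s) j"
    and thin: "thin I N (fst s) J"
  shows "carve_inv (fst s - spread I (fst s) J, J # snd s)"
proof -
  let ?C = "fst s"
  have C: "?C \<subseteq> C0" using inv by (simp add: carve_inv_def)
  obtain t where t: "t \<le> h" "J = client_ball I ?C t j"
    using grow_funpow[of "min h (card C0)" ?C j] unfolding J core_def by auto
  have JC: "J \<subseteq> ?C" unfolding t by (rule client_ball_subset[OF j])
  have jJ: "j \<in> J" unfolding t by (rule client_ball_self[OF j])
  have hops: "hops I (2 * h) k l" if "k \<in> J" "l \<in> J" for k l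
  proof -
    have "hops I (t + t) k l"
      by (rule hops_trans[OF hops_sym[OF client_ball_hops] client_ball_hops]) (use that in \<open>simp_all add: t(2)\<close>)
    then show ?thesis by (rule hops_mono) (use t in simp)
  qed
  let ?L = "spread I ?C J - J"
  have sp: "J \<subseteq> spread I ?C J" "spread I ?C J \<subseteq> ?C" using JC spread_incl spread_subset by auto
  have fin: "finite ?C" by (rule finite_subset[OF C]) simp
  have "card ?L = card (spread I ?C J) - card J"
    by (rule card_Diff_subset[OF finite_subset[OF JC fin] sp(1)])
  then have L: "N * card ?L \<le> card J"
    using thin unfolding thin_def by (simp add: diff_mult_distrib2 algebra_simps)
  have Lh: "hops I (2 * h + 1) k l" if "k \<in> ?L" "l \<in> J" for k l
  proof -
    obtain m where "m \<in> J" "linked I m k" using \<open>k \<in> ?L\<close> by (auto simp: spread_def)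
    from hops_trans[OF hops_sym[OF linked_hops[OF this(2)]] hops[OF this(1) that(2)]]
    show ?thesis by (simp add: add.commute)
  qed
  obtain lay where lay: "C0 - ?C - \<Union> (set (snd s)) \<subseteq> \<Union> (lay ` set (snd s))"
    "\<forall>J\<in>set (snd s). lay J \<subseteq> C0 \<and> N * card (lay J) \<le> card J \<and>
           (\<forall>j\<in>lay J. \<forall>k\<in>J. hops I (2 * h + 1) j k)"
    using inv unfolding carve_inv_def by (elim conjE exE) (rule that; assumption)
  have all: "\<forall>J\<in>set (snd s). J \<noteq> {} \<and> J \<subseteq> C0 \<and> J \<inter> fst s = {} \<and>
      (\<forall>j\<in>J. \<forall>k\<in>J. hops I (2 * h) j k) \<and> (\<forall>j\<in>J. \<forall>k\<in>fst s. \<not> linked I j k)"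
    using inv unfolding carve_inv_def by (elim conjE)
  have old: "J' \<inter> ?C = {}" "J' \<noteq> {}" "J' \<subseteq> C0" "\<forall>j\<in>J'. \<forall>k\<in>J'. hops I (2 * h) j k"
     "\<And>j k. j \<in> J' \<Longrightarrow> k \<in> ?C \<Longrightarrow> \<not> linked I j k" if "J' \<in> set (snd s)" for J'
    using bspec[OF all that] by simp_all
  have new: "J \<notin> set (snd s)" using old(1) JC jJ by blast
  have nl: "\<not> linked I k l" if "k \<in> J" "l \<in> ?C - spread I ?C J" for k l
    using that by (auto simp: spread_def)
  have pw: "\<not> linked I j k"
    if "K \<in> set (snd s)" "K' \<in> set (snd s)" "K \<noteq> K'" "j \<in> K" "k \<in> K'" for K K' j k
  proof -
    have "\<forall>J\<in>set (snd s). \<forall>J'\<in>set (snd s). J \<noteq> J' \<longrightarrow> (\<forall>j\<in>J. \<forall>k\<in>J'. \<not> linked I j k)"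
      using inv unfolding carve_inv_def by (elim conjE)
    then show ?thesis using that by simp
  qed
  show ?thesis
    unfolding carve_inv_def fst_conv snd_conv
  proof (intro conjI)
    show "fst s - spread I (fst s) J \<subseteq> C0" using C by blast
    show "distinct (J # snd s)" using new inv by (simp add: carve_inv_def)
    show "\<forall>J'\<in>set (J # snd s). J' \<noteq> {} \<and> J' \<subseteq> C0 \<and> J' \<inter> (?C - spread I ?C J) = {} \<and>
        (\<forall>j\<in>J'. \<forall>k\<in>J'. hops I (2 * h) j k) \<and> (\<forall>j\<in>J'. \<forall>k\<in>?C - spread I ?C J. \<not> linked I j k)"
    proof
      fix J' assume "J' \<in> set (J # snd s)"
      then consider "J' = J" | "J' \<in> set (snd s)" by auto
      then show "J' \<noteq> {} \<and> J' \<subseteq> C0 \<and> J' \<inter> (?C - spread I ?C J) = {} \<and>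
        (\<forall>j\<in>J'. \<forall>k\<in>J'. hops I (2 * h) j k) \<and> (\<forall>j\<in>J'. \<forall>k\<in>?C - spread I ?C J. \<not> linked I j k)"
      proof cases
        case 1
        then show ?thesis using jJ JC C sp hops nl by auto
      next
        case 2
        then show ?thesis using old[OF 2] by blast
      qed
    qed
    show "\<forall>K\<in>set (J # snd s). \<forall>K'\<in>set (J # snd s). K \<noteq> K' \<longrightarrow> (\<forall>j\<in>K. \<forall>k\<in>K'. \<not> linked I j k)"
    proof (intro ballI impI)
      fix K K' j k
      assume *: "K \<in> set (J # snd s)" "K' \<in> set (J # snd s)" "K \<noteq> K'" "j \<in> K" "k \<in> K'"
      then consider "K = J" "K' \<in> set (snd s)" | "K' = J" "K \<in> set (snd s)"
        | "K \<in> set (snd s)" "K' \<in> set (snd s)" by auto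
      then show "\<not> linked I j k"
      proof cases
        case 1
        then show ?thesis using old(5)[of K' k j] * JC linked_sym by blast
      next
        case 2
        then show ?thesis using old(5)[of K j k] * JC by blast
      next
        case 3
        then show ?thesis using pw * by blast
      qed
    qed
    show "\<exists>lay. C0 - (?C - spread I ?C J) - \<Union> (set (J # snd s)) \<subseteq> \<Union> (lay ` set (J # snd s)) \<and>
        (\<forall>J\<in>set (J # snd s). lay J \<subseteq> C0 \<and> N * card (lay J) \<le> card J \<and>
           (\<forall>j\<in>lay J. \<forall>k\<in>J. hops I (2 * h + 1) j k))"
    proof (intro exI conjI)
      show "C0 - (?C - spread I ?C J) - \<Union> (set (J # snd s)) \<subseteq> \<Union> ((lay(J := ?L)) ` set (J # snd s))"
        using lay(1) new by auto
      show "\<forall>K\<in>set (J # snd s). (lay(J := ?L)) K \<subseteq> C0 \<and> N * card ((lay(J := ?L)) K) \<le> card K \<and>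
           (\<forall>j\<in>(lay(J := ?L)) K. \<forall>k\<in>K. hops I (2 * h + 1) j k)"
      proof
        fix K assume "K \<in> set (J # snd s)"
        then consider "K = J" | "K \<noteq> J" "K \<in> set (snd s)" by auto
        then show "(lay(J := ?L)) K \<subseteq> C0 \<and> N * card ((lay(J := ?L)) K) \<le> card K \<and>
           (\<forall>j\<in>(lay(J := ?L)) K. \<forall>k\<in>K. hops I (2 * h + 1) j k)"
        proof cases
          case 1
          then show ?thesis using L Lh sp C by (simp only: fun_upd_same) blast
        next
          case 2
          then show ?thesis using lay(2) by simp
        qed
      qed
    qed
  qed
qed

lemma carve_cases:
  assumes "finite (fst s)"
  obtains "{j\<in>fst s. thin I N (fst s) (core I N (fst s) j)} = {}" "carve I N s = s"
  | j where "j \<in> fst s" "thin I N (fst s) (core I N (fst s) j)"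
      "carve I N s = (fst s - spread I (fst s) (core I N (fst s) j), core I N (fst s) j # snd s)"
proof (cases "{j\<in>fst s. thin I N (fst s) (core I N (fst s) j)} = {}")
  case True
  then show thesis using that(1) by (simp add: carve_def)
next
  case False
  let ?X = "{j\<in>fst s. thin I N (fst s) (core I N (fst s) j)}"
  have "Min ?X \<in> ?X" using assms False by (intro Min_in) auto
  moreover have "carve I N s =
      (fst s - spread I (fst s) (core I N (fst s) (Min ?X)), core I N (fst s) (Min ?X) # snd s)"
    unfolding carve_def Let_def using False by (simp only: if_False)
  ultimately show thesis using that(2)[of "Min ?X"] by blast
qed

definition "stage m = (carve I N ^^ m) (C0, [])"

lemma carve_inv_stage: "carve_inv (stage m)"
proof (induction m)
  case 0
  show ?case by (simp add: stage_def carve_inv_def)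
next
  case (Suc m)
  have "fst (stage m) \<subseteq> C0" using Suc by (simp add: carve_inv_def)
  then have "finite (fst (stage m))" by (rule finite_subset) simp
  then show ?case
    by (rule carve_cases) (use Suc carve_inv_step[OF Suc _ refl] in \<open>simp_all add: stage_def\<close>)
qed

text \<open>A round that changes the state removes at least the client it has chosen, so
  \<open>card C0\<close> rounds exhaust all thin balls.\<close>

lemma stage_progress:
  "{j\<in>fst (stage m). thin I N (fst (stage m)) (core I N (fst (stage m)) j)} = {} \<or>
   card (fst (stage m)) + m \<le> card C0"
proof (induction m)
  case 0
  show ?case by (simp add: stage_def)
next
  case (Suc m)
  let ?C = "fst (stage m)"
  have C: "?C \<subseteq> C0" using carve_inv_stage[of m] by (simp add: carve_inv_def)
  have fin: "finite ?C" by (rule finite_subset[OF C]) simp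
  have S: "stage (Suc m) = carve I N (stage m)" by (simp add: stage_def)
  from fin show ?case
  proof (rule carve_cases)
    assume "{j\<in>?C. thin I N ?C (core I N ?C j)} = {}" "carve I N (stage m) = stage m"
    then show ?thesis unfolding S by simp
  next
    fix j assume j: "j \<in> ?C" "thin I N ?C (core I N ?C j)"
      "carve I N (stage m) = (?C - spread I ?C (core I N ?C j), core I N ?C j # snd (stage m))"
    obtain t where t: "core I N ?C j = client_ball I ?C t j"
      using grow_funpow[of "min h (card C0)" ?C j] unfolding core_def by blast
    have "j \<in> core I N ?C j" unfolding t by (rule client_ball_self[OF j(1)])
    then have "j \<in> spread I ?C (core I N ?C j)" using j(1) by (simp add: spread_def)
    then have "?C - spread I ?C (core I N ?C j) \<subset> ?C" using j(1) by blast
    then have "card (?C - spread I ?C (core I N ?C j)) < card ?C" by (rule psubset_card_mono[OF fin])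
    moreover have "card ?C + m \<le> card C0" using Suc j by blast
    ultimately show ?thesis unfolding S j(3) by simp
  qed
qed

abbreviation "R \<equiv> rest I N"
abbreviation "B \<equiv> rball I N"
abbreviation "w \<equiv> weight I N"

lemma carved_stage: "carved I N = stage (card C0)" "R = fst (stage (card C0))"
  by (simp_all add: carved_def stage_def rest_def)

lemma rest_sub: "R \<subseteq> C0"
  using carve_inv_stage[of "card C0"] by (simp add: carved_stage carve_inv_def)

lemma rest_finite [simp]: "finite R"
  by (rule finite_subset[OF rest_sub]) simp

lemma rest_client: "j \<in> R \<Longrightarrow> j \<in> C0"
  using rest_sub by blast

lemma rest_not_thin:
  assumes "j \<in> R"
  shows "\<not> thin I N R (core I N R j)"
proof -
  have "{j\<in>R. thin I N R (core I N R j)} = {} \<or> card R + card C0 \<le> card C0"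
    using stage_progress[of "card C0"] by (simp only: carved_stage)
  moreover have "card R > 0" using assms by (auto simp: card_gt_0_iff)
  ultimately show ?thesis using assms by auto
qed

lemma ball_subset: "j \<in> R \<Longrightarrow> B t j \<subseteq> R"
  unfolding rball_def by (rule client_ball_subset)

lemma ball_finite [simp]: "j \<in> R \<Longrightarrow> finite (B t j)"
  by (rule finite_subset[OF ball_subset]) auto

lemma ball_self: "j \<in> R \<Longrightarrow> j \<in> B t j"
  unfolding rball_def by (rule client_ball_self)

lemma ball_mono: "j \<in> R \<Longrightarrow> s \<le> t \<Longrightarrow> B s j \<subseteq> B t j"
  unfolding rball_def by (rule client_ball_mono)

lemma ball_sym: "j \<in> R \<Longrightarrow> k \<in> B t j \<Longrightarrow> j \<in> B t k"
  unfolding rball_def by (rule client_ball_sym)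

lemma ball_trans: "k \<in> B s j \<Longrightarrow> l \<in> B t k \<Longrightarrow> l \<in> B (s + t) j"
  unfolding rball_def by (rule client_ball_trans)

lemma ball_hops: "k \<in> B t j \<Longrightarrow> hops I t j k"
  unfolding rball_def by (rule client_ball_hops)

lemma ball_adjacent:
  assumes "j \<in> R" "k \<in> R" "adjacent I i j" "adjacent I i k"
  shows "k \<in> B 1 j"
  unfolding rball_def using assms by (intro client_ball_step) (auto simp: linked_def adjacent_def)

lemma ball_in_rest: "j \<in> R \<Longrightarrow> k \<in> B t j \<Longrightarrow> k \<in> R"
  using ball_subset by blast

lemma weight_mono: "j \<in> R \<Longrightarrow> k \<le> l \<Longrightarrow> w k j \<le> w l j"
  unfolding weight_def by (intro card_mono ball_mono) auto

lemma weight_pos: "j \<in> R \<Longrightarrow> w k j \<ge> 1"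
  unfolding weight_def using ball_self[of j "h + k"] by (auto simp: Suc_le_eq card_gt_0_iff)

text \<open>A thin ball below the horizon around a remaining client would have been carved
  off.\<close>

lemma rest_growth:
  assumes "j \<in> R"
  shows "plenty_const N * jump_const N * card (B 1 j) \<le> w 0 j"
  unfolding weight_def rball_def add_0_right
  by (rule client_ball_growth[OF _ assms N])
     (use not_thin_core[OF rest_sub assms rest_not_thin[OF assms]] in auto)

abbreviation "cored \<equiv> snd (carved I N)"

lemma cored_props:
  assumes "J \<in> set cored"
  shows "J \<noteq> {}" "J \<subseteq> C0" "J \<inter> R = {}" "\<And>j k. j \<in> J \<Longrightarrow> k \<in> J \<Longrightarrow> hops I (2 * h) j k"
    "\<And>j k. j \<in> J \<Longrightarrow> k \<in> R \<Longrightarrow> \<not> linked I j k"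
proof -
  have all: "\<forall>J\<in>set cored. J \<noteq> {} \<and> J \<subseteq> C0 \<and> J \<inter> R = {} \<and>
      (\<forall>j\<in>J. \<forall>k\<in>J. hops I (2 * h) j k) \<and> (\<forall>j\<in>J. \<forall>k\<in>R. \<not> linked I j k)"
    using carve_inv_stage[of "card C0"] unfolding carve_inv_def carved_stage by (elim conjE)
  show "J \<noteq> {}" "J \<subseteq> C0" "J \<inter> R = {}" "\<And>j k. j \<in> J \<Longrightarrow> k \<in> J \<Longrightarrow> hops I (2 * h) j k"
    "\<And>j k. j \<in> J \<Longrightarrow> k \<in> R \<Longrightarrow> \<not> linked I j k"
    using bspec[OF all assms] by simp_all
qed

lemma cored_unlinked:
  assumes "J \<in> set cored" "J' \<in> set cored" "J \<noteq> J'" "j \<in> J" "k \<in> J'"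
  shows "\<not> linked I j k"
proof -
  have "\<forall>J\<in>set cored. \<forall>J'\<in>set cored. J \<noteq> J' \<longrightarrow> (\<forall>j\<in>J. \<forall>k\<in>J'. \<not> linked I j k)"
    using carve_inv_stage[of "card C0"] unfolding carve_inv_def carved_stage by (elim conjE)
  then show ?thesis using assms by simp
qed

lemma cored_distinct: "distinct cored"
  using carve_inv_stage[of "card C0"] unfolding carve_inv_def carved_stage by (elim conjE)

lemma cored_layers:
  obtains lay where "C0 - R - \<Union> (set cored) \<subseteq> \<Union> (lay ` set cored)"
    "\<And>J. J \<in> set cored \<Longrightarrow> lay J \<subseteq> C0" "\<And>J. J \<in> set cored \<Longrightarrow> N * card (lay J) \<le> card J"
    "\<And>J j k. J \<in> set cored \<Longrightarrow> j \<in> lay J \<Longrightarrow> k \<in> J \<Longrightarrow> hops I (2 * h + 1) j k"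
proof -
  have "\<exists>lay. C0 - R - \<Union> (set cored) \<subseteq> \<Union> (lay ` set cored) \<and>
      (\<forall>J\<in>set cored. lay J \<subseteq> C0 \<and> N * card (lay J) \<le> card J \<and>
           (\<forall>j\<in>lay J. \<forall>k\<in>J. hops I (2 * h + 1) j k))"
    using carve_inv_stage[of "card C0"] unfolding carve_inv_def carved_stage by (elim conjE)
  then obtain lay where lay: "C0 - R - \<Union> (set cored) \<subseteq> \<Union> (lay ` set cored)"
    "\<forall>J\<in>set cored. lay J \<subseteq> C0 \<and> N * card (lay J) \<le> card J \<and>
           (\<forall>j\<in>lay J. \<forall>k\<in>J. hops I (2 * h + 1) j k)"
    by (elim exE conjE)
  show thesis
    by (rule that[of lay]) (use lay(1) bspec[OF lay(2)] in simp_all)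
qed

end

section \<open>Sinks\<close>

context setting
begin

abbreviation "R0 \<equiv> 2 * h + 6"
abbreviation "A \<equiv> sinks I N"

text \<open>On the last clause: a client is free until the first sink near it is chosen, and that
  sink was then at least as heavy as the client. This is what provides every remaining client with a
  home.\<close>

definition sink_inv :: "nat set \<Rightarrow> bool" where
  "sink_inv S \<longleftrightarrow> S \<subseteq> R \<and> (\<forall>a\<in>S. \<forall>b\<in>S. a \<noteq> b \<longrightarrow> b \<notin> B R0 a) \<and>
     (\<forall>j\<in>R. (\<forall>a\<in>S. a \<notin> B R0 j) \<or> (\<exists>a\<in>S. a \<in> B R0 j \<and> w 0 j \<le> w 0 a))"

abbreviation "free S \<equiv> {j\<in>R. \<forall>a\<in>S. a \<notin> B R0 j}"

lemma add_sink_cases: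
  obtains "free S = {}" "add_sink I N S = S"
  | a where "a \<in> free S" "\<And>k. k \<in> free S \<Longrightarrow> w 0 k \<le> w 0 a" "add_sink I N S = insert a S"
proof (cases "free S = {}")
  case True
  then show thesis using that(1) by (simp add: add_sink_def)
next
  case False
  define F where "F = free S"
  let ?Y = "{j\<in>F. \<forall>k\<in>F. w 0 k \<le> w 0 j}"
  have F: "F \<noteq> {}" "finite F" using False by (simp_all add: F_def)
  have "Max (w 0 ` F) \<in> w 0 ` F" using F by (intro Max_in) auto
  then obtain j where j: "j \<in> F" "w 0 j = Max (w 0 ` F)" by (metis imageE)
  have "w 0 k \<le> w 0 j" if "k \<in> F" for k
    unfolding j(2) by (rule Max_ge) (use that F in auto)
  with j(1) have "j \<in> ?Y" by simp
  then have Y: "?Y \<noteq> {}" by (metis empty_iff)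
  have min: "Min ?Y \<in> ?Y" by (rule Min_in[OF _ Y]) (simp add: F)
  have add: "add_sink I N S = insert (Min ?Y) S"
    unfolding add_sink_def Let_def F_def using False by (simp only: if_False)
  show thesis
    by (rule that(2)[OF _ _ add]) (use min in \<open>simp_all add: F_def\<close>)
qed

lemma sink_inv_add: "sink_inv S \<Longrightarrow> sink_inv (add_sink I N S)"
proof (rule add_sink_cases[of S])
  fix a assume inv: "sink_inv S" and a: "a \<in> free S" "\<And>k. k \<in> free S \<Longrightarrow> w 0 k \<le> w 0 a"
    "add_sink I N S = insert a S"
  have inv': "S \<subseteq> R" "\<And>b c. b \<in> S \<Longrightarrow> c \<in> S \<Longrightarrow> b \<noteq> c \<Longrightarrow> c \<notin> B R0 b"
    "\<And>j. j \<in> R \<Longrightarrow> (\<forall>a\<in>S. a \<notin> B R0 j) \<or> (\<exists>a\<in>S. a \<in> B R0 j \<and> w 0 j \<le> w 0 a)"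
    using inv unfolding sink_inv_def by simp_all
  have aR: "a \<in> R" "\<And>b. b \<in> S \<Longrightarrow> b \<notin> B R0 a" using a(1) by simp_all
  have bR: "b \<in> R" if "b \<in> S" for b using inv'(1) that by (rule subsetD)
  show "sink_inv (add_sink I N S)"
    unfolding sink_inv_def a(3)
  proof (intro conjI ballI impI)
    show "insert a S \<subseteq> R" using aR inv'(1) by simp
    fix b c assume bc: "b \<in> insert a S" "c \<in> insert a S" "b \<noteq> c"
    then consider "b = a" "c \<in> S" | "c = a" "b \<in> S" | "b \<in> S" "c \<in> S" by auto
    then show "c \<notin> B R0 b"
    proof cases
      case 1
      then show ?thesis using aR(2) by simp
    next
      case 2
      then show ?thesis using aR(2)[of b] ball_sym[OF bR, of b a R0] by auto
    next
      case 3
      then show ?thesis using inv'(2) bc(3) by simp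
    qed
  next
    fix j assume j: "j \<in> R"
    show "(\<forall>b\<in>insert a S. b \<notin> B R0 j) \<or> (\<exists>b\<in>insert a S. b \<in> B R0 j \<and> w 0 j \<le> w 0 b)"
    proof (cases "\<forall>b\<in>S. b \<notin> B R0 j")
      case True
      then have "w 0 j \<le> w 0 a" using a(2)[of j] j by simp
      then show ?thesis using True by auto
    next
      case False
      with inv'(3)[OF j] have "\<exists>b\<in>S. b \<in> B R0 j \<and> w 0 j \<le> w 0 b" by (elim disjE) simp_all
      then show ?thesis by auto
    qed
  qed
qed simp

lemma sink_inv_funpow: "sink_inv ((add_sink I N ^^ m) {})"
  by (induction m) (auto intro: sink_inv_add simp: sink_inv_def[of "{}"])

text \<open>Each round with a free client produces a new sink. If this happened in all
  \<open>card C0\<close> rounds, every remaining client would be a sink and so not free.\<close>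

lemma sinks_saturated: "free A = {}"
proof -
  have "free ((add_sink I N ^^ m) {}) = {} \<or> card ((add_sink I N ^^ m) {}) = m" for m
  proof (induction m)
    case (Suc m)
    let ?S = "(add_sink I N ^^ m) {}"
    show ?case
    proof (rule add_sink_cases[of ?S])
      assume "free ?S = {}" "add_sink I N ?S = ?S"
      then show ?thesis by simp
    next
      fix a assume a: "a \<in> free ?S" "add_sink I N ?S = insert a ?S"
      have S: "?S \<subseteq> R" using sink_inv_funpow[of m] unfolding sink_inv_def by (elim conjE)
      have aR: "a \<in> R" "\<forall>b\<in>?S. b \<notin> B R0 a" using a(1) by simp_all
      have "a \<notin> ?S" using ball_self[OF aR(1), of R0] aR(2) by metis
      moreover have "free ?S \<noteq> {}" using a(1) by (metis empty_iff)
      then have "card ?S = m" using Suc by (elim disjE) (rule notE)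
      ultimately have "card (insert a ?S) = Suc m"
        using finite_subset[OF S rest_finite] by simp
      then show ?thesis using a(2) by simp
    qed
  qed simp
  from this[of "card C0"] consider "free A = {}" | "card A = card C0" unfolding sinks_def by auto
  then show ?thesis
  proof cases
    case 2
    have S: "A \<subseteq> R"
      using sink_inv_funpow[of "card C0"] unfolding sinks_def sink_inv_def by (elim conjE)
    have "card R \<le> card C0" by (rule card_mono[OF finite_clients rest_sub])
    then have eq: "A = R" using card_subset_eq[OF rest_finite S] card_mono[OF rest_finite S] 2 by simp
    show ?thesis
    proof (rule equals0I)
      fix j assume "j \<in> free A"
      then have "j \<in> R" "\<forall>a\<in>A. a \<notin> B R0 j" by simp_all
      then show False using ball_self[of j R0] eq by simp
    qed
  qed
qed

lemma sinks_inv: "sink_inv A"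
  unfolding sinks_def by (rule sink_inv_funpow)

lemma sinks_sub: "A \<subseteq> R"
  using sinks_inv unfolding sink_inv_def by (elim conjE)

lemma sink_rest: "a \<in> A \<Longrightarrow> a \<in> R"
  by (rule subsetD[OF sinks_sub])

lemma sinks_finite [simp]: "finite A"
  by (rule finite_subset[OF sinks_sub]) simp

lemma sinks_apart: "a \<in> A \<Longrightarrow> b \<in> A \<Longrightarrow> b \<in> B R0 a \<Longrightarrow> a = b"
proof (rule ccontr)
  assume "a \<in> A" "b \<in> A" "b \<in> B R0 a" "a \<noteq> b"
  moreover have "\<forall>a\<in>A. \<forall>b\<in>A. a \<noteq> b \<longrightarrow> b \<notin> B R0 a"
    using sinks_inv unfolding sink_inv_def by (elim conjE)
  ultimately show False by simp
qed

lemma home_props: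
  assumes "j \<in> R"
  shows "home I N j \<in> A" "home I N j \<in> B R0 j" "w 0 j \<le> w 0 (home I N j)"
proof -
  let ?X = "{a\<in>A. a \<in> B R0 j \<and> w 0 j \<le> w 0 a}"
  have "\<not> (\<forall>a\<in>A. a \<notin> B R0 j)" using sinks_saturated assms by auto
  moreover have "\<forall>j\<in>R. (\<forall>a\<in>A. a \<notin> B R0 j) \<or> (\<exists>a\<in>A. a \<in> B R0 j \<and> w 0 j \<le> w 0 a)"
    using sinks_inv unfolding sink_inv_def by (elim conjE)
  ultimately have "\<exists>a\<in>A. a \<in> B R0 j \<and> w 0 j \<le> w 0 a" using bspec[of R _ j] assms by (metis (no_types))
  then have "?X \<noteq> {}" by auto
  then have "Min ?X \<in> ?X" by (intro Min_in) auto
  then show "home I N j \<in> A" "home I N j \<in> B R0 j" "w 0 j \<le> w 0 (home I N j)"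
    unfolding home_def by simp_all
qed

section \<open>Parents, labels and regions\<close>

abbreviation "R1 \<equiv> 3 * h + 8"
abbreviation "parent a \<equiv> Min (parents I N a)"

lemma parent_props:
  assumes "parents I N a \<noteq> {}"
  shows "parent a \<in> A" "parent a \<in> B R1 a" "jump_const N * w 2 a \<le> w 0 (parent a)"
proof -
  have "finite (parents I N a)" by (simp add: parents_def)
  then have "parent a \<in> parents I N a" using assms by (rule Min_in)
  then show "parent a \<in> A" "parent a \<in> B R1 a" "jump_const N * w 2 a \<le> w 0 (parent a)"
    by (simp_all add: parents_def)
qed

text \<open>The home of \<open>j\<close> lies within \<open>R1\<close> of \<open>a\<close> and is at
  least as heavy as \<open>j\<close>. If \<open>w 0 j\<close> reached the bound, this home would be
  a parent of \<open>a\<close>.\<close>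

lemma no_parent:
  assumes "a \<in> A" "parents I N a = {}" "j \<in> B (h + 2) a"
  shows "w 0 j < jump_const N * w 2 a"
proof -
  have j: "j \<in> R" by (rule ball_in_rest[OF sink_rest[OF assms(1)] assms(3)])
  have "home I N j \<in> B (h + 2 + R0) a" by (rule ball_trans[OF assms(3) home_props(2)[OF j]])
  also have "h + 2 + R0 = R1" by simp
  finally have "\<not> jump_const N * w 2 a \<le> w 0 (home I N j)"
    using assms(2) home_props(1)[OF j] by (auto simp: parents_def)
  then show ?thesis using home_props(3)[OF j] by linarith
qed

abbreviation "sealed \<equiv> closed_sinks I N"
abbreviation "lab \<equiv> label I N"

lemma closed_sub: "a \<in> sealed \<Longrightarrow> a \<in> A"
  by (simp add: closed_sinks_def)

lemma closed_finite [simp]: "finite sealed"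
  by (simp add: closed_sinks_def)

lemma children_finite [simp]: "finite (children I N b)"
  by (simp add: children_def)

definition members :: "nat \<Rightarrow> nat set" where
  "members l = {a\<in>A. lab a = l}"

lemma members_finite [simp]: "finite (members l)"
  by (simp add: members_def)

lemma lab_plentiful:
  assumes "a \<in> A" "parents I N a \<noteq> {}" "plentiful I N (parent a)"
  shows "lab a \<in> children I N (parent a)" "lab a = Min (children I N (parent a))"
proof -
  have "a \<in> children I N (parent a)" using assms by (simp add: children_def)
  then have "Min (children I N (parent a)) \<in> children I N (parent a)" by (intro Min_in) auto
  then show "lab a \<in> children I N (parent a)" "lab a = Min (children I N (parent a))"
    using assms by (auto simp: label_def)
qed

lemma lab_other:
  assumes "\<not> (parents I N a \<noteq> {} \<and> plentiful I N (parent a))"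
  shows "lab a = a"
  using assms by (auto simp: label_def)

lemma lab_sink: "a \<in> A \<Longrightarrow> lab a \<in> A"
proof (cases "parents I N a \<noteq> {} \<and> plentiful I N (parent a)")
  case True
  moreover assume "a \<in> A"
  ultimately have "lab a \<in> children I N (parent a)" using lab_plentiful(1) by simp
  then show ?thesis by (simp add: children_def)
qed (use lab_other in simp)

text \<open>
  Three kinds of labels: a sink without parent, closed sinks, and the children of a plentiful sink.
\<close>

lemma members_cases:
  assumes "a \<in> A"
  obtains (root) "parents I N a = {}" "lab a = a" "members (lab a) = {a}" "a \<notin> sealed"
  | (sealed) "a \<in> sealed" "lab a = a" "members (lab a) = {a}"
  | (group) b where "plentiful I N b" "members (lab a) = children I N b" "a \<in> children I N b"
      "b = parent a" "parents I N a \<noteq> {}" "a \<notin> sealed" "lab a \<notin> sealed"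
proof -
  have single: "members (lab a) = {a}" if "\<not> (parents I N a \<noteq> {} \<and> plentiful I N (parent a))"
  proof -
    \<comment> \<open>The label of a grouped sink is itself a child of a plentiful sink, which
      \<open>a\<close> is not; so only \<open>a\<close> carries the label \<open>a\<close>.\<close>
    have "c = a" if c: "c \<in> A" "lab c = a" for c
    proof (cases "parents I N c \<noteq> {} \<and> plentiful I N (parent c)")
      case True
      then have "a \<in> children I N (parent c)" using lab_plentiful(1)[of c] c by simp
      then have "parents I N a \<noteq> {}" "parent a = parent c" by (auto simp: children_def)
      then show ?thesis using True \<open>\<not> (parents I N a \<noteq> {} \<and> plentiful I N (parent a))\<close> by simp
    next
      case False
      then show ?thesis using lab_other[of c] c by simp
    qed
    then show ?thesis using assms lab_other[OF that] by (auto simp: members_def)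
  qed
  show thesis
  proof (cases "parents I N a = {}")
    case True
    then show thesis using root single lab_other[of a] by (simp add: closed_sinks_def)
  next
    case ne: False
    show thesis
    proof (cases "plentiful I N (parent a)")
      case False
      then show thesis using sealed single lab_other[of a] ne assms by (simp add: closed_sinks_def)
    next
      case True
      let ?b = "parent a"
      have a: "a \<in> children I N ?b" using assms ne by (simp add: children_def)
      have la: "lab a \<in> children I N ?b" "lab a = Min (children I N ?b)"
        using lab_plentiful[OF assms ne True] by auto
      have "lab c = lab a \<longleftrightarrow> c \<in> children I N ?b" if c: "c \<in> A" for c
      proof
        assume eq: "lab c = lab a"
        show "c \<in> children I N ?b"
        proof (cases "parents I N c \<noteq> {} \<and> plentiful I N (parent c)")
          case True
          then have "lab a \<in> children I N (parent c)" using lab_plentiful(1)[of c] c eq by simp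
          then have "parent c = ?b" using la(1) by (simp add: children_def)
          then show ?thesis using c True by (simp add: children_def)
        next
          case False
          then have "c = lab a" using lab_other[of c] eq by simp
          then show ?thesis using la(1) by simp
        qed
      next
        assume "c \<in> children I N ?b"
        then have "parents I N c \<noteq> {}" "parent c = ?b" by (auto simp: children_def)
        then show "lab c = lab a" using lab_plentiful(2)[of c] c la(2) True by simp
      qed
      then have "members (lab a) = children I N ?b"
        by (auto simp: members_def children_def)
      moreover have "lab a \<notin> sealed" using la(1) True by (auto simp: closed_sinks_def children_def)
      ultimately show thesis using group[of ?b] True a ne by (simp add: closed_sinks_def)
    qed
  qed
qed

text \<open>The clients that carry the load assigned to a label.\<close>

definition region :: "nat \<Rightarrow> nat set" where
  "region l = (if l \<in> sealed then B h l else (\<Union>a\<in>members l. B (radius I N a) a))"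

lemma radius_le: "radius I N a \<le> h + 2" "radius I N a \<ge> h + 1"
  by (auto simp: radius_def)

text \<open>The balls are not only disjoint but unlinked: a link would bring \<open>b\<close> within
  \<open>s + 1 + t \<le> R0\<close> of \<open>a\<close>.\<close>

lemma balls_apart:
  assumes "a \<in> A" "b \<in> A" "a \<noteq> b" "s + t + 1 \<le> R0" "j \<in> B s a" "k \<in> B t b"
  shows "k \<notin> B 1 j"
proof
  assume "k \<in> B 1 j"
  note R = sink_rest[OF assms(1)] sink_rest[OF assms(2)]
  have "k \<in> B (s + 1) a" by (rule ball_trans[OF assms(5) \<open>k \<in> B 1 j\<close>])
  moreover have "b \<in> B t k" by (rule ball_sym[OF R(2) assms(6)])
  ultimately have "b \<in> B (s + 1 + t) a" by (rule ball_trans)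
  moreover have "B (s + 1 + t) a \<subseteq> B R0 a" by (rule ball_mono[OF R(1)]) (use assms(4) in simp)
  ultimately have "b \<in> B R0 a" by (rule subsetD[rotated])
  then show False using sinks_apart[OF assms(1,2)] assms(3) by simp
qed

lemma balls_disjoint:
  assumes "a \<in> A" "b \<in> A" "a \<noteq> b" "s + t + 1 \<le> R0"
  shows "B s a \<inter> B t b = {}"
proof -
  have False if "j \<in> B s a" "j \<in> B t b" for j
    using balls_apart[OF assms that] ball_self[OF ball_in_rest[OF sink_rest[OF assms(1)] that(1)]] by simp
  then show ?thesis by blast
qed

lemma member_sink: "a \<in> members l \<Longrightarrow> a \<in> A"
  by (simp add: members_def)

lemma lab_member: "a \<in> A \<Longrightarrow> a \<in> members (lab a)"
  by (simp add: members_def)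

lemma region_sub: "l \<in> A \<Longrightarrow> region l \<subseteq> R"
  using ball_subset[OF sink_rest] member_sink by (simp add: region_def UN_least)

text \<open>The region of a group is a disjoint union of balls, so its size is exactly the sum that
  occurs in \<open>plentiful\<close>.\<close>

lemma region_card:
  assumes "a \<in> A"
  shows "members (lab a) = {a} \<Longrightarrow> a \<notin> sealed \<Longrightarrow> parents I N a = {} \<Longrightarrow> card (region (lab a)) = w 2 a"
    and "a \<in> sealed \<Longrightarrow> lab a = a \<Longrightarrow> card (region (lab a)) = w 0 a"
    and "members (lab a) = children I N b \<Longrightarrow> lab a \<notin> sealed \<Longrightarrow>
         card (region (lab a)) = (\<Sum>c\<in>children I N b. w 1 c)"
proof -
  show "card (region (lab a)) = w 2 a" if "members (lab a) = {a}" "a \<notin> sealed" "parents I N a = {}"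
    using that lab_other[of a] by (simp add: region_def radius_def weight_def)
  show "card (region (lab a)) = w 0 a" if "a \<in> sealed" "lab a = a"
    using that by (simp add: region_def weight_def)
  show "card (region (lab a)) = (\<Sum>c\<in>children I N b. w 1 c)"
    if "members (lab a) = children I N b" "lab a \<notin> sealed"
  proof -
    have ch: "c \<in> A" "radius I N c = h + 1" if "c \<in> children I N b" for c
      using that by (auto simp: children_def radius_def)
    have "region (lab a) = (\<Union>c\<in>children I N b. B (h + 1) c)"
      using that ch(2) by (simp add: region_def)
    also have "card \<dots> = (\<Sum>c\<in>children I N b. card (B (h + 1) c))"
      by (rule card_UN_disjoint) (use ch balls_disjoint ball_finite[OF sink_rest] in simp_all)
    finally show ?thesis by (simp add: weight_def)
  qed
qed

lemma children_weight_le: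
  assumes "c \<in> children I N b"
  shows "w 1 c \<le> (\<Sum>c\<in>children I N b. w 1 c)"
  by (rule member_le_sum) (use assms in simp_all)

lemma plenty_pos: "plenty_const N \<ge> 1" "jump_const N \<ge> 1" "load_const N \<ge> 1"
  using N by (simp_all add: plenty_const_def jump_const_def load_const_def Suc_le_eq)

text \<open>Members of one group may be parents of different closed sinks. This bound allows all of
  them to pay from the joint region.\<close>

lemma sum_member_weight: "l \<in> A \<Longrightarrow> l = lab a \<Longrightarrow> a \<in> A \<Longrightarrow> (\<Sum>c\<in>members l. w 0 c) \<le> card (region l)"
proof -
  assume l: "l = lab a" "a \<in> A"
  from l(2) show ?thesis
  proof (cases rule: members_cases)
    case root
    then show ?thesis using region_card(1)[OF l(2)] l weight_mono[OF sink_rest, of a 0 2] by simp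
  next
    case sealed
    then show ?thesis using region_card(2)[OF l(2)] l by simp
  next
    case (group b)
    have "(\<Sum>c\<in>children I N b. w 0 c) \<le> (\<Sum>c\<in>children I N b. w 1 c)"
      by (rule sum_mono) (use weight_mono[OF sink_rest] in \<open>simp add: children_def\<close>)
    then show ?thesis using group region_card(3)[OF l(2)] l by simp
  qed
qed

text \<open>Some child \<open>a\<close> violates the condition in \<open>plentiful\<close>, so all
  children together stay below \<open>plenty_const N * w 2 a\<close>. Being the parent of
  \<open>a\<close>, the sink \<open>b\<close> exceeds this by the factor \<open>4 * N\<close> built
  into \<open>jump_const\<close>.\<close>

lemma sum_sparse_children:
  assumes "\<not> plentiful I N b"
  shows "4 * N * (\<Sum>c\<in>children I N b. w 1 c) \<le> w 0 b"
proof -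
  obtain a where a: "a \<in> children I N b" "(\<Sum>c\<in>children I N b. w 1 c) < plenty_const N * w 2 a"
    using assms by (auto simp: plentiful_def not_le)
  then have "jump_const N * w 2 a \<le> w 0 b" using parent_props(3)[of a] by (auto simp: children_def)
  moreover have "4 * N * (\<Sum>c\<in>children I N b. w 1 c) \<le> 4 * N * (plenty_const N * w 2 a)"
    by (rule mult_le_mono2[OF less_imp_le[OF a(2)]])
  moreover have "4 * N * (plenty_const N * w 2 a) = jump_const N * w 2 a" by (simp add: jump_const_def)
  ultimately show ?thesis by linarith
qed

text \<open>The layer deleted around a closed sink is charged to the region of its parent.\<close>

lemma rim_load:
  assumes "a \<in> A"
  shows "4 * N * (\<Sum>c\<in>{c\<in>sealed. lab (parent c) = lab a}. w 1 c) \<le> card (region (lab a))"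
proof -
  \<comment> \<open>The closed sinks charged to this label are sorted by their parents, which are
    members of the label.\<close>
  have "(\<Sum>c\<in>{c\<in>sealed. lab (parent c) = lab a}. w 1 c)
      = (\<Sum>b\<in>members (lab a). \<Sum>c\<in>{c\<in>sealed. parent c = b}. w 1 c)"
  proof (subst sum.UNION_disjoint[symmetric])
    have "{c\<in>sealed. lab (parent c) = lab a} = (\<Union>b\<in>members (lab a). {c\<in>sealed. parent c = b})"
      using parent_props(1) by (auto simp: members_def closed_sinks_def)
    then show "(\<Sum>c\<in>{c\<in>sealed. lab (parent c) = lab a}. w 1 c) =
      sum (w 1) (\<Union>b\<in>members (lab a). {c\<in>sealed. parent c = b})" by simp
  qed auto
  then have "4 * N * (\<Sum>c\<in>{c\<in>sealed. lab (parent c) = lab a}. w 1 c)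
      = (\<Sum>b\<in>members (lab a). 4 * N * (\<Sum>c\<in>{c\<in>sealed. parent c = b}. w 1 c))"
    by (simp add: sum_distrib_left)
  also have "\<dots> \<le> (\<Sum>b\<in>members (lab a). w 0 b)"
  proof (rule sum_mono)
    fix b
    show "4 * N * (\<Sum>c\<in>{c\<in>sealed. parent c = b}. w 1 c) \<le> w 0 b"
    proof (cases "{c\<in>sealed. parent c = b} = {}")
      case False
      then have "\<not> plentiful I N b" by (auto simp: closed_sinks_def)
      then have "4 * N * (\<Sum>c\<in>children I N b. w 1 c) \<le> w 0 b" by (rule sum_sparse_children)
      moreover have "(\<Sum>c\<in>{c\<in>sealed. parent c = b}. w 1 c) \<le> (\<Sum>c\<in>children I N b. w 1 c)"
        by (rule sum_mono2) (auto simp: closed_sinks_def children_def)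
      ultimately show ?thesis by (meson le_trans mult_le_mono2)
    qed (simp only: sum.empty mult_0_right le0)
  qed
  also have "\<dots> \<le> card (region (lab a))"
    by (rule sum_member_weight[OF lab_sink[OF assms] refl assms])
  finally show ?thesis .
qed

end

section \<open>Loads\<close>

text \<open>Charging in blocks: \<open>W j k\<close> is the fraction of \<open>j\<close> charged to
  block \<open>k\<close>, spread evenly over the surviving clients \<open>X k\<close>. As blocks are
  disjoint, a survivor receives the load of one block divided by its size.\<close>

lemma deletableI:
  fixes K :: "'k set" and W :: "nat \<Rightarrow> 'k \<Rightarrow> real" and \<rho> \<tau> :: real
  assumes D: "D \<subseteq> clients I" and fin: "finite (clients I)" "finite K"
    and X: "\<And>k. k \<in> K \<Longrightarrow> X k \<subseteq> clients I - D" "\<And>k. k \<in> K \<Longrightarrow> X k \<noteq> {}"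
      "\<And>k l. k \<in> K \<Longrightarrow> l \<in> K \<Longrightarrow> k \<noteq> l \<Longrightarrow> X k \<inter> X l = {}"
    and W: "\<And>j k. j \<in> D \<Longrightarrow> k \<in> K \<Longrightarrow> 0 \<le> W j k" "\<And>j. j \<in> D \<Longrightarrow> (\<Sum>k\<in>K. W j k) = 1"
    and load: "\<And>k. k \<in> K \<Longrightarrow> (\<Sum>j\<in>D. W j k) \<le> \<rho> * card (X k)" and \<rho>: "\<rho> \<ge> 0"
    and near: "\<And>j k t. j \<in> D \<Longrightarrow> k \<in> K \<Longrightarrow> W j k > 0 \<Longrightarrow> t \<in> X k \<Longrightarrow> distf I j t \<le> \<tau> * opt I"
  shows "deletable I \<tau> \<rho> D"
proof -
  define \<phi> where "\<phi> j t = (\<Sum>k\<in>K. if t \<in> X k then W j k / card (X k) else 0)" for j t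
  have finX: "finite (X k)" if "k \<in> K" for k
    by (rule finite_subset[OF X(1)[OF that]]) (simp add: fin)
  have cX: "card (X k) > 0" if "k \<in> K" for k
    using finX[OF that] X(2)[OF that] by (simp add: card_gt_0_iff)
  have t0: "0 \<le> (if t \<in> X k then W j k / card (X k) else 0)" if "j \<in> D" "k \<in> K" for j k t
    using W(1)[OF that] by simp
  have t1: "(if t \<in> X k then W j k / card (X k) else 0) \<le> W j k" if "j \<in> D" "k \<in> K" for j k t
  proof -
    have "W j k * 1 \<le> W j k * card (X k)"
      by (rule mult_left_mono) (use W(1)[OF that] cX[OF that(2)] in auto)
    then show ?thesis using W(1)[OF that] cX[OF that(2)] by (simp add: divide_le_eq)
  qed
  show ?thesis
    unfolding deletable_def
  proof (intro conjI exI[of _ \<phi>] ballI impI)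
    show "D \<subseteq> clients I" by (rule D)
    fix j assume j: "j \<in> D"
    show "0 \<le> \<phi> j t" for t unfolding \<phi>_def by (rule sum_nonneg) (rule t0[OF j])
    show "\<phi> j t \<le> 1" for t
      unfolding \<phi>_def W(2)[OF j, symmetric] by (rule sum_mono) (rule t1[OF j])
    show "(\<Sum>t\<in>clients I - D. \<phi> j t) = 1"
    proof -
      have "(\<Sum>t\<in>clients I - D. \<phi> j t)
          = (\<Sum>k\<in>K. \<Sum>t\<in>clients I - D. if t \<in> X k then W j k / card (X k) else 0)"
        unfolding \<phi>_def by (rule sum.swap)
      also have "\<dots> = (\<Sum>k\<in>K. W j k)"
      proof (rule sum.cong[OF refl])
        fix k assume k: "k \<in> K"
        have "(\<Sum>t\<in>clients I - D. if t \<in> X k then W j k / card (X k) else 0)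
            = (\<Sum>t\<in>X k. W j k / card (X k))"
          using X(1)[OF k] fin by (simp add: sum.If_cases Int_absorb1)
        then show "(\<Sum>t\<in>clients I - D. if t \<in> X k then W j k / card (X k) else 0) = W j k"
          using cX[OF k] by simp
      qed
      finally show ?thesis by (simp only: W(2)[OF j])
    qed
    fix t assume "t \<in> clients I - D" and pos: "\<phi> j t > 0"
    from pos have "\<phi> j t \<noteq> 0" by simp
    then obtain k where k: "k \<in> K" "(if t \<in> X k then W j k / card (X k) else 0) \<noteq> 0"
      unfolding \<phi>_def by (rule sum.not_neutral_contains_not_neutral)
    then have "t \<in> X k" "W j k \<noteq> 0" by (auto split: if_splits)
    then show "distf I j t \<le> \<tau> * opt I" using near[OF j k(1)] W(1)[OF j k(1)] by simp
  next
    fix t assume t: "t \<in> clients I - D"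
    show "(\<Sum>j\<in>D. \<phi> j t) \<le> \<rho>"
    proof (cases "\<exists>k\<in>K. t \<in> X k")
      case True
      then obtain k where k: "k \<in> K" "t \<in> X k" by blast
      have "\<phi> j t = W j k / card (X k)" for j
      proof -
        have "\<phi> j t = (\<Sum>l\<in>{k}. if t \<in> X l then W j l / card (X l) else 0)"
          unfolding \<phi>_def using k X(3)[OF k(1)] fin by (intro sum.mono_neutral_right) auto
        then show ?thesis using k by simp
      qed
      then have "(\<Sum>j\<in>D. \<phi> j t) = (\<Sum>j\<in>D. W j k) / card (X k)" by (simp add: sum_divide_distrib)
      also have "\<dots> \<le> \<rho>" using load[OF k(1)] cX[OF k(1)] by (simp add: divide_le_eq)
      finally show ?thesis .
    next
      case False
      then have "\<phi> j t = 0" for j unfolding \<phi>_def by (intro sum.neutral) auto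
      then show ?thesis using \<rho> by simp
    qed
  qed
qed

context setting
begin

lemma open_facs_sub: "i \<in> open_facs I N \<Longrightarrow> i \<in> facs I"
  by (simp add: open_facs_def)

lemma open_facs_finite [simp]: "finite (open_facs I N)"
  by (simp add: open_facs_def)

lemma cluster_finite [simp]: "finite (cluster I N l)"
  by (simp add: cluster_def)

text \<open>Any two clients of \<open>i\<close> are linked, so two sinks forcing \<open>i\<close>
  would have linked balls.\<close>

lemma forced_unique: "a \<in> forced I N i \<Longrightarrow> b \<in> forced I N i \<Longrightarrow> a = b"
proof (rule ccontr)
  assume ab: "a \<in> forced I N i" "b \<in> forced I N i" "a \<noteq> b"
  then obtain j k where jk: "a \<in> A" "b \<in> A" "j \<in> B (radius I N a) a" "adjacent I i j"
    "k \<in> B (radius I N b) b" "adjacent I i k" by (auto simp: forced_def)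
  have "radius I N a + radius I N b + 1 \<le> R0" using radius_le[of a] radius_le[of b] by linarith
  then have "k \<notin> B 1 j" using balls_apart[OF jk(1,2) ab(3) _ jk(3,5)] by blast
  moreover have "k \<in> B 1 j"
    by (rule ball_adjacent[OF _ _ jk(4,6)])
       (use ball_in_rest[OF sink_rest[OF jk(1)] jk(3)] ball_in_rest[OF sink_rest[OF jk(2)] jk(5)] in auto)
  ultimately show False by simp
qed

lemma centre_cases:
  assumes "i \<in> open_facs I N"
  obtains (forced) j where "centre I N i \<in> A" "centre I N i \<notin> sealed" "j \<in> R" "adjacent I i j"
      "j \<in> B (radius I N (centre I N i)) (centre I N i)"
  | (home) j where "centre I N i = home I N j" "j \<in> R" "adjacent I i j"
proof (cases "forced I N i = {}")
  case True
  let ?X = "{j\<in>R. adjacent I i j}"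
  have "?X \<noteq> {}" using assms by (auto simp: open_facs_def)
  then have "Min ?X \<in> ?X" by (intro Min_in) auto
  then show thesis using home[of "Min ?X"] True by (simp add: centre_def)
next
  case False
  have "finite (forced I N i)" by (simp add: forced_def)
  then have "Min (forced I N i) \<in> forced I N i" using False by (intro Min_in)
  then have c: "centre I N i \<in> forced I N i" using False by (simp add: centre_def)
  then obtain j where j: "j \<in> B (radius I N (centre I N i)) (centre I N i)" "adjacent I i j"
    and a: "centre I N i \<in> A" "centre I N i \<notin> sealed" by (auto simp: forced_def)
  show thesis by (rule forced[OF a ball_in_rest[OF sink_rest[OF a(1)] j(1)] j(2,1)])
qed

lemma forced_centre:
  assumes "a \<in> A" "a \<notin> sealed" "j \<in> B (radius I N a) a" "adjacent I i j"
  shows "centre I N i = a"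
proof -
  have a: "a \<in> forced I N i" using assms by (auto simp: forced_def)
  have "finite (forced I N i)" by (simp add: forced_def)
  then have "Min (forced I N i) \<in> forced I N i" using a by (intro Min_in) auto
  then have "Min (forced I N i) = a" using forced_unique[OF _ a] by blast
  then show ?thesis using a by (auto simp: centre_def)
qed

lemma centre_near:
  assumes "i \<in> open_facs I N"
  obtains j where "j \<in> R" "adjacent I i j" "centre I N i \<in> A" "centre I N i \<in> B R0 j"
  using assms
proof (cases rule: centre_cases)
  case (forced j)
  have "centre I N i \<in> B (radius I N (centre I N i)) j"
    by (rule ball_sym[OF sink_rest[OF forced(1)] forced(5)])
  moreover have "B (radius I N (centre I N i)) j \<subseteq> B R0 j"
    by (rule ball_mono[OF forced(3)]) (use radius_le[of "centre I N i"] in linarith)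
  ultimately have "centre I N i \<in> B R0 j" by (rule subsetD[rotated])
  then show thesis using that forced by simp
next
  case (home j)
  then show thesis using that[of j] home_props[of j] by simp
qed

lemma centre_sink: "i \<in> open_facs I N \<Longrightarrow> centre I N i \<in> A"
  by (erule centre_near)

lemma sealed_member:
  assumes "a \<in> A" "lab a \<notin> sealed" "c \<in> members (lab a)"
  shows "c \<notin> sealed"
proof
  assume c: "c \<in> sealed"
  then have "c \<in> A" by (rule closed_sub)
  then have "lab c = c"
    by (rule members_cases) (use c in auto)
  then show False using assms c by (simp add: members_def)
qed

lemma region_member:
  assumes "l \<notin> sealed" "j \<in> region l"
  obtains c where "c \<in> members l" "j \<in> B (radius I N c) c"
  using assms by (auto simp: region_def)

text \<open>The region of an open label is not linked to any ball of a closed sink, so facilities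
  adjacent to it are open, and \<open>forced\<close> decides their cluster.\<close>

lemma region_facility:
  assumes "a \<in> A" "lab a \<notin> sealed" "j \<in> region (lab a)" "adjacent I i j"
  shows "i \<in> open_facs I N" "lab (centre I N i) = lab a"
proof -
  obtain c where c: "c \<in> members (lab a)" "j \<in> B (radius I N c) c"
    using assms region_member by blast
  have cA: "c \<in> A" "c \<notin> sealed" using c(1) sealed_member[OF assms(1,2)] by (auto simp: members_def)
  have j: "j \<in> R" by (rule ball_in_rest[OF sink_rest[OF cA(1)] c(2)])
  have "\<not> adjacent I i k" if b: "b \<in> sealed" "k \<in> B h b" for b k
  proof
    assume "adjacent I i k"
    have bA: "b \<in> A" by (rule closed_sub[OF b(1)])
    have "k \<in> R" by (rule ball_in_rest[OF sink_rest[OF bA] b(2)])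
    then have "k \<in> B 1 j" by (rule ball_adjacent[OF j _ assms(4) \<open>adjacent I i k\<close>])
    moreover have "radius I N c + h + 1 \<le> R0" using radius_le[of c] by linarith
    moreover have "c \<noteq> b" using b cA by auto
    ultimately show False using balls_apart[OF cA(1) bA _ _ c(2) b(2)] by blast
  qed
  then show "i \<in> open_facs I N" using j assms(4) by (auto simp: open_facs_def adjacent_def)
  show "lab (centre I N i) = lab a"
    using forced_centre[OF cA c(2) assms(4)] c(1) by (simp add: members_def)
qed

section \<open>Degrees of facilities against sizes of regions\<close>

abbreviation "deg i \<equiv> card {j\<in>R. adjacent I i j}"

lemma deg_le:
  assumes "j \<in> R" "adjacent I i j"
  shows "deg i \<le> card (B 1 j)"
  by (rule card_mono) (use assms ball_adjacent in auto)

text \<open>A facility sent to a home sink has a client that is no heavier than this sink, and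
  growth applies at the client. A facility forced to a parentless sink loses a factor
  \<open>jump_const N\<close> by \<open>no_parent\<close>, which the growth bound has in reserve.
  For one forced to a grouped child, all remaining clients lie within \<open>h + 2\<close> of the
  child, and \<open>plentiful\<close> compares this ball with the joint region.\<close>

lemma deg_load:
  assumes "i \<in> open_facs I N"
  shows "plenty_const N * deg i \<le> card (region (lab (centre I N i)))"
proof -
  let ?c = "centre I N i"
  have c: "?c \<in> A" by (rule centre_sink[OF assms])
  have growth: "plenty_const N * jump_const N * deg i \<le> w 0 j" if "j \<in> R" "adjacent I i j" for j
    using rest_growth[OF that(1)] deg_le[OF that] by (meson le_trans mult_le_mono2)
  have one: "plenty_const N * deg i \<le> plenty_const N * jump_const N * deg i"
    using plenty_pos(2) by (simp add: mult.assoc)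
  have w0: "w 0 ?c \<le> card (region (lab ?c))"
    using c
  proof (cases rule: members_cases)
    case root
    then show ?thesis using region_card(1)[OF c] weight_mono[OF sink_rest[OF c], of 0 2] by simp
  next
    case sealed
    then show ?thesis using region_card(2)[OF c] by simp
  next
    case (group b)
    then have "w 1 ?c \<le> card (region (lab ?c))"
      using region_card(3)[OF c] children_weight_le[of ?c b] by simp
    then show ?thesis using weight_mono[OF sink_rest[OF c], of 0 1] by simp
  qed
  from assms show ?thesis
  proof (cases rule: centre_cases)
    case (home j)
    have "plenty_const N * deg i \<le> w 0 j" using growth[OF home(2,3)] one by linarith
    then show ?thesis using home_props(3)[OF home(2)] w0 home(1) by simp
  next
    case (forced j)
    from c show ?thesis
    proof (cases rule: members_cases)
      case root
      have "radius I N ?c = h + 2" using root by (simp add: radius_def)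
      then have "w 0 j < jump_const N * w 2 ?c" using no_parent[OF c root(1)] forced(5) by simp
      moreover have "plenty_const N * jump_const N * deg i = jump_const N * (plenty_const N * deg i)"
        by (simp only: mult.assoc mult.left_commute)
      ultimately have "jump_const N * (plenty_const N * deg i) < jump_const N * w 2 ?c"
        using growth[OF forced(3,4)] by linarith
      then have "plenty_const N * deg i < w 2 ?c" by (simp only: mult_less_cancel1)
      then show ?thesis using region_card(1)[OF c] root by simp
    next
      case sealed
      then show ?thesis using forced(2) by simp
    next
      case (group b)
      have r: "radius I N ?c = h + 1" using group by (simp add: radius_def)
      have "deg i \<le> w 2 ?c"
        unfolding weight_def
      proof (rule card_mono)
        show "finite (B (h + 2) ?c)" using sink_rest[OF c] by simp
        show "{k\<in>R. adjacent I i k} \<subseteq> B (h + 2) ?c"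
        proof
          fix k assume "k \<in> {k\<in>R. adjacent I i k}"
          then have "k \<in> B 1 j" using ball_adjacent[OF forced(3) _ forced(4)] by simp
          from ball_trans[OF forced(5) this] show "k \<in> B (h + 2) ?c" by (simp add: r)
        qed
      qed
      then have "plenty_const N * deg i \<le> plenty_const N * w 2 ?c" by simp
      also have "\<dots> \<le> (\<Sum>c\<in>children I N b. w 1 c)" using group(1,3) by (simp add: plentiful_def)
      also have "\<dots> = card (region (lab ?c))" using region_card(3)[OF c group(2)] group by simp
      finally show ?thesis .
    qed
  qed
qed

subsection \<open>Dropped assignments\<close>

abbreviation "lost l \<equiv> {p\<in>types I. \<not> kept I N y l p}"

definition drop :: "nat \<Rightarrow> nat \<Rightarrow> real" where
  "drop j l = (\<Sum>i\<in>cluster I N l. \<Sum>p\<in>lost l. x i j p)"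

lemma types_finite [simp]: "finite (types I)"
  by (simp add: types_def)

lemma x_nonneg: "i \<in> facs I \<Longrightarrow> j \<in> C0 \<Longrightarrow> p \<in> types I \<Longrightarrow> 0 \<le> x i j p"
  and y_nonneg: "i \<in> facs I \<Longrightarrow> p \<in> types I \<Longrightarrow> 0 \<le> y i p"
  and x_le_y: "i \<in> facs I \<Longrightarrow> j \<in> C0 \<Longrightarrow> p \<in> types I \<Longrightarrow> x i j p \<le> y i p"
  using feas by (auto simp: feasible_def nonneg_x_def nonneg_y_def L4_def)

lemma x_nonadjacent: "i \<in> facs I \<Longrightarrow> j \<in> C0 \<Longrightarrow> p \<in> types I \<Longrightarrow> \<not> adjacent I i j \<Longrightarrow> x i j p = 0"
  using feas by (auto simp: feasible_def supported_def adjacent_def)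

lemma cluster_fac: "i \<in> cluster I N l \<Longrightarrow> i \<in> facs I"
  by (simp add: cluster_def open_facs_def)

text \<open>All lost types lie above the least one, whose tail sum is below
  \<open>N + 1\<close>.\<close>

lemma lost_mass: "(\<Sum>p\<in>lost l. \<Sum>i\<in>cluster I N l. y i p) \<le> real N + 1"
proof (cases "lost l = {}")
  case False
  define q where "q = Min (lost l)"
  have "q \<in> lost l" unfolding q_def using False by (intro Min_in) auto
  then have q: "q \<in> types I" "\<not> kept I N y l q" by simp_all
  have sub: "lost l \<subseteq> {q..num_types I}"
  proof
    fix p assume p: "p \<in> lost l"
    then have "q \<le> p" unfolding q_def by (intro Min_le) auto
    then show "p \<in> {q..num_types I}" using p by (simp add: types_def)
  qed
  have "(\<Sum>p\<in>lost l. \<Sum>i\<in>cluster I N l. y i p) \<le> (\<Sum>p\<in>{q..num_types I}. \<Sum>i\<in>cluster I N l. y i p)"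
    using q(1) by (intro sum_mono2 sub sum_nonneg y_nonneg) (auto simp: types_def cluster_fac)
  then show ?thesis using q(2) unfolding kept_def by linarith
next
  case True
  show ?thesis unfolding True by simp
qed

lemma live_rest: "j \<in> live I N \<Longrightarrow> j \<in> R"
  by (simp add: live_def)

text \<open>A facility adjacent to a remaining client fails to be open only by touching the ball of
  a closed sink; then all its remaining clients are within \<open>h + 1\<close> of that sink and
  hence not live.\<close>

lemma live_facility:
  assumes "j \<in> live I N" "adjacent I i j"
  shows "i \<in> open_facs I N"
proof -
  have j: "j \<in> R" by (rule live_rest[OF assms(1)])
  have "\<not> adjacent I i k" if a: "a \<in> sealed" "k \<in> B h a" for a k
  proof
    assume "adjacent I i k"
    have "k \<in> R" by (rule ball_in_rest[OF sink_rest[OF closed_sub[OF a(1)]] a(2)])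
    then have "j \<in> B 1 k" by (rule ball_adjacent[OF _ j \<open>adjacent I i k\<close> assms(2)])
    then have "j \<in> B (h + 1) a" by (rule ball_trans[OF a(2)])
    then show False using assms(1) a(1) by (simp add: live_def)
  qed
  then show ?thesis using j assms(2) by (auto simp: open_facs_def adjacent_def)
qed

lemma sum_clusters: "(\<Sum>l\<in>A. \<Sum>i\<in>cluster I N l. f l i) = (\<Sum>i\<in>open_facs I N. f (lab (centre I N i)) i)"
  for f :: "nat \<Rightarrow> nat \<Rightarrow> real"
proof -
  have "(\<Sum>l\<in>A. \<Sum>i\<in>cluster I N l. f l i) = (\<Sum>l\<in>A. \<Sum>i\<in>cluster I N l. f (lab (centre I N i)) i)"
    by (intro sum.cong refl) (simp add: cluster_def)
  also have "\<dots> = (\<Sum>i\<in>open_facs I N. f (lab (centre I N i)) i)"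
    unfolding cluster_def
    by (rule sum.group) (use centre_sink lab_sink in auto)
  finally show ?thesis .
qed

text \<open>By (L1), and since live clients are adjacent to open facilities only, whatever
  \<open>new_x\<close> does not retain is dropped in some cluster.\<close>

lemma kept_plus_dropped:
  assumes "j \<in> live I N"
  shows "1 \<le> (\<Sum>i\<in>facs I. \<Sum>p\<in>types I. new_x I N x y i j p) + (\<Sum>l\<in>A. drop j l)"
proof -
  have j: "j \<in> C0" by (rule rest_client[OF live_rest[OF assms]])
  have "1 \<le> (\<Sum>i\<in>facs I. \<Sum>p\<in>types I. x i j p)"
    using feas j by (auto simp: feasible_def L1_def)
  also have "\<dots> = (\<Sum>i\<in>open_facs I N. \<Sum>p\<in>types I. x i j p)"
    by (rule sum.mono_neutral_right)
       (use open_facs_sub live_facility[OF assms] x_nonadjacent[OF _ j] in \<open>auto intro!: sum.neutral\<close>)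
  also have "\<dots> = (\<Sum>i\<in>open_facs I N. (\<Sum>p\<in>types I. new_x I N x y i j p)
      + (\<Sum>p\<in>lost (lab (centre I N i)). x i j p))"
  proof (rule sum.cong[OF refl])
    fix i assume i: "i \<in> open_facs I N"
    have "(\<Sum>p\<in>lost (lab (centre I N i)). x i j p)
        = (\<Sum>p\<in>types I. if kept I N y (lab (centre I N i)) p then 0 else x i j p)"
      by (simp add: sum.If_cases Int_def)
    then show "(\<Sum>p\<in>types I. x i j p) = (\<Sum>p\<in>types I. new_x I N x y i j p)
      + (\<Sum>p\<in>lost (lab (centre I N i)). x i j p)"
      using assms i by (simp add: sum.distrib[symmetric] new_x_def if_distrib cong: if_cong)
  qed
  also have "\<dots> = (\<Sum>i\<in>open_facs I N. \<Sum>p\<in>types I. new_x I N x y i j p) + (\<Sum>l\<in>A. drop j l)"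
    unfolding drop_def sum_clusters by (rule sum.distrib)
  also have "(\<Sum>i\<in>open_facs I N. \<Sum>p\<in>types I. new_x I N x y i j p)
      = (\<Sum>i\<in>facs I. \<Sum>p\<in>types I. new_x I N x y i j p)"
    by (rule sum.mono_neutral_left)
       (use open_facs_sub in \<open>auto simp: new_x_def intro!: sum.neutral\<close>)
  finally show ?thesis .
qed

lemma drop_nonneg: "j \<in> R \<Longrightarrow> 0 \<le> drop j l"
  unfolding drop_def by (intro sum_nonneg x_nonneg) (auto simp: cluster_fac rest_client)

abbreviation "Bad \<equiv> bad I N x y"

lemma bad_live: "j \<in> Bad \<Longrightarrow> j \<in> live I N"
  by (simp add: bad_def)

lemma bad_rest: "j \<in> Bad \<Longrightarrow> j \<in> R"
  by (rule live_rest[OF bad_live])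

lemma bad_finite [simp]: "finite Bad"
  by (rule finite_subset[OF _ rest_finite]) (auto intro: bad_rest)

definition total_drop :: "nat \<Rightarrow> real" where
  "total_drop j = (\<Sum>l\<in>A. drop j l)"

lemma bad_drop: "j \<in> Bad \<Longrightarrow> 1 / (100 * real N) < total_drop j"
  using kept_plus_dropped[OF bad_live, of j] unfolding total_drop_def bad_def
  by simp

lemma bad_drop_pos: "j \<in> Bad \<Longrightarrow> 0 < total_drop j"
proof -
  assume "j \<in> Bad"
  then have "1 / (100 * real N) < total_drop j" by (rule bad_drop)
  moreover have "0 \<le> 1 / (100 * real N)" by simp
  ultimately show ?thesis by linarith
qed

text \<open>A deleted client is charged to the clusters in proportion to the mass it loses there.\<close>

definition share :: "nat \<Rightarrow> nat \<Rightarrow> real" where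
  "share j l = drop j l / total_drop j"

lemma share_nonneg: "j \<in> Bad \<Longrightarrow> 0 \<le> share j l"
  unfolding share_def using drop_nonneg[OF bad_rest] bad_drop_pos by (simp add: less_imp_le)

lemma share_sum: "j \<in> Bad \<Longrightarrow> (\<Sum>l\<in>A. share j l) = 1"
  unfolding share_def sum_divide_distrib[symmetric] total_drop_def[symmetric]
  using bad_drop_pos[of j] by simp

text \<open>A bad client drops more than \<open>1 / (100 * N)\<close> in total, so its share is at
  most \<open>100 * N\<close> times the mass dropped in the cluster. By (L4), a facility drops at
  most its degree times its \<open>y\<close>-mass on lost types; \<open>deg_load\<close> and
  \<open>lost_mass\<close> bound the two. The factors \<open>100 * N\<close> and
  \<open>N + 1\<close> make up \<open>load_const\<close>.\<close>

lemma share_load: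
  assumes "a \<in> A"
  shows "4 * real N * (\<Sum>j\<in>Bad. share j (lab a)) \<le> card (region (lab a))"
proof -
  let ?l = "lab a" and ?r = "real (card (region (lab a)))"
  have "(\<Sum>j\<in>Bad. share j ?l) \<le> (\<Sum>j\<in>Bad. 100 * real N * drop j ?l)"
  proof (rule sum_mono)
    fix j assume j: "j \<in> Bad"
    have "1 \<le> 100 * real N * total_drop j" using bad_drop[OF j] N by (simp add: field_simps)
    then have "drop j ?l * 1 \<le> drop j ?l * (100 * real N * total_drop j)"
      by (rule mult_left_mono) (rule drop_nonneg[OF bad_rest[OF j]])
    then show "share j ?l \<le> 100 * real N * drop j ?l"
      unfolding share_def using bad_drop_pos[OF j] by (simp add: divide_le_eq ac_simps)
  qed
  also have "\<dots> \<le> (\<Sum>j\<in>R. 100 * real N * drop j ?l)"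
    by (rule sum_mono2) (auto simp: bad_rest drop_nonneg)
  also have "\<dots> = 100 * real N * (\<Sum>i\<in>cluster I N ?l. \<Sum>p\<in>lost ?l. \<Sum>j\<in>R. x i j p)"
  proof -
    have "(\<Sum>j\<in>R. drop j ?l) = (\<Sum>i\<in>cluster I N ?l. \<Sum>j\<in>R. \<Sum>p\<in>lost ?l. x i j p)"
      unfolding drop_def by (rule sum.swap)
    also have "\<dots> = (\<Sum>i\<in>cluster I N ?l. \<Sum>p\<in>lost ?l. \<Sum>j\<in>R. x i j p)"
      by (rule sum.cong[OF refl]) (rule sum.swap)
    finally show ?thesis by (simp only: sum_distrib_left[symmetric])
  qed
  also have "\<dots> \<le> 100 * real N * (\<Sum>i\<in>cluster I N ?l. \<Sum>p\<in>lost ?l. y i p * (?r / plenty_const N))"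
  proof (intro mult_left_mono sum_mono)
    fix i p assume i: "i \<in> cluster I N ?l" and p: "p \<in> lost ?l"
    have f: "i \<in> facs I" "p \<in> types I" using i p cluster_fac by auto
    have "(\<Sum>j\<in>R. x i j p) = (\<Sum>j\<in>{j\<in>R. adjacent I i j}. x i j p)"
      by (rule sum.mono_neutral_right) (use f x_nonadjacent rest_client in auto)
    also have "\<dots> \<le> (\<Sum>j\<in>{j\<in>R. adjacent I i j}. y i p)"
      by (rule sum_mono) (use f x_le_y rest_client in auto)
    also have "\<dots> = y i p * deg i" by simp
    also have "\<dots> \<le> y i p * (?r / plenty_const N)"
    proof (rule mult_left_mono)
      have "plenty_const N * deg i \<le> card (region ?l)"
        using deg_load[of i] i by (simp add: cluster_def)
      then have "real (plenty_const N) * deg i \<le> ?r"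
        by (metis of_nat_mono of_nat_mult)
      then show "real (deg i) \<le> ?r / plenty_const N"
        using plenty_pos(1) by (simp add: pos_le_divide_eq ac_simps)
    qed (use f y_nonneg in auto)
    finally show "(\<Sum>j\<in>R. x i j p) \<le> y i p * (?r / plenty_const N)" .
  qed simp
  also have "(\<Sum>i\<in>cluster I N ?l. \<Sum>p\<in>lost ?l. y i p * (?r / plenty_const N))
      = (?r / plenty_const N) * (\<Sum>p\<in>lost ?l. \<Sum>i\<in>cluster I N ?l. y i p)"
    by (subst sum.swap) (simp add: sum_distrib_left sum_distrib_right mult.commute)
  also have "100 * real N * \<dots> \<le> 100 * real N * ((?r / plenty_const N) * (real N + 1))"
    by (intro mult_left_mono lost_mass) auto
  finally have "4 * real N * (\<Sum>j\<in>Bad. share j ?l)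
      \<le> 4 * real N * (100 * real N * ((?r / plenty_const N) * (real N + 1)))"
    by (rule mult_left_mono) simp
  also have "\<dots> = ?r"
  proof -
    have p: "real (plenty_const N) = 4 * real N * (100 * real N * (real N + 1))"
      by (simp add: plenty_const_def load_const_def distrib_left)
    have "4 * real N * (100 * real N * ((?r / plenty_const N) * (real N + 1)))
        = ?r / plenty_const N * (4 * real N * (100 * real N * (real N + 1)))" by (simp only: ac_simps)
    also have "\<dots> = ?r" using plenty_pos(1) unfolding p[symmetric] by simp
    finally show ?thesis .
  qed
  finally show ?thesis .
qed

text \<open>All facilities adjacent to the region belong to this one cluster, so a client inside
  cannot drop mass elsewhere.\<close>

lemma region_share:
  assumes "a \<in> A" "lab a \<notin> sealed" "j \<in> Bad" "j \<in> region (lab a)"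
  shows "share j (lab a) = 1"
proof -
  have "drop j l = 0" if l: "l \<noteq> lab a" for l
    unfolding drop_def
  proof (intro sum.neutral ballI)
    fix i p assume i: "i \<in> cluster I N l" and p: "p \<in> lost l"
    have "\<not> adjacent I i j"
      using region_facility(2)[OF assms(1,2,4), of i] i l by (auto simp: cluster_def)
    then show "x i j p = 0"
      using x_nonadjacent[OF cluster_fac[OF i] rest_client[OF bad_rest[OF assms(3)]]] p by simp
  qed
  then have "total_drop j = (\<Sum>l\<in>{lab a}. drop j l)"
    unfolding total_drop_def by (intro sum.mono_neutral_right) (auto simp: lab_sink assms(1))
  then show ?thesis using bad_drop_pos[OF assms(3)] by (simp add: share_def)
qed

lemma sealed_region_live: "l \<in> sealed \<Longrightarrow> region l \<inter> live I N = {}"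
proof -
  assume l: "l \<in> sealed"
  have "B h l \<subseteq> B (h + 1) l" by (rule ball_mono[OF sink_rest[OF closed_sub[OF l]]]) simp
  then show ?thesis using l by (auto simp: region_def live_def)
qed

section \<open>The surviving part of a region\<close>

abbreviation "target l \<equiv> region l - Bad"

lemma region_finite [simp]: "l \<in> A \<Longrightarrow> finite (region l)"
  by (rule finite_subset[OF region_sub]) auto

lemma region_nonempty: "a \<in> A \<Longrightarrow> card (region (lab a)) > 0"
proof -
  assume a: "a \<in> A"
  have "w 0 a \<le> (\<Sum>c\<in>members (lab a). w 0 c)"
    by (rule member_le_sum) (use lab_member[OF a] in auto)
  then show ?thesis
    using sum_member_weight[OF lab_sink[OF a] refl a] weight_pos[OF sink_rest[OF a], of 0] by linarith
qed

text \<open>Bad clients inside the region have share 1, so their number is at most the total share,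
  which is at most a quarter of the region. The region of a closed sink contains no live client and
  hence no bad one.\<close>

lemma target_card:
  assumes "a \<in> A"
  shows "real (card (region (lab a))) \<le> 2 * card (target (lab a))"
proof (cases "lab a \<in> sealed")
  case True
  then have "region (lab a) \<inter> Bad = {}" using sealed_region_live[OF True] bad_live by auto
  then have "target (lab a) = region (lab a)" by auto
  then show ?thesis by simp
next
  case False
  let ?X = "region (lab a) \<inter> Bad"
  have fin: "finite (region (lab a))" by (rule region_finite[OF lab_sink[OF assms]])
  have "real (card ?X) = (\<Sum>j\<in>?X. share j (lab a))"
    using region_share[OF assms False] by simp
  also have "\<dots> \<le> (\<Sum>j\<in>Bad. share j (lab a))"
    by (rule sum_mono2) (auto simp: share_nonneg)
  finally have "4 * real N * card ?X \<le> 4 * real N * (\<Sum>j\<in>Bad. share j (lab a))"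
    by (intro mult_left_mono) auto
  then have "4 * real N * card ?X \<le> card (region (lab a))" using share_load[OF assms] by linarith
  moreover have "4 * 1 * real (card ?X) \<le> 4 * real N * card ?X" using N by (intro mult_mono) auto
  ultimately have "4 * real (card ?X) \<le> card (region (lab a))" by linarith
  moreover have "card (region (lab a)) = card ?X + card (target (lab a))"
    using card_Int_Diff[OF fin] by simp
  ultimately show ?thesis by simp
qed

end

section \<open>The decomposition\<close>

context setting
begin

text \<open>A generous length in links: the longest chain, from a deleted layer around a closed sink
  to the region of its parent, has at most \<open>11 * h + 27\<close> links. Twice
  \<open>reach\<close> bounds hops and, in units of \<open>opt I\<close>, distances.\<close>

abbreviation "reach \<equiv> 40 * h"
abbreviation "Cores \<equiv> set (cores I N)"
abbreviation "Del \<equiv> C0 - \<Union> Cores - (live I N - Bad)"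

lemma h_large: "h \<ge> 23"
proof -
  have "1 * 22 \<le> N * (22 + 7 * floorlog 2 N)" by (rule mult_le_mono) (use N in auto)
  then show ?thesis by (simp add: horizon_def)
qed

text \<open>Members of a group meet at their common parent, which is within \<open>R1\<close> of
  each; every other label has a single member.\<close>

lemma member_hops:
  assumes "c \<in> members l" "c' \<in> members l"
  shows "hops I (2 * R1) c c'"
proof -
  have c: "c \<in> A" "lab c = l" using assms(1) by (auto simp: members_def)
  from c(1) show ?thesis
  proof (cases rule: members_cases)
    case (group b)
    then have "c' \<in> children I N b" using assms(2) c(2) by simp
    then have "b \<in> B R1 c'" "b \<in> B R1 c"
      using group parent_props(2)[of c] parent_props(2)[of c'] by (auto simp: children_def)
    then have "hops I (R1 + R1) c c'"
      by (intro hops_trans[OF ball_hops hops_sym[OF ball_hops]])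
    then show ?thesis by (simp add: mult_2)
  qed (use assms c hops_refl in auto)
qed

lemma region_hops:
  assumes "a \<in> A" "t \<in> region (lab a)" "c \<in> members (lab a)"
  shows "hops I (2 * R1 + (h + 2)) c t"
proof (cases "lab a \<in> sealed")
  case True
  then have la: "lab a \<in> A" by (rule closed_sub)
  have "lab (lab a) = lab a"
    using la by (rule members_cases) (use True in auto)
  then have m: "lab a \<in> members (lab a)" using la by (simp add: members_def)
  have "t \<in> B h (lab a)" using True assms(2) by (simp add: region_def)
  then have "hops I h (lab a) t" by (rule ball_hops)
  then have "hops I (h + 2) (lab a) t" by (rule hops_mono) simp
  with member_hops[OF assms(3) m] show ?thesis by (rule hops_trans)
next
  case False
  then obtain d where d: "d \<in> members (lab a)" "t \<in> B (radius I N d) d"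
    using assms(2) region_member by blast
  have "hops I (h + 2) d t" by (rule hops_mono[OF ball_hops[OF d(2)] radius_le(1)])
  with member_hops[OF assms(3) d(1)] show ?thesis by (rule hops_trans)
qed

lemma cluster_hops:
  assumes "i \<in> cluster I N l"
  obtains j c where "j \<in> R" "adjacent I i j" "c \<in> members l" "hops I R0 j c" "l = lab c" "c \<in> A"
proof -
  have i: "i \<in> open_facs I N" "lab (centre I N i) = l" using assms by (auto simp: cluster_def)
  from i(1) obtain j where j: "j \<in> R" "adjacent I i j" "centre I N i \<in> A" "centre I N i \<in> B R0 j"
    by (rule centre_near)
  show thesis
    by (rule that[OF j(1,2) _ ball_hops[OF j(4)] _ j(3)]) (use i(2) j(3) in \<open>simp_all add: members_def\<close>)
qed

text \<open>A charge travels from the client through the facility to its centre, possibly through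
  the common parent of the group, and on into the region.\<close>

lemma cluster_region_hops:
  assumes "i \<in> cluster I N l" "adjacent I i k" "t \<in> region l"
  shows "hops I reach k t"
proof -
  obtain j c where jc: "j \<in> R" "adjacent I i j" "c \<in> members l" "hops I R0 j c" "l = lab c" "c \<in> A"
    using cluster_hops[OF assms(1)] by metis
  have "linked I k j" using assms(2) jc(2) by (auto simp: linked_def adjacent_def)
  then have "hops I 1 k j" by (rule linked_hops)
  from hops_trans[OF this jc(4)] have "hops I (1 + R0) k c" .
  from hops_trans[OF this region_hops[OF jc(6), of t c]] assms(3) jc
  have "hops I (1 + R0 + (2 * R1 + (h + 2))) k t" by simp
  then show ?thesis by (rule hops_mono) (use h_large in simp)
qed

lemma cluster_diam:
  assumes "i \<in> cluster I N l" "i' \<in> cluster I N l"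
  shows "hop_dist I (Inl i) (Inl i') \<le> enat (2 * reach)"
proof -
  obtain j c where jc: "adjacent I i j" "c \<in> members l" "hops I R0 j c"
    using cluster_hops[OF assms(1)] by metis
  obtain j' c' where jc': "adjacent I i' j'" "c' \<in> members l" "hops I R0 j' c'"
    using cluster_hops[OF assms(2)] by metis
  have "hops I (R0 + 2 * R1) j c'" by (rule hops_trans[OF jc(3) member_hops[OF jc(2) jc'(2)]])
  from hops_trans[OF this hops_sym[OF jc'(3)]] have "hops I (R0 + 2 * R1 + R0) j j'" .
  from hop_dist_le[OF this jc(1) jc'(1)]
  have "hop_dist I (Inl i) (Inl i') \<le> enat (2 * (R0 + 2 * R1 + R0) + 2)" .
  also have "\<dots> \<le> enat (2 * reach)" unfolding enat_ord_simps using h_large by simp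
  finally show ?thesis .
qed

section \<open>Cores and their separation\<close>

lemma cores_cases:
  assumes "J \<in> Cores"
  obtains "J \<in> set cored" | a where "a \<in> sealed" "J = B h a"
  using assms by (auto simp: cores_def)

lemma cores_sub: "J \<in> Cores \<Longrightarrow> J \<subseteq> C0"
  using cores_cases[of J] cored_props(2) ball_subset[OF sink_rest[OF closed_sub]] rest_sub
  by (metis subset_trans)

lemma cores_nonempty: "J \<in> Cores \<Longrightarrow> J \<noteq> {}"
  using cores_cases[of J] cored_props(1) ball_self[OF sink_rest[OF closed_sub]] by (metis empty_iff)

lemma cores_hops: "J \<in> Cores \<Longrightarrow> j \<in> J \<Longrightarrow> k \<in> J \<Longrightarrow> hops I (2 * h) j k"
proof (erule cores_cases)
  assume "J \<in> set cored" "j \<in> J" "k \<in> J"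
  then show ?thesis by (rule cored_props(4))
next
  fix a assume a: "a \<in> sealed" "J = B h a" and jk: "j \<in> J" "k \<in> J"
  have "hops I (h + h) j k"
    by (rule hops_trans[OF hops_sym[OF ball_hops] ball_hops]) (use a jk in auto)
  then show ?thesis by (simp add: mult_2)
qed

text \<open>Carved balls have no links to each other or into the rest, where the balls of closed
  sinks lie; the latter are kept apart by the separation of sinks.\<close>

lemma cores_unlinked:
  assumes "J \<in> Cores" "J' \<in> Cores" "J \<noteq> J'" "j \<in> J" "k \<in> J'"
  shows "\<not> linked I j k"
proof -
  have mixed: "\<not> linked I j k" if "J \<in> set cored" "a \<in> sealed" "j \<in> J" "k \<in> B h a" for J a j k
    by (rule cored_props(5)[OF that(1,3)]) (rule ball_in_rest[OF sink_rest[OF closed_sub[OF that(2)]] that(4)])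
  from assms(1) show ?thesis
  proof (rule cores_cases)
    assume J: "J \<in> set cored"
    from assms(2) show ?thesis
    proof (rule cores_cases)
      assume "J' \<in> set cored"
      then show ?thesis using cored_unlinked[OF J] assms(3-5) by simp
    next
      fix a assume "a \<in> sealed" "J' = B h a"
      then show ?thesis using mixed[OF J] assms by simp
    qed
  next
    fix a assume a: "a \<in> sealed" "J = B h a"
    from assms(2) show ?thesis
    proof (rule cores_cases)
      assume J': "J' \<in> set cored"
      show ?thesis
        using mixed[OF J' a(1) assms(5), of j] assms(4) a(2) linked_sym by auto
    next
      fix b assume b: "b \<in> sealed" "J' = B h b"
      have k: "k \<in> R" "j \<in> R"
        using ball_in_rest[OF sink_rest[OF closed_sub[OF b(1)]]] ball_in_rest[OF sink_rest[OF closed_sub[OF a(1)]]]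
          assms(4,5) a(2) b(2) by auto
      have "a \<noteq> b" using a b assms(3) by auto
      then have "k \<notin> B 1 j"
        using balls_apart[OF closed_sub[OF a(1)] closed_sub[OF b(1)], of h h j k] assms(4,5) a(2) b(2) by simp
      then show ?thesis unfolding rball_def using client_ball_step[OF k(2) k(1)] by blast
    qed
  qed
qed

lemma cores_disjoint: "J \<in> Cores \<Longrightarrow> J' \<in> Cores \<Longrightarrow> J \<noteq> J' \<Longrightarrow> J \<inter> J' = {}"
proof -
  assume J: "J \<in> Cores" "J' \<in> Cores" "J \<noteq> J'"
  have False if "j \<in> J" "j \<in> J'" for j
    using cores_unlinked[OF J that] linked_refl[OF subsetD[OF cores_sub[OF J(1)] that(1)]] by simp
  then show ?thesis by blast
qed

lemma live_core: "j \<in> live I N \<Longrightarrow> J \<in> Cores \<Longrightarrow> j \<notin> J"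
proof (erule cores_cases)
  assume "j \<in> live I N" "J \<in> set cored"
  then show ?thesis using cored_props(3)[of J] live_rest by auto
next
  fix a assume j: "j \<in> live I N" and a: "a \<in> sealed" "J = B h a"
  have "B h a \<subseteq> B (h + 1) a" by (rule ball_mono[OF sink_rest[OF closed_sub[OF a(1)]]]) simp
  then show ?thesis using j a by (auto simp: live_def)
qed

lemma open_region_live:
  assumes "a \<in> A" "lab a \<notin> sealed" "j \<in> region (lab a)"
  shows "j \<in> live I N"
proof -
  obtain c where c: "c \<in> members (lab a)" "j \<in> B (radius I N c) c"
    using assms region_member by blast
  have cA: "c \<in> A" "c \<notin> sealed" using c(1) sealed_member[OF assms(1,2)] by (auto simp: members_def)
  have "j \<notin> B (h + 1) b" if b: "b \<in> sealed" for b
  proof -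
    have "radius I N c + (h + 1) + 1 \<le> R0" using radius_le[of c] by linarith
    then have "B (radius I N c) c \<inter> B (h + 1) b = {}"
      using balls_disjoint[OF cA(1) closed_sub[OF b]] cA(2) b by blast
    then show ?thesis using c(2) by blast
  qed
  then show ?thesis using ball_in_rest[OF sink_rest[OF cA(1)] c(2)] by (simp add: live_def)
qed

text \<open>The region of a closed label is a core, and the region of an open label consists of live
  clients.\<close>

lemma target_kept:
  assumes "a \<in> A"
  shows "target (lab a) \<subseteq> C0 - Del"
proof (cases "lab a \<in> sealed")
  case True
  then have "region (lab a) \<in> Cores" by (simp add: region_def cores_def)
  then show ?thesis using cores_sub[of "region (lab a)"] by auto
next
  case False
  then show ?thesis using open_region_live[OF assms False] live_rest rest_client by auto
qed

text \<open>Each region is covered by balls of radius \<open>h + 2\<close> around sinks carrying its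
  label, and different labels belong to different sinks.\<close>

lemma regions_disjoint:
  assumes "a \<in> A" "a' \<in> A" "lab a \<noteq> lab a'"
  shows "region (lab a) \<inter> region (lab a') = {}"
proof -
  have *: "\<exists>c. c \<in> A \<and> lab c = lab a \<and> j \<in> B (h + 2) c" if a: "a \<in> A" "j \<in> region (lab a)" for a j
  proof (cases "lab a \<in> sealed")
    case True
    then have la: "lab a \<in> A" by (rule closed_sub)
    have "lab (lab a) = lab a" using la by (rule members_cases) (use True in auto)
    moreover have "B h (lab a) \<subseteq> B (h + 2) (lab a)" by (rule ball_mono[OF sink_rest[OF la]]) simp
    ultimately show ?thesis using a True la by (auto simp: region_def)
  next
    case False
    then obtain d where d: "d \<in> members (lab a)" "j \<in> B (radius I N d) d"
      using a(2) region_member by blast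
    then have "B (radius I N d) d \<subseteq> B (h + 2) d"
      using ball_mono[OF sink_rest, of d "radius I N d" "h + 2"] radius_le(1) by (simp add: members_def)
    then show ?thesis using d by (auto simp: members_def)
  qed
  have False if j: "j \<in> region (lab a)" "j \<in> region (lab a')" for j
  proof -
    obtain c c' where c: "c \<in> A" "lab c = lab a" "j \<in> B (h + 2) c"
      "c' \<in> A" "lab c' = lab a'" "j \<in> B (h + 2) c'" using *[OF assms(1) j(1)] *[OF assms(2) j(2)] by blast
    have "B (h + 2) c \<inter> B (h + 2) c' = {}"
      by (rule balls_disjoint) (use c assms(3) in auto)
    then show False using c by blast
  qed
  then show ?thesis by blast
qed

text \<open>Each kind of deleted client has its own payer: the clusters in which mass was dropped,
  the parent of a nearby closed sink, or the carved ball in whose layer the client lies.\<close>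

lemma rim_cases:
  assumes "j \<in> Del"
  obtains (bad) "j \<in> Bad"
  | (rim) a where "j \<in> R" "a \<in> sealed" "j \<in> B (h + 1) a" "j \<notin> Bad"
  | (layer) "j \<notin> R" "j \<in> C0 - R - \<Union> (set cored)"
proof (cases "j \<in> R")
  case True
  show thesis
  proof (cases "j \<in> live I N")
    case True
    then show thesis using assms bad by auto
  next
    case False
    then obtain a where "a \<in> sealed" "j \<in> B (h + 1) a" using True by (auto simp: live_def)
    then show thesis using rim True bad by blast
  qed
next
  case False
  then show thesis using assms layer by (auto simp: cores_def)
qed

lemma Del_deletable:
  assumes "1 / real N \<le> \<delta>"
  shows "deletable I (2 * real reach) \<delta> Del"
proof -
  obtain lay where lay: "C0 - R - \<Union> (set cored) \<subseteq> \<Union> (lay ` set cored)"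
    "\<And>J. J \<in> set cored \<Longrightarrow> lay J \<subseteq> C0" "\<And>J. J \<in> set cored \<Longrightarrow> N * card (lay J) \<le> card J"
    "\<And>J j k. J \<in> set cored \<Longrightarrow> j \<in> lay J \<Longrightarrow> k \<in> J \<Longrightarrow> hops I (2 * h + 1) j k"
    by (rule cored_layers) blast
  define near where "near j = (SOME a. a \<in> sealed \<and> j \<in> B (h + 1) a)" for j
  \<comment> \<open>Layers of different carved balls are not known to be disjoint, so each client
    chooses one of them.\<close>
  define core_of where "core_of j = (SOME J. J \<in> set cored \<and> j \<in> lay J)" for j
  have near: "near j \<in> sealed" "j \<in> B (h + 1) (near j)" if "a \<in> sealed" "j \<in> B (h + 1) a" for j a
    using someI[of "\<lambda>a. a \<in> sealed \<and> j \<in> B (h + 1) a" a] that unfolding near_def by auto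
  have core_of: "core_of j \<in> set cored" "j \<in> lay (core_of j)" if "j \<in> C0 - R - \<Union> (set cored)" for j
  proof -
    from lay(1) that have "j \<in> \<Union> (lay ` set cored)" by (rule subsetD)
    then obtain J where "J \<in> set cored" "j \<in> lay J" by (elim UN_E)
    then show "core_of j \<in> set cored" "j \<in> lay (core_of j)"
      using someI[of "\<lambda>J. J \<in> set cored \<and> j \<in> lay J" J] unfolding core_of_def by auto
  qed
  have parent: "parent c \<in> A" "parent c \<in> B R1 c" if "c \<in> sealed" for c
    using parent_props[of c] that by (auto simp: closed_sinks_def)
  \<comment> \<open>The blocks are the regions of labels, as far as they survive, and the carved
    balls. Labels are collected in the image of \<open>lab\<close>, since several sinks may share
    one region.\<close>
  define K :: "(nat + nat set) set" where "K = Inl ` (lab ` A) \<union> Inr ` set cored"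
  define X :: "nat + nat set \<Rightarrow> nat set" where "X = case_sum target id"
  define W :: "nat \<Rightarrow> nat + nat set \<Rightarrow> real" where
    "W j k = (if j \<in> Bad then (case k of Inl l \<Rightarrow> share j l | Inr J \<Rightarrow> 0)
       else if j \<in> R then of_bool (k = Inl (lab (parent (near j))))
       else of_bool (k = Inr (core_of j)))" for j k
  have N0: "real N > 0" using N by simp
  have d0: "0 \<le> \<delta>" using assms N0 zero_le_divide_1_iff[of "real N"] by linarith
  have XInl: "X (Inl l) = target l" and XInr: "X (Inr J) = J" for l J by (simp_all add: X_def)
  have WR: "W j k = of_bool (k = Inl (lab (parent (near j))))" if "j \<in> R" "j \<notin> Bad" for j k
    using that by (simp add: W_def)
  have WL: "W j k = of_bool (k = Inr (core_of j))" if "j \<notin> R" for j k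
    using that bad_rest by (auto simp: W_def)
  \<comment> \<open>Sinks that are not labels have empty clusters, so sums of shares over sinks and
    over labels agree.\<close>
  have share_lab: "share j l = 0" if "l \<notin> lab ` A" for j l
  proof -
    have "cluster I N l = {}" using that centre_sink by (auto simp: cluster_def)
    then show ?thesis by (simp add: share_def drop_def)
  qed
  show ?thesis
  proof (rule deletableI[where K = K and X = X and W = W])
    show "Del \<subseteq> C0" by blast
    show "finite C0" "finite K" by (simp_all add: K_def)
    show "X k \<subseteq> C0 - Del" if "k \<in> K" for k
    proof -
      from that consider a where "a \<in> A" "k = Inl (lab a)" | J where "J \<in> set cored" "k = Inr J"
        by (auto simp: K_def)
      then show ?thesis
      proof cases
        case 1
        then show ?thesis using target_kept by (simp add: XInl)
      next
        case 2
        then have "J \<in> Cores" by (simp add: cores_def)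
        then show ?thesis using cores_sub[of J] 2 by (auto simp: XInr)
      qed
    qed
    show "X k \<noteq> {}" if "k \<in> K" for k
    proof -
      from that consider a where "a \<in> A" "k = Inl (lab a)" | J where "J \<in> set cored" "k = Inr J"
        by (auto simp: K_def)
      then show ?thesis
      proof cases
        case 1
        then have "0 < card (target (lab a))"
          using target_card[OF 1(1)] region_nonempty[OF 1(1)] by linarith
        then show ?thesis unfolding 1(2) XInl by (metis card.empty less_irrefl)
      next
        case 2
        then show ?thesis using cored_props(1) by (simp add: XInr)
      qed
    qed
    show "X k \<inter> X l = {}" if kl: "k \<in> K" "l \<in> K" "k \<noteq> l" for k l
    proof -
      have mix: "target (lab a) \<inter> J = {}" if "a \<in> A" "J \<in> set cored" for a J
        using region_sub[OF lab_sink[OF that(1)]] cored_props(3)[OF that(2)] by blast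
      have JJ: "J \<inter> J' = {}" if "J \<in> set cored" "J' \<in> set cored" "J \<noteq> J'" for J J'
        by (rule cores_disjoint) (use that in \<open>auto simp: cores_def\<close>)
      have TT: "target (lab a) \<inter> target (lab a') = {}" if "a \<in> A" "a' \<in> A" "lab a \<noteq> lab a'" for a a'
        using regions_disjoint[OF that] by blast
      show ?thesis
      proof (cases k)
        case (Inl a)
        then obtain c where c: "c \<in> A" "k = Inl (lab c)" using kl by (auto simp: K_def)
        show ?thesis
        proof (cases l)
          case (Inl b)
          then obtain d where d: "d \<in> A" "l = Inl (lab d)" using kl by (auto simp: K_def)
          then show ?thesis using TT c kl(3) by (simp add: XInl)
        next
          case (Inr J)
          then show ?thesis using mix c kl by (auto simp: XInl XInr K_def)
        qed
      next
        case (Inr J)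
        then have J: "J \<in> set cored" using kl by (auto simp: K_def)
        show ?thesis
        proof (cases l)
          case (Inl b)
          then obtain d where d: "d \<in> A" "l = Inl (lab d)" using kl by (auto simp: K_def)
          then show ?thesis using mix[OF d(1) J] Inr by (simp add: XInl XInr Int_commute)
        next
          case (Inr J')
          then have "J' \<in> set cored" using kl by (auto simp: K_def)
          then show ?thesis using JJ[OF J] Inr \<open>k = Inr J\<close> kl(3) by (simp add: XInr)
        qed
      qed
    qed
    show "0 \<le> W j k" for j k
      by (auto simp: W_def share_nonneg split: sum.split)
    show "(\<Sum>k\<in>K. W j k) = 1" if j: "j \<in> Del" for j
      using j
    proof (cases rule: rim_cases)
      case bad
      have "(\<Sum>k\<in>K. W j k) = (\<Sum>k\<in>Inl ` (lab ` A). W j k) + (\<Sum>k\<in>Inr ` set cored. W j k)"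
        unfolding K_def by (rule sum.union_disjoint) auto
      also have "(\<Sum>k\<in>Inr ` set cored. W j k) = 0"
        by (rule sum.neutral) (use bad in \<open>auto simp: W_def\<close>)
      also have "(\<Sum>k\<in>Inl ` (lab ` A). W j k) = (\<Sum>l\<in>lab ` A. share j l)"
        by (subst sum.reindex) (use bad in \<open>auto simp: W_def\<close>)
      also have "\<dots> = (\<Sum>l\<in>A. share j l)"
        by (rule sum.mono_neutral_left) (auto simp: lab_sink share_lab)
      finally show ?thesis using share_sum[OF bad] by simp
    next
      case (rim a)
      have "Inl (lab (parent (near j))) \<in> K" using parent(1) near(1)[OF rim(2,3)] by (auto simp: K_def)
      moreover have "finite K" by (simp add: K_def)
      ultimately show ?thesis using WR[OF rim(1,4)] by (simp add: of_bool_def)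
    next
      case layer
      have "Inr (core_of j) \<in> K" using core_of(1)[OF layer(2)] by (auto simp: K_def)
      moreover have "finite K" by (simp add: K_def)
      ultimately show ?thesis using WL[OF layer(1)] by (simp add: of_bool_def)
    qed
    show "0 \<le> \<delta>" by (rule d0)
    show "(\<Sum>j\<in>Del. W j k) \<le> \<delta> * card (X k)" if k: "k \<in> K" for k
    proof -
      have "real N * (\<Sum>j\<in>Del. W j k) \<le> card (X k)"
      proof -
        from k consider a where "a \<in> A" "k = Inl (lab a)" | J where "J \<in> set cored" "k = Inr J"
          by (auto simp: K_def)
        then show ?thesis
        proof cases
          case (1 a)
          \<comment> \<open>A region bears the shares of bad clients and the rims of the closed
            sinks whose parents carry its label. Each amounts to at most \<open>1 / (4 * N)\<close>
            of the region, and half of the region survives; so every survivor receives at most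
            \<open>1 / N\<close>.\<close>
          let ?S = "{c\<in>sealed. lab (parent c) = lab a}"
          define Rim where "Rim = {j\<in>Del. j \<in> R \<and> j \<notin> Bad \<and> lab (parent (near j)) = lab a}"
          have split: "W j k \<le> (if j \<in> Bad then share j (lab a) else 0) + of_bool (j \<in> Rim)"
            if "j \<in> Del" for j
            using that bad_rest by (auto simp: W_def 1 Rim_def)
          have "(\<Sum>j\<in>Del. W j k) \<le> (\<Sum>j\<in>Del. (if j \<in> Bad then share j (lab a) else 0) + of_bool (j \<in> Rim))"
            by (rule sum_mono) (rule split)
          also have "\<dots> = (\<Sum>j\<in>Del \<inter> Bad. share j (lab a)) + card (Del \<inter> Rim)"
            by (simp add: sum.distrib sum.If_cases of_bool_def Int_def)
          also have "\<dots> \<le> (\<Sum>j\<in>Bad. share j (lab a)) + card Rim"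
          proof (rule add_mono)
            show "(\<Sum>j\<in>Del \<inter> Bad. share j (lab a)) \<le> (\<Sum>j\<in>Bad. share j (lab a))"
              by (rule sum_mono2) (auto simp: share_nonneg)
            show "real (card (Del \<inter> Rim)) \<le> card Rim"
              unfolding of_nat_le_iff by (rule card_mono) (auto simp: Rim_def)
          qed
          finally have le: "(\<Sum>j\<in>Del. W j k) \<le> (\<Sum>j\<in>Bad. share j (lab a)) + card Rim" .
          have "Rim \<subseteq> (\<Union>c\<in>?S. B (h + 1) c)"
          proof
            fix j assume j: "j \<in> Rim"
            then have jD: "j \<in> Del" "j \<in> R" "j \<notin> Bad" "lab (parent (near j)) = lab a" by (auto simp: Rim_def)
            from jD(1) obtain b where b: "b \<in> sealed" "j \<in> B (h + 1) b"
              by (rule rim_cases) (use jD in auto)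
            from near[OF b] jD(4) show "j \<in> (\<Union>c\<in>?S. B (h + 1) c)" by auto
          qed
          then have "card Rim \<le> card (\<Union>c\<in>?S. B (h + 1) c)"
            by (rule card_mono[rotated]) (auto intro!: ball_finite sink_rest closed_sub)
          also have "\<dots> \<le> (\<Sum>c\<in>?S. card (B (h + 1) c))" by (rule card_UN_le) simp
          finally have "card Rim \<le> (\<Sum>c\<in>?S. w 1 c)" by (simp add: weight_def)
          then have "4 * N * card Rim \<le> 4 * N * (\<Sum>c\<in>?S. w 1 c)" by simp
          also have "\<dots> \<le> card (region (lab a))" by (rule rim_load[OF 1(1)])
          finally have "real (4 * N * card Rim) \<le> card (region (lab a))" by (simp only: of_nat_le_iff)
          then have r: "4 * real N * card Rim \<le> card (region (lab a))" by simp
          have "4 * real N * (\<Sum>j\<in>Del. W j k) \<le> 4 * real N * ((\<Sum>j\<in>Bad. share j (lab a)) + card Rim)"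
            using le N0 by (intro mult_left_mono) auto
          also have "\<dots> \<le> 2 * real (card (region (lab a)))"
            using share_load[OF 1(1)] r by (simp add: distrib_left)
          also have "\<dots> \<le> 4 * card (target (lab a))" using target_card[OF 1(1)] by linarith
          finally show ?thesis by (simp add: 1 XInl)
        next
          case (2 J)
          have J: "J \<inter> R = {}" by (rule cored_props(3)[OF 2(1)])
          define Q where "Q = {j\<in>Del. j \<notin> R \<and> core_of j = J}"
          have "W j k = of_bool (j \<in> Q)" if "j \<in> Del" for j
            using that bad_rest[of j] by (auto simp: W_def 2 Q_def)
          then have "(\<Sum>j\<in>Del. W j k) = (\<Sum>j\<in>Del. of_bool (j \<in> Q))" by (intro sum.cong) auto
          also have "\<dots> = card (Del \<inter> Q)" by (simp add: of_bool_def sum.If_cases Int_def)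
          also have "Del \<inter> Q = Q" by (auto simp: Q_def)
          finally have s: "(\<Sum>j\<in>Del. W j k) = card Q" .
          have "Q \<subseteq> lay J"
          proof
            fix j assume "j \<in> Q"
            then have j: "j \<in> Del" "j \<notin> R" "core_of j = J" by (auto simp: Q_def)
            from j(1) have "j \<in> C0 - R - \<Union> (set cored)"
              by (rule rim_cases) (use j bad_rest in auto)
            from core_of(2)[OF this] j(3) show "j \<in> lay J" by simp
          qed
          then have "card Q \<le> card (lay J)"
            by (rule card_mono[rotated]) (rule finite_subset[OF lay(2)[OF 2(1)] finite_clients])
          then have "N * card Q \<le> card J" using lay(3)[OF 2(1)] by (meson le_trans mult_le_mono2)
          then have "real N * card Q \<le> card J" by (metis of_nat_mono of_nat_mult)
          then show ?thesis unfolding s by (simp add: 2 XInr)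
        qed
      qed
      then have "(\<Sum>j\<in>Del. W j k) \<le> 1 / real N * card (X k)" using N0 by (simp add: field_simps)
      also have "\<dots> \<le> \<delta> * card (X k)" by (rule mult_right_mono[OF assms]) simp
      finally show ?thesis .
    qed
    show "distf I j t \<le> 2 * real reach * opt I"
      if j: "j \<in> Del" and k: "k \<in> K" and pos: "W j k > 0" and t: "t \<in> X k" for j k t
    proof -
      have "hops I reach j t"
        using j
      proof (cases rule: rim_cases)
        case bad
        then obtain l where l: "k = Inl l" "share j l > 0" using pos by (cases k) (auto simp: W_def)
        then have "drop j l \<noteq> 0" by (auto simp: share_def)
        then obtain i where i: "i \<in> cluster I N l" "(\<Sum>p\<in>lost l. x i j p) \<noteq> 0"
          unfolding drop_def by (rule sum.not_neutral_contains_not_neutral)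
        from i(2) obtain p where p: "p \<in> lost l" "x i j p \<noteq> 0"
          by (rule sum.not_neutral_contains_not_neutral)
        have "adjacent I i j"
          using x_nonadjacent[OF cluster_fac[OF i(1)] rest_client[OF bad_rest[OF bad]], of p] p by auto
        moreover have "t \<in> region l" using t l by (simp add: XInl)
        ultimately show ?thesis by (rule cluster_region_hops[OF i(1)])
      next
        case (rim a)
        let ?c = "near j"
        have c: "?c \<in> sealed" "j \<in> B (h + 1) ?c" using near[OF rim(2,3)] by auto
        have "k = Inl (lab (parent ?c))" using pos WR[OF rim(1,4)] by (auto simp: of_bool_def split: if_splits)
        then have t: "t \<in> region (lab (parent ?c))" using t by (simp add: XInl)
        note p = parent[OF c(1)]
        have "hops I (h + 1) j ?c" by (rule hops_sym[OF ball_hops[OF c(2)]])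
        from hops_trans[OF this ball_hops[OF p(2)]] have "hops I (h + 1 + R1) j (parent ?c)" .
        from hops_trans[OF this region_hops[OF p(1) t lab_member[OF p(1)]]]
        show ?thesis by (rule hops_mono) (use h_large in simp)
      next
        case layer
        have "k = Inr (core_of j)" using pos WL[OF layer(1)] by (auto simp: of_bool_def split: if_splits)
        then have "t \<in> core_of j" using t by (simp add: XInr)
        from lay(4)[OF core_of[OF layer(2)] this] show ?thesis
          by (rule hops_mono) (use h_large in simp)
      qed
      moreover have "j \<in> C0" using j by blast
      ultimately show ?thesis using hops_dist[OF wf] by blast
    qed
  qed
qed

end

section \<open>Rounding a cluster\<close>

text \<open>
  Summation by parts: if \<open>G \<le> b F\<close> holds for tail sums, then it also holds after weighting by
  a nondecreasing \<open>c\<close>.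
\<close>

lemma weighted_tails_mono:
  fixes c F G :: "nat \<Rightarrow> real"
  assumes c: "\<And>p. m \<le> p \<Longrightarrow> p \<le> n \<Longrightarrow> 0 \<le> c p" "\<And>p. m \<le> p \<Longrightarrow> p < n \<Longrightarrow> c p \<le> c (Suc p)"
    and le: "\<And>p. m \<le> p \<Longrightarrow> p \<le> n \<Longrightarrow> G p \<le> b * F p" and last: "F (Suc n) = 0" "G (Suc n) = 0"
  shows "(\<Sum>p\<in>{m..n}. c p * (G p - G (Suc p))) \<le> b * (\<Sum>p\<in>{m..n}. c p * (F p - F (Suc p)))"
proof -
  define H where "H p = b * F p - G p" for p
  \<comment> \<open>The boundary term \<open>c m * H m\<close> makes the claim inductive when
    \<open>m\<close> is lowered: as \<open>H (Suc m)\<close> is nonnegative, the smaller factor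
    \<open>c m\<close> may replace \<open>c (Suc m)\<close>, and \<open>c m * H (Suc m)\<close>
    cancels.\<close>
  have "m \<le> Suc n \<Longrightarrow> (if m \<le> n then c m else 0) * H m \<le> (\<Sum>p\<in>{m..n}. c p * (H p - H (Suc p)))"
    using c le
  proof (induction "Suc n - m" arbitrary: m)
    case (Suc k)
    then have m: "m \<le> n" by linarith
    have H: "0 \<le> H p" if "m \<le> p" "p \<le> n" for p using Suc.prems(4)[OF that] by (simp add: H_def)
    have HS: "H (Suc n) = 0" using last by (simp add: H_def)
    have "(if Suc m \<le> n then c (Suc m) else 0) * H (Suc m) \<le> (\<Sum>p\<in>{Suc m..n}. c p * (H p - H (Suc p)))"
      by (rule Suc.hyps(1)) (use Suc.hyps(2) Suc.prems m in auto)
    moreover have "c m * H (Suc m) \<le> (if Suc m \<le> n then c (Suc m) else 0) * H (Suc m)"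
    proof (cases "Suc m \<le> n")
      case True
      then show ?thesis using Suc.prems(3)[of m] H[of "Suc m"] by (simp add: mult_right_mono)
    next
      case False
      then have "Suc m = Suc n" using m by simp
      then show ?thesis using HS False by simp
    qed
    moreover have "(\<Sum>p\<in>{m..n}. c p * (H p - H (Suc p)))
        = c m * (H m - H (Suc m)) + (\<Sum>p\<in>{Suc m..n}. c p * (H p - H (Suc p)))"
      using m by (rule sum.atLeast_Suc_atMost)
    ultimately show ?case using m by (simp add: right_diff_distrib)
  qed simp
  moreover have "0 \<le> (if m \<le> n then c m else 0) * H m" using c(1)[of m] le[of m] by (simp add: H_def)
  moreover have "(\<Sum>p\<in>{m..n}. c p * (H p - H (Suc p)))
      = b * (\<Sum>p\<in>{m..n}. c p * (F p - F (Suc p))) - (\<Sum>p\<in>{m..n}. c p * (G p - G (Suc p)))"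
    by (simp add: H_def algebra_simps sum_distrib_left sum.distrib sum_subtractf)
  ultimately show ?thesis by (cases "m \<le> Suc n") auto
qed

lemma tail_telescope:
  fixes f :: "nat \<Rightarrow> real"
  assumes "p \<le> Suc n"
  shows "(\<Sum>q\<in>{p..n}. f q - f (Suc q)) = f p - f (Suc n)"
  using assms sum_Suc_diff[of p n "\<lambda>q. - f q"] by (simp add: algebra_simps sum_negf sum_subtractf)

lemma deletable_mono:
  assumes "deletable I \<tau> \<rho> D" "\<tau> * opt I \<le> \<tau>' * opt I"
  shows "deletable I \<tau>' \<rho> D"
proof -
  obtain \<phi> where \<phi>: "\<forall>j\<in>D. \<forall>k\<in>clients I - D. 0 \<le> \<phi> j k \<and> \<phi> j k \<le> 1"
    "\<forall>j\<in>D. (\<Sum>k\<in>clients I - D. \<phi> j k) = 1" "\<forall>k\<in>clients I - D. (\<Sum>j\<in>D. \<phi> j k) \<le> \<rho>"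
    and near: "\<forall>j\<in>D. \<forall>k\<in>clients I - D. \<phi> j k > 0 \<longrightarrow> distf I j k \<le> \<tau> * opt I" and D: "D \<subseteq> clients I"
    using assms(1) unfolding deletable_def by (elim conjE exE)
  have "\<forall>j\<in>D. \<forall>k\<in>clients I - D. \<phi> j k > 0 \<longrightarrow> distf I j k \<le> \<tau>' * opt I"
  proof (intro ballI impI)
    fix j k assume "j \<in> D" "k \<in> clients I - D" "\<phi> j k > 0"
    then have "distf I j k \<le> \<tau> * opt I" using near by simp
    then show "distf I j k \<le> \<tau>' * opt I" using assms(2) by (rule order_trans)
  qed
  then show ?thesis unfolding deletable_def by (intro conjI D exI[of _ \<phi>] \<phi>)
qed

context setting
begin

section \<open>Tail sums of \<open>y\<close> and their rounding\<close>

definition tail :: "nat set \<Rightarrow> nat \<Rightarrow> real" where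
  "tail S p = (\<Sum>q\<in>{p..num_types I}. \<Sum>i\<in>S. y i q)"

lemma tail_Suc: "p \<le> num_types I \<Longrightarrow> tail S p = (\<Sum>i\<in>S. y i p) + tail S (Suc p)"
  unfolding tail_def by (rule sum.atLeast_Suc_atMost)

lemma tail_mono:
  assumes "S \<subseteq> facs I" "1 \<le> p" "p \<le> q"
  shows "tail S q \<le> tail S p"
  unfolding tail_def
  by (rule sum_mono2) (use assms y_nonneg in \<open>auto intro!: sum_nonneg simp: types_def\<close>)

lemma tail_nonneg: "S \<subseteq> facs I \<Longrightarrow> 1 \<le> p \<Longrightarrow> 0 \<le> tail S p"
  unfolding tail_def by (intro sum_nonneg y_nonneg) (auto simp: types_def)

text \<open>This is where (L5) enters: it guarantees that \<open>S\<close> has enough facilities for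
  the rounded numbers of copies.\<close>

lemma tail_le_card:
  assumes "S \<subseteq> facs I"
  shows "tail S 1 \<le> card S"
proof -
  have "tail S 1 = (\<Sum>i\<in>S. \<Sum>q\<in>types I. y i q)" unfolding tail_def types_def by (rule sum.swap)
  also have "\<dots> \<le> (\<Sum>i\<in>S. 1)"
    by (rule sum_mono) (use feas assms in \<open>auto simp: feasible_def L5_def\<close>)
  finally show ?thesis by simp
qed

lemma capac_mono: "1 \<le> p \<Longrightarrow> p < num_types I \<Longrightarrow> capac I p \<le> capac I (Suc p)"
  using wf by (auto simp: wf_instance_def types_def)

text \<open>All tail sums are rounded down. For a tail \<open>t \<ge> N + 1\<close> this is
  harmless, because \<open>t \<le> (1 + 1 / N) * (t - 1)\<close>; types with a smaller tail carry no
  load by assumption. Comparing tails is enough since capacities increase with the type.\<close>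

lemma roundableI:
  assumes S: "S \<subseteq> facs I" and diam: "ereal_of_enat (diam_G I S) \<le> ereal a"
    and z0: "\<And>i p. i \<in> S \<Longrightarrow> p \<in> types I \<Longrightarrow> tail S p < real N + 1 \<Longrightarrow> (\<Sum>j\<in>C0. z i j p) = 0"
    and z: "\<And>i p. i \<in> S \<Longrightarrow> p \<in> types I \<Longrightarrow> (\<Sum>j\<in>C0. z i j p) \<le> real (capac I p) * y i p"
    and \<delta>: "1 / real N \<le> \<delta>"
  shows "roundable I z y a (1 + \<delta>) S"
proof -
  define P where "P = num_types I"
  define F :: "nat \<Rightarrow> real" where "F p = of_int \<lfloor>tail S p\<rfloor>" for p :: nat
  define n where "n p = nat (\<lfloor>tail S p\<rfloor> - \<lfloor>tail S (Suc p)\<rfloor>)" for p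
  have finS: "finite S" by (rule finite_subset[OF S]) simp
  have nF: "real (n p) = F p - F (Suc p)" if "1 \<le> p" for p
    unfolding n_def F_def using floor_mono[OF tail_mono[OF S that, of "Suc p"]] by simp
  have F0: "0 \<le> F p" if "1 \<le> p" for p using tail_nonneg[OF S that] by (simp add: F_def)
  have nS: "n p \<le> card S" if "1 \<le> p" for p
  proof -
    have "real (n p) \<le> F p" using nF[OF that] F0[of "Suc p"] by simp
    also have "F p \<le> tail S p" by (simp add: F_def)
    also have "\<dots> \<le> tail S 1" by (rule tail_mono[OF S _ that]) simp
    also have "\<dots> \<le> card S" by (rule tail_le_card[OF S])
    finally show ?thesis by simp
  qed
  \<comment> \<open>A facility may be opened with several types, so the types can be rounded independently.\<close>
  have "\<exists>Z. Z \<subseteq> S \<and> card Z = n p" if "1 \<le> p" for p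
    using obtain_subset_with_card_n[OF nS[OF that]] by metis
  then obtain Z where Z: "\<And>p. 1 \<le> p \<Longrightarrow> Z p \<subseteq> S" "\<And>p. 1 \<le> p \<Longrightarrow> card (Z p) = n p" by metis
  define ybar :: yvars where "ybar i p = of_bool (i \<in> Z p)" for i p
  have sum_ybar: "(\<Sum>i\<in>S. ybar i p) = n p" if "1 \<le> p" for p
  proof -
    have "(\<Sum>i\<in>S. ybar i p) = card (S \<inter> Z p)"
      using finS by (simp add: ybar_def of_bool_def sum.If_cases Int_def)
    then show ?thesis using Z[OF that] by (simp add: Int_absorb1)
  qed
  have tail0: "tail S (Suc P) = 0" by (simp add: tail_def P_def)
  have sub: "(\<Sum>q\<in>{p..P}. \<Sum>i\<in>S. ybar i q) = F p" if p: "p \<in> types I" for p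
  proof -
    have "(\<Sum>q\<in>{p..P}. \<Sum>i\<in>S. ybar i q) = (\<Sum>q\<in>{p..P}. F q - F (Suc q))"
      by (rule sum.cong[OF refl]) (use p sum_ybar nF in \<open>auto simp: types_def\<close>)
    also have "\<dots> = F p - F (Suc P)"
      by (rule tail_telescope) (use p in \<open>auto simp: types_def P_def\<close>)
    finally show ?thesis using tail0 by (simp add: F_def)
  qed
  have mass: "(\<Sum>j\<in>C0. \<Sum>i\<in>S. \<Sum>p\<in>types I. z i j p)
      \<le> (1 + \<delta>) * (\<Sum>i\<in>S. \<Sum>p\<in>types I. real (capac I p) * ybar i p)"
  proof -
    \<comment> \<open>The tails with the dropped types cut off. At the last type above the
      threshold, \<open>G p - G (Suc p)\<close> is the whole tail and thus at least the mass of type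
      \<open>p\<close>.\<close>
    define G where "G p = (if tail S p < real N + 1 then 0 else tail S p)" for p
    have "(\<Sum>j\<in>C0. \<Sum>i\<in>S. \<Sum>p\<in>types I. z i j p) = (\<Sum>p\<in>types I. \<Sum>i\<in>S. \<Sum>j\<in>C0. z i j p)"
    proof -
      have "(\<Sum>j\<in>C0. \<Sum>i\<in>S. \<Sum>p\<in>types I. z i j p) = (\<Sum>j\<in>C0. \<Sum>p\<in>types I. \<Sum>i\<in>S. z i j p)"
        by (rule sum.cong[OF refl]) (rule sum.swap)
      also have "\<dots> = (\<Sum>p\<in>types I. \<Sum>j\<in>C0. \<Sum>i\<in>S. z i j p)" by (rule sum.swap)
      also have "\<dots> = (\<Sum>p\<in>types I. \<Sum>i\<in>S. \<Sum>j\<in>C0. z i j p)"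
        by (rule sum.cong[OF refl]) (rule sum.swap)
      finally show ?thesis .
    qed
    also have "\<dots> \<le> (\<Sum>p\<in>types I. real (capac I p) * (G p - G (Suc p)))"
    proof (rule sum_mono)
      fix p assume p: "p \<in> types I"
      then have p1: "1 \<le> p" "p \<le> P" by (auto simp: types_def P_def)
      show "(\<Sum>i\<in>S. \<Sum>j\<in>C0. z i j p) \<le> real (capac I p) * (G p - G (Suc p))"
      proof (cases "tail S p < real N + 1")
        case True
        moreover have "tail S (Suc p) \<le> tail S p" by (rule tail_mono[OF S p1(1)]) simp
        ultimately have "G p = 0" "G (Suc p) = 0" by (auto simp: G_def)
        then show ?thesis using z0[OF _ p True] by simp
      next
        case False
        have "(\<Sum>i\<in>S. \<Sum>j\<in>C0. z i j p) \<le> (\<Sum>i\<in>S. real (capac I p) * y i p)"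
          by (rule sum_mono) (rule z[OF _ p])
        also have "\<dots> = real (capac I p) * (tail S p - tail S (Suc p))"
          using tail_Suc[of p S] p1 by (simp add: sum_distrib_left P_def)
        also have "\<dots> \<le> real (capac I p) * (G p - G (Suc p))"
          by (rule mult_left_mono) (use False tail_nonneg[OF S, of "Suc p"] in \<open>auto simp: G_def\<close>)
        finally show ?thesis .
      qed
    qed
    also have "\<dots> \<le> (1 + 1 / real N) * (\<Sum>p\<in>types I. real (capac I p) * (F p - F (Suc p)))"
      unfolding types_def P_def[symmetric]
    proof (rule weighted_tails_mono)
      show "G p \<le> (1 + 1 / real N) * F p" if "1 \<le> p" for p
      proof (cases "tail S p < real N + 1")
        case True
        have "0 \<le> (1 + 1 / real N) * F p" using F0[OF that] by (intro mult_nonneg_nonneg) auto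
        then show ?thesis using True by (simp add: G_def)
      next
        case False
        define t where "t = tail S p"
        have "t - 1 \<le> F p" unfolding F_def t_def by linarith
        then have "(1 + 1 / real N) * (t - 1) \<le> (1 + 1 / real N) * F p" by (intro mult_left_mono) auto
        moreover have "t \<le> (1 + 1 / real N) * (t - 1)"
        proof -
          have "1 \<le> (t - 1) / real N" using False N by (simp add: t_def)
          then show ?thesis by (simp add: algebra_simps diff_divide_distrib)
        qed
        ultimately show ?thesis using False by (simp add: G_def t_def)
      qed
      show "real (capac I p) \<le> real (capac I (Suc p))" if "1 \<le> p" "p < P" for p
        using capac_mono that by (simp add: P_def)
      show "F (Suc P) = 0" "G (Suc P) = 0" using tail0 by (auto simp: F_def G_def)
    qed simp
    also have "(\<Sum>p\<in>types I. real (capac I p) * (F p - F (Suc p)))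
        = (\<Sum>i\<in>S. \<Sum>p\<in>types I. real (capac I p) * ybar i p)"
    proof -
      have "(\<Sum>p\<in>types I. real (capac I p) * (F p - F (Suc p)))
          = (\<Sum>p\<in>types I. real (capac I p) * (\<Sum>i\<in>S. ybar i p))"
        by (rule sum.cong[OF refl]) (use sum_ybar nF in \<open>auto simp: types_def\<close>)
      also have "\<dots> = (\<Sum>p\<in>types I. \<Sum>i\<in>S. real (capac I p) * ybar i p)"
        by (simp add: sum_distrib_left)
      also have "\<dots> = (\<Sum>i\<in>S. \<Sum>p\<in>types I. real (capac I p) * ybar i p)" by (rule sum.swap)
      finally show ?thesis .
    qed
    also have "(1 + 1 / real N) * (\<Sum>i\<in>S. \<Sum>p\<in>types I. real (capac I p) * ybar i p)
        \<le> (1 + \<delta>) * (\<Sum>i\<in>S. \<Sum>p\<in>types I. real (capac I p) * ybar i p)"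
      using \<delta> by (intro mult_right_mono sum_nonneg) (auto simp: ybar_def)
    finally show ?thesis .
  qed
  show ?thesis
    unfolding roundable_def
  proof (intro conjI exI[of _ ybar])
    show "\<forall>p\<in>types I. (\<Sum>q\<in>{p..num_types I}. \<Sum>i\<in>S. ybar i q)
        \<le> of_int \<lfloor>\<Sum>q\<in>{p..num_types I}. \<Sum>i\<in>S. y i q\<rfloor>"
      using sub unfolding P_def F_def tail_def by simp
  qed (use S diam mass in \<open>auto simp: ybar_def\<close>)
qed

section \<open>Correctness\<close>

abbreviation "z \<equiv> new_x I N x y"

lemma new_x_le: "i \<in> facs I \<Longrightarrow> j \<in> C0 \<Longrightarrow> p \<in> types I \<Longrightarrow> 0 \<le> z i j p \<and> z i j p \<le> x i j p"
  using x_nonneg[of i j p] by (simp add: new_x_def)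

lemma new_x_valid: "supported I z" "nonneg_x I z" "L2 I z y" "L4 I z y"
proof -
  show "supported I z" using feas by (simp add: supported_def feasible_def new_x_def)
  show "nonneg_x I z" using new_x_le by (simp add: nonneg_x_def)
  show "L4 I z y" using new_x_le x_le_y by (fastforce simp: L4_def)
  show "L2 I z y"
    unfolding L2_def
  proof (intro ballI)
    fix i p assume i: "i \<in> facs I" "p \<in> types I"
    have "(\<Sum>j\<in>C0. z i j p) \<le> (\<Sum>j\<in>C0. x i j p)" by (rule sum_mono) (use new_x_le i in simp)
    also have "\<dots> \<le> real (capac I p) * y i p" using feas i by (simp add: feasible_def L2_def)
    finally show "(\<Sum>j\<in>C0. z i j p) \<le> real (capac I p) * y i p" .
  qed
qed

abbreviation "lone \<equiv> lone_facs I N"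

lemma cluster_roundable:
  assumes "1 / real N \<le> \<delta>"
  shows "roundable I z y (2 * real reach) (1 + \<delta>) (cluster I N l)"
proof (rule roundableI[OF _ _ _ _ assms])
  show "cluster I N l \<subseteq> facs I" using cluster_fac by blast
  have "ereal_of_enat (diam_G I (cluster I N l)) \<le> ereal (real (2 * reach))"
    by (rule diam_G_le) (rule cluster_diam)
  then show "ereal_of_enat (diam_G I (cluster I N l)) \<le> ereal (2 * real reach)" by simp
  show "(\<Sum>j\<in>C0. z i j p) = 0" if "i \<in> cluster I N l" "tail (cluster I N l) p < real N + 1" for i p
    using that by (intro sum.neutral) (auto simp: new_x_def kept_def tail_def cluster_def)
  show "(\<Sum>j\<in>C0. z i j p) \<le> real (capac I p) * y i p" if "i \<in> cluster I N l" "p \<in> types I" for i p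
    using new_x_valid(3) cluster_fac[OF that(1)] that(2) by (simp add: L2_def)
qed

lemma lone_roundable:
  assumes "1 / real N \<le> \<delta>" "i \<in> lone"
  shows "roundable I z y (2 * real reach) (1 + \<delta>) {i}"
proof (rule roundableI[OF _ _ _ _ assms(1)])
  have i: "i \<in> facs I" "i \<notin> open_facs I N" using assms(2) by (auto simp: lone_facs_def open_facs_def)
  then show "{i} \<subseteq> facs I" by simp
  have "hop_dist I (Inl i) (Inl i) \<le> enat 0"
    unfolding hop_dist_def by (rule INF_lower) simp
  then have "ereal_of_enat (diam_G I {i}) \<le> ereal (real 0)" by (intro diam_G_le) simp
  then show "ereal_of_enat (diam_G I {i}) \<le> ereal (2 * real reach)"
    by (rule order_trans) simp
  show "(\<Sum>j\<in>C0. z i' j p) = 0" if "i' \<in> {i}" for i' p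
    using that i(2) by (intro sum.neutral) (auto simp: new_x_def)
  show "(\<Sum>j\<in>C0. z i' j p) \<le> real (capac I p) * y i' p" if "i' \<in> {i}" "p \<in> types I" for i' p
    using new_x_valid(3) i that by (simp add: L2_def)
qed

lemma core_complete:
  assumes "J \<in> Cores"
  shows "complete_nbhd I (2 * real reach) (nbrs I J)" "responsible I J (nbrs I J)"
proof -
  show r: "responsible I J (nbrs I J)" using cores_sub[OF assms] by (simp add: responsible_def)
  have "ereal_of_enat (diam_G I (nbrs I J)) \<le> ereal (real (2 * reach))"
  proof (rule diam_G_le)
    fix i i' assume "i \<in> nbrs I J" "i' \<in> nbrs I J"
    then obtain j k where jk: "j \<in> J" "adjacent I i j" "k \<in> J" "adjacent I i' k" by (auto simp: nbrs_def)
    have "hop_dist I (Inl i) (Inl i') \<le> enat (2 * (2 * h) + 2)"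
      by (rule hop_dist_le[OF cores_hops[OF assms jk(1,3)] jk(2,4)])
    also have "\<dots> \<le> enat (2 * reach)" unfolding enat_ord_simps using h_large by simp
    finally show "hop_dist I (Inl i) (Inl i') \<le> enat (2 * reach)" .
  qed
  then show "complete_nbhd I (2 * real reach) (nbrs I J)"
    using r by (auto simp: complete_nbhd_def nbrs_def adjacent_def)
qed

section \<open>The parts and the partition of the facilities\<close>

abbreviation "Cl \<equiv> filter (\<lambda>l. cluster I N l \<noteq> {}) (sorted_list_of_set A)"
abbreviation "parts \<equiv> (map (cluster I N) Cl @ map (\<lambda>i. {i}) (sorted_list_of_set lone)) @ map (nbrs I) (cores I N)"

lemma lone_finite [simp]: "finite lone"
  by (simp add: lone_facs_def)

lemma nbrs_nonempty: "J \<in> Cores \<Longrightarrow> nbrs I J \<noteq> {}"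
proof -
  assume J: "J \<in> Cores"
  obtain j where "j \<in> J" using cores_nonempty[OF J] by blast
  moreover have "j \<in> C0" by (rule subsetD[OF cores_sub[OF J] \<open>j \<in> J\<close>])
  then obtain i where "adjacent I i j" by (rule client_has_facility)
  ultimately show ?thesis by (auto simp: nbrs_def)
qed

text \<open>A common facility would link the two cores.\<close>

lemma nbrs_disjoint: "J \<in> Cores \<Longrightarrow> J' \<in> Cores \<Longrightarrow> J \<noteq> J' \<Longrightarrow> nbrs I J \<inter> nbrs I J' = {}"
  using cores_unlinked[of J J'] by (fastforce simp: nbrs_def linked_def adjacent_def)

lemma cluster_nbrs: "J \<in> Cores \<Longrightarrow> open_facs I N \<inter> nbrs I J = {}"
proof (erule cores_cases)
  assume J: "J \<in> set cored"
  have False if i: "i \<in> open_facs I N" "i \<in> nbrs I J" for i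
  proof -
    obtain j k where "j \<in> J" "adjacent I i j" "k \<in> R" "adjacent I i k"
      using i by (auto simp: open_facs_def nbrs_def)
    then show False using cored_props(5)[OF J, of j k] by (auto simp: linked_def adjacent_def)
  qed
  then show ?thesis by blast
next
  fix a assume "a \<in> sealed" "J = B h a"
  then show ?thesis by (auto simp: open_facs_def nbrs_def)
qed

lemma lone_nbrs: "J \<in> Cores \<Longrightarrow> lone \<inter> nbrs I J = {}"
proof (erule cores_cases)
  assume "J \<in> set cored"
  then show ?thesis by (auto simp: lone_facs_def nbrs_def)
next
  fix a assume a: "a \<in> sealed" "J = B h a"
  have "J \<subseteq> R" unfolding a(2) by (rule ball_subset[OF sink_rest[OF closed_sub[OF a(1)]]])
  then show ?thesis by (auto simp: lone_facs_def nbrs_def)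
qed

lemma cluster_open: "cluster I N l \<subseteq> open_facs I N"
  by (auto simp: cluster_def)

lemma lone_open: "lone \<inter> open_facs I N = {}"
  by (auto simp: lone_facs_def open_facs_def)

lemma cores_distinct: "distinct (cores I N)"
proof -
  have "inj_on (B h) sealed"
  proof (rule inj_onI, rule ccontr)
    fix a b assume ab: "a \<in> sealed" "b \<in> sealed" "B h a = B h b" "a \<noteq> b"
    have "B h a \<inter> B h b = {}" by (rule balls_disjoint[OF closed_sub[OF ab(1)] closed_sub[OF ab(2)] ab(4)]) simp
    then show False using ab ball_self[OF sink_rest[OF closed_sub[OF ab(1)]], of h] by auto
  qed
  moreover have "set cored \<inter> B h ` sealed = {}"
  proof -
    have False if "B h a \<in> set cored" "a \<in> sealed" for a
      using cored_props(3)[OF that(1)] ball_self[OF sink_rest[OF closed_sub[OF that(2)]], of h]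
        sink_rest[OF closed_sub[OF that(2)]] by blast
    then show ?thesis by blast
  qed
  ultimately show ?thesis using cored_distinct by (simp add: cores_def distinct_map)
qed

text \<open>The partition property concerns only the set of parts. Repetitions in the list are
  excluded because distinct indices give disjoint nonempty parts.\<close>

lemma parts_distinct: "distinct parts"
proof -
  have 1: "inj_on (cluster I N) (set Cl)"
    by (rule inj_onI) (auto simp: cluster_def)
  have 2: "inj_on (nbrs I) Cores"
  proof (rule inj_onI, rule ccontr)
    fix J J' assume "J \<in> Cores" "J' \<in> Cores" "nbrs I J = nbrs I J'" "J \<noteq> J'"
    then show False using nbrs_disjoint[of J J'] nbrs_nonempty[of J] by auto
  qed
  have 3: "cluster I N l \<noteq> {i}" if "i \<in> lone" for l i using that cluster_open[of l] lone_open by blast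
  have 4: "cluster I N l \<noteq> nbrs I J" if "J \<in> Cores" for l J
    using cluster_nbrs[OF that] cluster_open[of l] nbrs_nonempty[OF that] by blast
  have 5: "{i} \<noteq> nbrs I J" if "J \<in> Cores" "i \<in> lone" for J i
    using lone_nbrs[OF that(1)] that(2) by blast
  show ?thesis
    unfolding distinct_append
    using 1 2 cores_distinct 3 4 5 4[symmetric] 5[symmetric]
    by (auto simp: distinct_map)
qed

lemma parts_partition: "partition_on (facs I) (set parts)"
proof -
  have sets: "P \<in> set parts \<longleftrightarrow> (\<exists>l\<in>A. P = cluster I N l \<and> P \<noteq> {}) \<or> (\<exists>i\<in>lone. P = {i}) \<or>
      (\<exists>J\<in>Cores. P = nbrs I J)" for P by auto
  have ne: "{} \<notin> set parts" using nbrs_nonempty unfolding sets by auto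
  have un: "\<Union> (set parts) = facs I"
  proof (intro equalityI subsetI)
    fix i assume "i \<in> \<Union> (set parts)"
    then show "i \<in> facs I"
      using cluster_fac by (auto simp: nbrs_def adjacent_def lone_facs_def)
  next
    fix i assume i: "i \<in> facs I"
    have "(\<exists>l\<in>A. i \<in> cluster I N l) \<or> i \<in> lone \<or> (\<exists>J\<in>Cores. i \<in> nbrs I J)"
    proof (cases "i \<in> open_facs I N")
      case True
      then show ?thesis using lab_sink[OF centre_sink[OF True]] by (auto simp: cluster_def)
    next
      case False
      then show ?thesis
        using i by (auto simp: open_facs_def lone_facs_def cores_def nbrs_def)
    qed
    then show "i \<in> \<Union> (set parts)" by auto
  qed
  have dj: "P \<inter> Q = {}" if PQ: "P \<in> set parts" "Q \<in> set parts" "P \<noteq> Q" for P Q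
  proof -
    have cc: "cluster I N l \<inter> cluster I N l' = {}" if "cluster I N l \<noteq> cluster I N l'" for l l'
      using that by (auto simp: cluster_def)
    have cl: "cluster I N l \<inter> {i} = {}" if "i \<in> lone" for l i
      using that cluster_open[of l] lone_open by blast
    have cn: "cluster I N l \<inter> nbrs I J = {}" if "J \<in> Cores" for l J
      using cluster_open[of l] cluster_nbrs[OF that] by blast
    have ln: "{i} \<inter> nbrs I J = {}" if "J \<in> Cores" "i \<in> lone" for i J
      using lone_nbrs[OF that(1)] that(2) by blast
    have nn: "nbrs I J \<inter> nbrs I J' = {}" if "J \<in> Cores" "J' \<in> Cores" "nbrs I J \<noteq> nbrs I J'" for J J'
      by (rule nbrs_disjoint[OF that(1,2)]) (use that in auto)
    show ?thesis
      using PQ(1,2) unfolding sets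
      by (elim disjE bexE conjE) (use PQ(3) cc cl cn ln nn in \<open>simp_all add: Int_commute\<close>)
  qed
  show ?thesis using dj by (intro partition_onI un ne) (simp add: disjnt_def)
qed

text \<open>Every facility to which \<open>new_x\<close> assigns anything is open and hence in a
  cluster, so the restricted sum is the full one. The tolerance is
  \<open>1 / (100 * N) \<le> \<delta> / 100\<close>.\<close>

lemma good_served:
  assumes "j \<in> live I N - Bad" "1 / real N \<le> \<delta>"
  shows "1 - \<delta> / 100 \<le> (\<Sum>i\<in>\<Union> (set (map (cluster I N) Cl @ map (\<lambda>i. {i}) (sorted_list_of_set lone))).
      \<Sum>p\<in>types I. z i j p)"
proof -
  let ?U = "\<Union> (set (map (cluster I N) Cl @ map (\<lambda>i. {i}) (sorted_list_of_set lone)))"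
  have U: "?U \<subseteq> facs I" using cluster_fac by (auto simp: lone_facs_def)
  have "(\<Sum>i\<in>facs I. \<Sum>p\<in>types I. z i j p) = (\<Sum>i\<in>?U. \<Sum>p\<in>types I. z i j p)"
  proof (rule sum.mono_neutral_right[OF finite_facs U], rule ballI)
    fix i assume i: "i \<in> facs I - ?U"
    have "i \<notin> open_facs I N"
    proof
      assume o: "i \<in> open_facs I N"
      then have "i \<in> cluster I N (lab (centre I N i))" by (simp add: cluster_def)
      then have "i \<in> ?U" using lab_sink[OF centre_sink[OF o]] by auto
      then show False using i by simp
    qed
    then show "(\<Sum>p\<in>types I. z i j p) = 0" by (simp add: new_x_def)
  qed
  moreover have "1 - 1 / (100 * real N) \<le> (\<Sum>i\<in>facs I. \<Sum>p\<in>types I. z i j p)"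
    using assms(1) by (auto simp: bad_def not_less)
  moreover have "1 / (100 * real N) = (1 / real N) / 100" by simp
  then have "1 / (100 * real N) \<le> \<delta> / 100" using assms(2) by linarith
  ultimately show ?thesis by linarith
qed

theorem decompose_correct:
  assumes "1 / real N \<le> \<delta>" "2 * real reach \<le> r"
  shows "is_decomposition I y \<delta> r (decompose I N x y)"
proof -
  have mono_round: "roundable I z y r b S" if "roundable I z y (2 * real reach) b S" for b S
  proof -
    have "ereal (2 * real reach) \<le> ereal r" using assms(2) by simp
    then show ?thesis using that unfolding roundable_def by (meson order_trans)
  qed
  have mono_complete: "complete_nbhd I r T" if "complete_nbhd I (2 * real reach) T" for T
  proof -
    have "ereal (2 * real reach) \<le> ereal r" using assms(2) by simp
    then show ?thesis using that unfolding complete_nbhd_def by (meson order_trans)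
  qed
  have o: "opt I > 0" using wf by (simp add: wf_instance_def)
  have del: "deletable I r \<delta> Del"
  proof -
    have le: "2 * real reach * opt I \<le> r * opt I" using o assms(2) by (intro mult_right_mono) auto
    show ?thesis by (rule deletable_mono[OF Del_deletable[OF assms(1)] le])
  qed
  have L: "live I N \<subseteq> C0" by (rule subsetI) (rule rest_client[OF live_rest])
  have T: "\<Union> Cores \<subseteq> C0" by (rule Union_least) (rule cores_sub)
  have LT: "live I N \<inter> \<Union> Cores = {}"
  proof (rule equals0I)
    fix j assume "j \<in> live I N \<inter> \<Union> Cores"
    then obtain J where "j \<in> live I N" "J \<in> Cores" "j \<in> J" by (elim IntE UnionE)
    then show False using live_core[of j J] by simp
  qed
  show ?thesis
    unfolding is_decomposition_def decompose_def decomposition.simps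
  proof (intro conjI)
    show "supported I z" "nonneg_x I z" "L2 I z y" "L4 I z y" by (rule new_x_valid)+
    have parts: "(map (cluster I N) Cl @ map (\<lambda>i. {i}) (sorted_list_of_set lone)) @
        map fst (map (\<lambda>J. (nbrs I J, J)) (cores I N)) = parts" by (simp add: comp_def)
    show "distinct ((map (cluster I N) Cl @ map (\<lambda>i. {i}) (sorted_list_of_set lone)) @
        map fst (map (\<lambda>J. (nbrs I J, J)) (cores I N)))" unfolding parts by (rule parts_distinct)
    show "partition_on (facs I) (set ((map (cluster I N) Cl @ map (\<lambda>i. {i}) (sorted_list_of_set lone)) @
        map fst (map (\<lambda>J. (nbrs I J, J)) (cores I N))))" unfolding parts by (rule parts_partition)
    show "C0 = Del \<union> \<Union> Cores \<union> (live I N - Bad)" using L T by blast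
    show "Del \<inter> \<Union> Cores = {}" "Del \<inter> (live I N - Bad) = {}" by blast+
    show "\<Union> Cores \<inter> (live I N - Bad) = {}" using LT by blast
    show "deletable I r \<delta> Del" by (rule del)
    show "\<forall>S\<in>set (map (cluster I N) Cl @ map (\<lambda>i. {i}) (sorted_list_of_set lone)).
        roundable I z y r (1 + \<delta>) S"
      using mono_round cluster_roundable[OF assms(1)] lone_roundable[OF assms(1)] by auto
    show "\<forall>j\<in>live I N - Bad. 1 - \<delta> / 100 \<le>
        (\<Sum>i\<in>\<Union> (set (map (cluster I N) Cl @ map (\<lambda>i. {i}) (sorted_list_of_set lone))). \<Sum>p\<in>types I. z i j p)"
      using good_served[OF _ assms(1)] by blast
    show "\<forall>(T, J)\<in>set (map (\<lambda>J. (nbrs I J, J)) (cores I N)). complete_nbhd I r T \<and> responsible I J T"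
      using core_complete mono_complete by auto
    show "\<Union> Cores = (\<Union>(T, J)\<in>set (map (\<lambda>J. (nbrs I J, J)) (cores I N)). J)" by auto
  qed
qed

end

section \<open>Computable set operations\<close>

text \<open>
  \<open>computes D e d ok f\<close>: from the code \<open>e s\<close> of a context \<open>s\<close> in \<open>D\<close> the code \<open>d (f s)\<close> is
  computable in polynomial time, and \<open>f s\<close> satisfies \<open>ok\<close>. Local variables extend contexts to
  pairs: \<open>extend d e\<close> encodes a context together with the value of a further variable.
\<close>

definition computes ::
  "'s set \<Rightarrow> ('s \<Rightarrow> val) \<Rightarrow> ('a \<Rightarrow> val) \<Rightarrow> ('a \<Rightarrow> bool) \<Rightarrow> ('s \<Rightarrow> 'a) \<Rightarrow> bool" where
  "computes D e d ok f \<longleftrightarrow> poly_time D e (\<lambda>s. d (f s)) \<and> (\<forall>s\<in>D. ok (f s))"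

definition extend :: "('a \<Rightarrow> val) \<Rightarrow> ('s \<Rightarrow> val) \<Rightarrow> 's \<times> 'a \<Rightarrow> val" where
  "extend d e = (\<lambda>z. VCons (e (fst z)) (d (snd z)))"

abbreviation "nat_c D e f \<equiv> computes D e enc_nat (\<lambda>_. True) f"
abbreviation "bool_c D e f \<equiv> computes D e val_of_bool (\<lambda>_. True) f"
abbreviation "rat_c D e f \<equiv> computes D e VNum (\<lambda>_. True) f"
abbreviation "set_c D e f \<equiv> computes D e enc_set finite f"
abbreviation "sets_c D e f \<equiv> computes D e (enc_list enc_set) (\<lambda>Js. \<forall>J\<in>set Js. finite J) f"

lemma computes_lift: "computes D e d ok f \<Longrightarrow> computes (Sigma D A) (extend d' e) d ok (\<lambda>z. f (fst z))"
  unfolding computes_def extend_def by (auto intro: poly_time_lift)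

lemma computes_var: "(\<And>s a. s \<in> D \<Longrightarrow> a \<in> A s \<Longrightarrow> ok a) \<Longrightarrow> computes (Sigma D A) (extend d e) d ok snd"
  unfolding computes_def extend_def by (auto intro: poly_time_var)

lemma nat_var: "nat_c (Sigma D A) (extend enc_nat e) snd"
  by (rule computes_var) simp

lemma computes_mono: "computes D e d ok f \<Longrightarrow> D' \<subseteq> D \<Longrightarrow> computes D' e d ok f"
  unfolding computes_def by (auto elim: poly_time_subset)

lemma computes_cong: "computes D e d ok g \<Longrightarrow> (\<And>s. s \<in> D \<Longrightarrow> f s = g s) \<Longrightarrow> computes D e d ok f"
  unfolding computes_def by (auto elim: poly_time_cong)

lemma computes_poly: "computes D e d ok f \<Longrightarrow> poly_time D e (\<lambda>s. d (f s))"
  and computes_ok: "computes D e d ok f \<Longrightarrow> s \<in> D \<Longrightarrow> ok (f s)"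
  by (auto simp: computes_def)

lemma computesI: "poly_time D e (\<lambda>s. d (f s)) \<Longrightarrow> (\<And>s. s \<in> D \<Longrightarrow> ok (f s)) \<Longrightarrow> computes D e d ok f"
  by (auto simp: computes_def)

lemma computes_plainI: "poly_time D e (\<lambda>s. d (f s)) \<Longrightarrow> computes D e d (\<lambda>_. True) f"
  by (auto simp: computes_def)

lemma computes_cond:
  assumes "bool_c D e c" "computes {s\<in>D. c s} e d ok f" "computes {s\<in>D. \<not> c s} e d ok g"
  shows "computes D e d ok (\<lambda>s. if c s then f s else g s)"
proof (rule computesI)
  have "poly_time D e (\<lambda>s. if c s then d (f s) else d (g s))"
    using assms by (intro poly_time_cond) (auto simp: computes_def)
  then show "poly_time D e (\<lambda>s. d (if c s then f s else g s))" by (rule poly_time_cong) simp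
qed (use assms in \<open>auto simp: computes_def\<close>)

lemma computes_if:
  assumes "bool_c D e c" "computes D e d ok f" "computes D e d ok g"
  shows "computes D e d ok (\<lambda>s. if c s then f s else g s)"
  using assms by (intro computes_cond) (auto elim: computes_mono)

lemma computes_const: "ok c \<Longrightarrow> computes D e d ok (\<lambda>_. c)"
  by (intro computesI poly_time_const)

lemma nat_const: "nat_c D e (\<lambda>_. c)"
  by (rule computes_const) simp

lemma nat_add: "nat_c D e f \<Longrightarrow> nat_c D e g \<Longrightarrow> nat_c D e (\<lambda>s. f s + g s)"
  by (intro computes_plainI poly_time_nat_add computes_poly)

lemma nat_mult: "nat_c D e f \<Longrightarrow> nat_c D e g \<Longrightarrow> nat_c D e (\<lambda>s. f s * g s)"
  by (intro computes_plainI poly_time_nat_mult computes_poly)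

lemma nat_min: "nat_c D e f \<Longrightarrow> nat_c D e g \<Longrightarrow> nat_c D e (\<lambda>s. min (f s) (g s))"
  by (intro computes_plainI poly_time_nat_min computes_poly)

lemma bool_less: "nat_c D e f \<Longrightarrow> nat_c D e g \<Longrightarrow> bool_c D e (\<lambda>s. f s < g s)"
  by (intro computes_plainI poly_time_nat_less computes_poly)

lemma bool_le: "nat_c D e f \<Longrightarrow> nat_c D e g \<Longrightarrow> bool_c D e (\<lambda>s. f s \<le> g s)"
  by (intro computes_plainI poly_time_nat_le computes_poly)

lemma bool_eq: "nat_c D e f \<Longrightarrow> nat_c D e g \<Longrightarrow> bool_c D e (\<lambda>s. f s = g s)"
  by (intro computes_plainI poly_time_nat_eq computes_poly)

lemma bool_not: "bool_c D e f \<Longrightarrow> bool_c D e (\<lambda>s. \<not> f s)"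
  by (intro computes_plainI poly_time_not computes_poly)

lemma bool_conj: "bool_c D e f \<Longrightarrow> bool_c D e g \<Longrightarrow> bool_c D e (\<lambda>s. f s \<and> g s)"
  by (intro computes_plainI poly_time_conj computes_poly)

lemma bool_disj: "bool_c D e f \<Longrightarrow> bool_c D e g \<Longrightarrow> bool_c D e (\<lambda>s. f s \<or> g s)"
  by (intro computes_plainI poly_time_disj computes_poly)

lemma rat_const: "rat_c D e (\<lambda>_. c)"
  by (rule computes_const) simp

lemma rat_less: "rat_c D e f \<Longrightarrow> rat_c D e g \<Longrightarrow> bool_c D e (\<lambda>s. f s < g s)"
  by (intro computes_plainI poly_time_less computes_poly)

lemma rat_le: "rat_c D e f \<Longrightarrow> rat_c D e g \<Longrightarrow> bool_c D e (\<lambda>s. f s \<le> g s)"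
  by (intro computes_plainI poly_time_le computes_poly)

lemma rat_add: "rat_c D e f \<Longrightarrow> rat_c D e g \<Longrightarrow> rat_c D e (\<lambda>s. f s + g s)"
  by (intro computes_plainI poly_time_add computes_poly)

lemma rat_diff: "rat_c D e f \<Longrightarrow> rat_c D e g \<Longrightarrow> rat_c D e (\<lambda>s. f s - g s)"
  by (intro computes_plainI poly_time_diff computes_poly)

lemma rat_mult: "rat_c D e f \<Longrightarrow> rat_c D e g \<Longrightarrow> rat_c D e (\<lambda>s. f s * g s)"
  by (intro computes_plainI poly_time_mult computes_poly)

lemma rat_divide: "rat_c D e f \<Longrightarrow> rat_c D e g \<Longrightarrow> rat_c D e (\<lambda>s. f s / g s)"
  by (intro computes_plainI poly_time_divide computes_poly)

lemma rat_of_nat: "nat_c D e f \<Longrightarrow> rat_c D e (\<lambda>s. of_nat (f s))"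
  unfolding computes_def enc_nat_def by simp

subsection \<open>Sets\<close>

lemma sorted_list_filter:
  fixes A :: "nat set"
  shows "finite A \<Longrightarrow> sorted_list_of_set {a\<in>A. P a} = filter P (sorted_list_of_set A)"
  by (rule sorted_distinct_set_unique[symmetric]) (auto simp: sorted_wrt_filter)

text \<open>Reduces insertion into an increasing list to two filters, so that no sorting program has
  to be analysed.\<close>

lemma sorted_list_insert:
  fixes A :: "nat set"
  assumes "finite A"
  shows "sorted_list_of_set (insert k A) =
    filter (\<lambda>a. a < k) (sorted_list_of_set A) @ k # filter (\<lambda>a. k < a) (sorted_list_of_set A)"
proof (rule sorted_distinct_set_unique)
  show "sorted (sorted_list_of_set (insert k A))" by (rule sorted_sorted_list_of_set)
  show "distinct (sorted_list_of_set (insert k A))" by (rule distinct_sorted_list_of_set)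
  have "set (sorted_list_of_set (insert k A)) = insert k A"
    by (rule set_sorted_list_of_set) (simp add: assms)
  then show "set (sorted_list_of_set (insert k A)) = set (filter (\<lambda>a. a < k) (sorted_list_of_set A) @
      k # filter (\<lambda>a. k < a) (sorted_list_of_set A))"
    using assms by auto
qed (use assms in \<open>auto simp: sorted_append sorted_wrt_filter\<close>)

lemma enc_set_list: "enc_set A = enc_list enc_nat (sorted_list_of_set A)"
  by (simp add: enc_set_def)

lemma Sigma_sorted:
  assumes "set_c D e A"
  shows "Sigma D (\<lambda>s. set (sorted_list_of_set (A s))) = Sigma D A"
  using computes_ok[OF assms] by (intro Sigma_cong) auto

lemma body_sorted:
  assumes "set_c D e A" "poly_time (Sigma D A) (extend enc_nat e) g"
  shows "poly_time (Sigma D (\<lambda>s. set (sorted_list_of_set (A s))))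
    (\<lambda>z. VCons (e (fst z)) (enc_nat (snd z))) g"
  using assms(2) unfolding Sigma_sorted[OF assms(1)] extend_def by simp

lemma set_filter:
  assumes "set_c D e A" "bool_c (Sigma D A) (extend enc_nat e) (\<lambda>z. P (fst z) (snd z))"
  shows "set_c D e (\<lambda>s. {a\<in>A s. P s a})"
proof (rule computesI)
  have "poly_time D e (\<lambda>s. enc_list enc_nat (filter (P s) (sorted_list_of_set (A s))))"
    by (rule poly_time_filter[OF computes_poly[OF assms(1), unfolded enc_set_list]])
       (rule body_sorted[OF assms(1) computes_poly[OF assms(2)]])
  then show "poly_time D e (\<lambda>s. enc_set {a\<in>A s. P s a})"
    by (rule poly_time_cong) (simp add: enc_set_list sorted_list_filter[OF computes_ok[OF assms(1)]])
qed (use computes_ok[OF assms(1)] in simp)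

lemma table_c:
  assumes "set_c D e A" "poly_time (Sigma D A) (extend enc_nat e) (\<lambda>z. g (fst z) (snd z))"
  shows "poly_time D e (\<lambda>s. enc_table (A s) (g s))"
  unfolding enc_table_def
  by (rule poly_time_map[OF computes_poly[OF assms(1), unfolded enc_set_list]])
     (rule body_sorted[OF assms])

lemma bool_bex:
  assumes "set_c D e A" "bool_c (Sigma D A) (extend enc_nat e) (\<lambda>z. P (fst z) (snd z))"
  shows "bool_c D e (\<lambda>s. \<exists>a\<in>A s. P s a)"
proof (rule computes_plainI)
  have "poly_time D e (\<lambda>s. val_of_bool (\<exists>a\<in>set (sorted_list_of_set (A s)). P s a))"
    by (rule poly_time_bex_list[OF computes_poly[OF assms(1), unfolded enc_set_list]])
       (rule body_sorted[OF assms(1) computes_poly[OF assms(2)]])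
  then show "poly_time D e (\<lambda>s. val_of_bool (\<exists>a\<in>A s. P s a))"
    by (rule poly_time_cong) (simp add: computes_ok[OF assms(1)])
qed

lemma bool_ball:
  assumes "set_c D e A" "bool_c (Sigma D A) (extend enc_nat e) (\<lambda>z. P (fst z) (snd z))"
  shows "bool_c D e (\<lambda>s. \<forall>a\<in>A s. P s a)"
  using bool_not[OF bool_bex[OF assms(1) bool_not[OF assms(2)]]] by simp

lemma bool_mem:
  assumes "nat_c D e k" "set_c D e A"
  shows "bool_c D e (\<lambda>s. k s \<in> A s)"
proof -
  have "bool_c D e (\<lambda>s. \<exists>a\<in>A s. k s = a)"
    by (intro bool_bex assms(2) bool_eq assms(1)[THEN computes_lift] nat_var)
  then show ?thesis by (rule computes_cong) simp
qed

lemma bool_not_mem: "nat_c D e k \<Longrightarrow> set_c D e A \<Longrightarrow> bool_c D e (\<lambda>s. k s \<notin> A s)"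
  by (intro bool_not bool_mem)

lemma bool_empty:
  assumes "set_c D e A"
  shows "bool_c D e (\<lambda>s. A s = {})"
proof -
  have "bool_c D e (\<lambda>s. \<not> (\<exists>a\<in>A s. True))"
    by (intro bool_not bool_bex assms computes_const TrueI)
  then show ?thesis by (rule computes_cong) auto
qed

lemma set_diff:
  assumes "set_c D e A" "set_c D e A'"
  shows "set_c D e (\<lambda>s. A s - A' s)"
proof -
  have "set_c D e (\<lambda>s. {a\<in>A s. a \<notin> A' s})"
    by (intro set_filter bool_not_mem assms assms(2)[THEN computes_lift] nat_var)
  then show ?thesis by (rule computes_cong) auto
qed

lemma set_empty: "set_c D e (\<lambda>_. {})"
  by (rule computes_const) simp

lemma set_insert:
  assumes "nat_c D e k" "set_c D e A"
  shows "set_c D e (\<lambda>s. insert (k s) (A s))"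
proof (rule computesI)
  have 1: "set_c D e (\<lambda>s. {a\<in>A s. a < k s})" "set_c D e (\<lambda>s. {a\<in>A s. k s < a})"
    by (intro set_filter bool_less assms assms(1)[THEN computes_lift] nat_var)+
  have "poly_time D e (\<lambda>s. enc_list enc_nat
     (sorted_list_of_set {a\<in>A s. a < k s} @ ([k s] @ sorted_list_of_set {a\<in>A s. k s < a})))"
    using computes_poly[OF 1(1)] computes_poly[OF 1(2)] poly_time_pair[OF computes_poly[OF assms(1)] poly_time_const[of _ _ VNil]]
    unfolding enc_set_list by (intro poly_time_append) simp_all
  then show "poly_time D e (\<lambda>s. enc_set (insert (k s) (A s)))"
    by (rule poly_time_cong)
       (simp only: enc_set_list sorted_list_filter sorted_list_insert computes_ok[OF assms(2)]
          append_Cons append_Nil)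
qed (use computes_ok[OF assms(2)] in simp)

lemma set_singleton: "nat_c D e k \<Longrightarrow> set_c D e (\<lambda>s. {k s})"
  by (intro set_insert set_empty)

lemma nat_Min:
  assumes "set_c D e A"
  shows "nat_c D e (\<lambda>s. Min (A s))"
proof -
  \<comment> \<open>\<open>Min {}\<close> is some fixed number, whatever it is, and can be written
    into the program as a literal.\<close>
  have "nat_c D e (\<lambda>s. if A s = {} then Min {} else Min (A s))"
  proof (rule computes_cond[OF bool_empty[OF assms] nat_const])
    let ?D = "{s\<in>D. A s \<noteq> {}}"
    have "poly_time ?D e (\<lambda>s. enc_set (A s))"
      by (rule poly_time_subset[OF computes_poly[OF assms]]) auto
    then have "poly_time ?D e (\<lambda>s. VCons (enc_nat (Min (A s))) (enc_list enc_nat (sorted_list_of_set (A s - {Min (A s)}))))"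
      by (rule poly_time_cong) (use computes_ok[OF assms] in \<open>auto simp: enc_set_list sorted_list_of_set_nonempty\<close>)
    then show "nat_c ?D e (\<lambda>s. Min (A s))" by (intro computes_plainI) (rule poly_time_fst)
  qed
  then show ?thesis by (rule computes_cong) simp
qed

lemma rat_sum:
  assumes "set_c D e A" "rat_c (Sigma D A) (extend enc_nat e) (\<lambda>z. g (fst z) (snd z))"
  shows "rat_c D e (\<lambda>s. \<Sum>a\<in>A s. g s a)"
proof (rule computes_plainI)
  have "poly_time D e (\<lambda>s. VNum (\<Sum>a\<leftarrow>sorted_list_of_set (A s). g s a))"
    by (rule poly_time_sum_list[OF computes_poly[OF assms(1), unfolded enc_set_list]])
       (rule body_sorted[OF assms(1) computes_poly[OF assms(2)]])
  then show "poly_time D e (\<lambda>s. VNum (\<Sum>a\<in>A s. g s a))"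
    by (rule poly_time_cong) (simp add: computes_ok[OF assms(1)] sum_list_distinct_conv_sum_set)
qed

lemma nat_sum:
  assumes "set_c D e A" "nat_c (Sigma D A) (extend enc_nat e) (\<lambda>z. g (fst z) (snd z))"
  shows "nat_c D e (\<lambda>s. \<Sum>a\<in>A s. g s a)"
  using rat_sum[OF assms(1) rat_of_nat[OF assms(2)]] unfolding computes_def enc_nat_def by simp

lemma nat_card:
  assumes "set_c D e A"
  shows "nat_c D e (\<lambda>s. card (A s))"
proof -
  have "nat_c D e (\<lambda>s. \<Sum>a\<in>A s. 1)" by (intro nat_sum assms nat_const)
  then show ?thesis by simp
qed

text \<open>Keys and table are traversed in parallel. The accumulator holds the unread part of the
  table and, once the key has been passed, its entry.\<close>

lemma computes_lookup:
  assumes T: "poly_time D e (\<lambda>s. enc_table (A s) (g s))" and A: "set_c D e A"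
    and k: "nat_c D e k" and kA: "\<And>s. s \<in> D \<Longrightarrow> k s \<in> A s"
  shows "poly_time D e (\<lambda>s. g s (k s))"
proof -
  define keys where "keys s = sorted_list_of_set (A s)" for s
  have keys: "poly_time D e (\<lambda>s. enc_list enc_nat (keys s))"
    using computes_poly[OF A] by (simp add: enc_set_list keys_def)
  define acc where "acc s n = VCons (enc_list (g s) (drop n (keys s)))
      (if k s \<in> set (take n (keys s)) then g s (k s) else VNil)" for s n
  have ks: "k s \<in> set (keys s)" if "s \<in> D" for s
    using kA[OF that] computes_ok[OF A that] by (simp add: keys_def)
  have "poly_time D e (\<lambda>s. acc s (length (keys s)))"
  proof (rule poly_time_foldi[OF keys])
    show "poly_time D e (\<lambda>s. acc s 0)"
      using T unfolding acc_def enc_table_def keys_def by (auto intro: poly_time_pair poly_time_const)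
    show "poly_bounded D e (\<lambda>s. 2 + 2 * vsize (enc_list (g s) (keys s)))"
      using poly_time_size[OF T] unfolding enc_table_def keys_def by (intro poly_bounded_intros)
    show "vsize (acc s n) \<le> 2 + 2 * vsize (enc_list (g s) (keys s))" if "s \<in> D" for s n
      using vsize_drop[of "g s" n "keys s"] vsize_elem[OF ks[OF that], of "g s"] by (simp add: acc_def)
    let ?D = "Sigma D (\<lambda>s. {..<length (keys s)})"
    let ?e = "\<lambda>z. VCons (e (fst z)) (VCons (enc_nat (keys (fst z) ! snd z)) (acc (fst z) (snd z)))"
    have c1: "nat_c ?D ?e (\<lambda>z. keys (fst z) ! snd z)"
      by (rule computes_plainI) (rule poly_time_fst[OF poly_time_snd[OF poly_time_id]])
    have c2: "nat_c ?D ?e (\<lambda>z. k (fst z))"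
      by (rule computes_plainI) (rule poly_time_lift[OF computes_poly[OF k]])
    have c3: "poly_time ?D ?e (\<lambda>z. acc (fst z) (snd z))"
      by (rule poly_time_snd[OF poly_time_snd[OF poly_time_id]])
    have "poly_time ?D ?e (\<lambda>z. enc_list (g (fst z)) (drop (snd z) (keys (fst z))))"
      using c3 unfolding acc_def by (rule poly_time_fst)
    then have c4: "poly_time ?D ?e (\<lambda>z. VCons (g (fst z) (keys (fst z) ! snd z))
        (enc_list (g (fst z)) (drop (Suc (snd z)) (keys (fst z)))))"
      by (rule poly_time_cong) (auto simp: Cons_nth_drop_Suc[symmetric])
    have c5: "poly_time ?D ?e (\<lambda>z. if k (fst z) \<in> set (take (snd z) (keys (fst z))) then g (fst z) (k (fst z)) else VNil)"
      using c3 unfolding acc_def by (rule poly_time_snd)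
    have "poly_time ?D ?e (\<lambda>z. VCons (enc_list (g (fst z)) (drop (Suc (snd z)) (keys (fst z))))
        (if k (fst z) = keys (fst z) ! snd z then g (fst z) (keys (fst z) ! snd z)
         else if k (fst z) \<in> set (take (snd z) (keys (fst z))) then g (fst z) (k (fst z)) else VNil))"
      by (intro poly_time_pair poly_time_if poly_time_snd[OF c4] poly_time_fst[OF c4] c5
          computes_poly[OF bool_eq[OF c2 c1]])
    then show "poly_time ?D ?e (\<lambda>z. acc (fst z) (Suc (snd z)))"
      by (rule poly_time_cong) (auto simp: acc_def take_Suc_conv_app_nth)
  qed
  then have "poly_time D e (\<lambda>s. if k s \<in> set (keys s) then g s (k s) else VNil)"
    unfolding acc_def using poly_time_snd by auto
  then show ?thesis by (rule poly_time_cong) (simp add: ks)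
qed

lemma computes_funpow:
  assumes n: "nat_c D e n" "poly_bounded D e n" and s0: "computes D e d ok s0"
    and step: "computes (Sigma D J) (extend d e) d ok (\<lambda>z. f (fst z) (snd z))"
    and J: "\<And>s. s \<in> D \<Longrightarrow> s0 s \<in> J s" "\<And>s v. s \<in> D \<Longrightarrow> v \<in> J s \<Longrightarrow> f s v \<in> J s"
    and Z: "poly_bounded D e Z" "\<And>s v. s \<in> D \<Longrightarrow> v \<in> J s \<Longrightarrow> vsize (d v) \<le> Z s"
  shows "computes D e d ok (\<lambda>s. (f s ^^ n s) (s0 s))"
proof (rule computesI)
  show "poly_time D e (\<lambda>s. d ((f s ^^ n s) (s0 s)))"
    by (rule poly_time_funpow[where ds = "\<lambda>_. d" and I = J, OF computes_poly[OF n(1)] n(2) computes_poly[OF s0] _ J Z])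
       (use computes_poly[OF step] in \<open>simp_all add: extend_def\<close>)
  fix s assume s: "s \<in> D"
  have "(f s ^^ k) (s0 s) \<in> J s \<and> ok ((f s ^^ k) (s0 s))" for k
    by (induction k) (use s J computes_ok[OF s0 s] computes_ok[OF step, of "(s, _)"] in auto)
  then show "ok ((f s ^^ n s) (s0 s))" by blast
qed

lemma vsize_enc_set: "finite A \<Longrightarrow> vsize (enc_set A) = 1 + (\<Sum>a\<in>A. 1 + vsize (enc_nat a))"
  by (simp add: enc_set_list vsize_enc_list sum_list_distinct_conv_sum_set)

lemma vsize_enc_set_mono:
  assumes "finite A'" "A \<subseteq> A'"
  shows "vsize (enc_set A) \<le> vsize (enc_set A')"
  unfolding vsize_enc_set[OF assms(1)] vsize_enc_set[OF finite_subset[OF assms(2,1)]]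
  by (intro add_left_mono sum_mono2 assms) simp

subsection \<open>Lists of sets\<close>

lemma bool_bex_sets:
  assumes "sets_c D e Js"
    and "bool_c (Sigma D (\<lambda>s. set (Js s))) (extend enc_set e) (\<lambda>z. P (fst z) (snd z))"
  shows "bool_c D e (\<lambda>s. \<exists>J\<in>set (Js s). P s J)"
  by (rule computes_plainI, rule poly_time_bex_list[OF computes_poly[OF assms(1)]])
     (use computes_poly[OF assms(2)] in \<open>simp add: extend_def\<close>)

lemma sets_var: "sets_c D e Js \<Longrightarrow> set_c (Sigma D (\<lambda>s. set (Js s))) (extend enc_set e) snd"
  by (rule computes_var) (auto dest: computes_ok)

lemma sets_Cons: "set_c D e J \<Longrightarrow> sets_c D e Js \<Longrightarrow> sets_c D e (\<lambda>s. J s # Js s)"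
  by (rule computesI) (auto intro: poly_time_pair computes_poly dest: computes_ok)

lemma sets_append: "sets_c D e Js \<Longrightarrow> sets_c D e Ks \<Longrightarrow> sets_c D e (\<lambda>s. Js s @ Ks s)"
  by (rule computesI) (auto intro: poly_time_append computes_poly dest: computes_ok)

lemma sets_map:
  assumes "set_c D e A" "set_c (Sigma D A) (extend enc_nat e) (\<lambda>z. g (fst z) (snd z))"
  shows "sets_c D e (\<lambda>s. map (g s) (sorted_list_of_set (A s)))"
proof (rule computesI)
  show "poly_time D e (\<lambda>s. enc_list enc_set (map (g s) (sorted_list_of_set (A s))))"
    using table_c[OF assms(1) computes_poly[OF assms(2)]] by (simp add: enc_list_map enc_table_def)
qed (use computes_ok[OF assms(1)] computes_ok[OF assms(2), of "(_, _)"] in auto)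

lemma card_bounded: "set_c D e A \<Longrightarrow> poly_bounded D e (\<lambda>s. card (A s))"
proof -
  assume A: "set_c D e A"
  have "card (A s) \<le> vsize (enc_set (A s))" for s
    using length_le_vsize[of "sorted_list_of_set (A s)" enc_nat] by (simp add: enc_set_list)
  then show ?thesis by (intro poly_bounded_mono[OF poly_time_size[OF computes_poly[OF A]]])
qed

lemma set_union:
  assumes "set_c D e A" "set_c D e A'"
  shows "set_c D e (\<lambda>s. A s \<union> A' s)"
proof (rule computesI)
  have f: "fold insert xs S = set xs \<union> S" for xs :: "nat list" and S
    by (induction xs arbitrary: S) auto
  have "poly_time D e (\<lambda>s. enc_set (fold insert (sorted_list_of_set (A s)) (A' s)))"
  proof (rule poly_time_fold[where ds = "\<lambda>_. enc_set" and I = "\<lambda>_. {S. finite S}"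
        and Z = "\<lambda>s. vsize (enc_set (A s)) + vsize (enc_set (A' s))",
        OF computes_poly[OF assms(1), unfolded enc_set_list] computes_poly[OF assms(2)]])
    let ?D = "Sigma D (\<lambda>s. set (sorted_list_of_set (A s)) \<times> {S. finite S})"
    let ?e = "\<lambda>z. VCons (e (fst z)) (VCons (enc_nat (fst (snd z))) (enc_set (snd (snd z))))"
    have "set_c ?D ?e (\<lambda>z. insert (fst (snd z)) (snd (snd z)))"
    proof (rule set_insert)
      show "nat_c ?D ?e (\<lambda>z. fst (snd z))"
        by (rule computes_plainI) (rule poly_time_fst[OF poly_time_snd[OF poly_time_id]])
      show "set_c ?D ?e (\<lambda>z. snd (snd z))"
        by (rule computesI) (auto intro: poly_time_snd[OF poly_time_snd[OF poly_time_id]])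
    qed
    then show "poly_time ?D ?e (\<lambda>z. enc_set (insert (fst (snd z)) (snd (snd z))))"
      by (rule computes_poly)
    show "poly_bounded D e (\<lambda>s. vsize (enc_set (A s)) + vsize (enc_set (A' s)))"
      by (intro poly_bounded_intros poly_time_size[OF computes_poly[OF assms(1)]]
          poly_time_size[OF computes_poly[OF assms(2)]])
    fix s ys zs assume s: "s \<in> D" and ys: "sorted_list_of_set (A s) = ys @ zs"
    have fin: "finite (A s)" "finite (A' s)" using computes_ok[OF assms(1) s] computes_ok[OF assms(2) s] by auto
    show "fold insert ys (A' s) \<in> {S. finite S}" using fin by (simp add: f)
    have "set ys \<subseteq> set (sorted_list_of_set (A s))" unfolding ys by simp
    then have sub: "set ys \<subseteq> A s" using fin by simp
    have "vsize (enc_set (fold insert ys (A' s))) \<le> vsize (enc_set (A s \<union> A' s))"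
      unfolding f by (rule vsize_enc_set_mono) (use sub fin in auto)
    also have "\<dots> \<le> 1 + ((\<Sum>a\<in>A s. 1 + vsize (enc_nat a)) + (\<Sum>a\<in>A' s. 1 + vsize (enc_nat a)))"
      using sum_Un_nat[OF fin, of "\<lambda>a. 1 + vsize (enc_nat a)"] fin by (simp add: vsize_enc_set)
    also have "\<dots> \<le> vsize (enc_set (A s)) + vsize (enc_set (A' s))"
      using fin by (simp add: vsize_enc_set)
    finally show "vsize (enc_set (fold insert ys (A' s))) \<le> vsize (enc_set (A s)) + vsize (enc_set (A' s))" .
  qed
  then show "poly_time D e (\<lambda>s. enc_set (A s \<union> A' s))"
    by (rule poly_time_cong) (simp add: f computes_ok[OF assms(1)])
qed (use computes_ok[OF assms(1)] computes_ok[OF assms(2)] in simp)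

lemma rat_bits_of_nat: "rat_bits (of_nat n) = floorlog 2 n + 1"
proof -
  have "quotient_of (of_nat n) = (int n, 1)"
    by (metis of_int_of_nat_eq quotient_of_int Rat.of_int_def)
  then show ?thesis by (simp add: rat_bits_def floorlog_def)
qed

text \<open>Doubling from 1 until the value is exceeded takes as many rounds as the number has bits,
  which is polynomial even if the value is not.\<close>

lemma nat_floorlog:
  assumes "nat_c D e f"
  shows "nat_c D e (\<lambda>s. floorlog 2 (f s))"
proof (rule computes_plainI)
  define st where "st s k = VCons (e s) (VCons (enc_nat (2 ^ k)) (enc_nat k))" for s k
  have less: "2 ^ k \<le> n \<longleftrightarrow> k < floorlog 2 n" for k n :: nat
    using floorlog_le_iff[of 2 n k] by (auto simp: not_le[symmetric])
  have 1: "poly_time D' (\<lambda>(s, k). st s k) (\<lambda>z. e (fst z))"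
    "nat_c D' (\<lambda>(s, k). st s k) (\<lambda>z. 2 ^ snd z)" "nat_c D' (\<lambda>(s, k). st s k) (\<lambda>z. snd z)" for D'
    by (auto simp: st_def case_prod_beta' intro!: computes_plainI poly_time_fst[OF poly_time_id]
        poly_time_fst[OF poly_time_snd[OF poly_time_id]] poly_time_snd[OF poly_time_snd[OF poly_time_id]])
  have 2: "nat_c D' (\<lambda>(s, k). st s k) (\<lambda>z. f (fst z))" if "fst ` D' \<subseteq> D" for D'
    by (rule computes_plainI, rule poly_time_subst[OF computes_poly[OF assms] 1(1)]) (use that in auto)
  have "poly_time D e (\<lambda>s. st s (floorlog 2 (f s)))"
  proof (rule poly_time_loop)
    show "poly_time D e (\<lambda>s. st s 0)"
      unfolding st_def by (intro poly_time_pair poly_time_id poly_time_const)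
    let ?D = "{(s, k). s \<in> D \<and> k \<le> floorlog 2 (f s)}" and ?D' = "{(s, k). s \<in> D \<and> k < floorlog 2 (f s)}"
    have "bool_c ?D (\<lambda>(s, k). st s k) (\<lambda>z. 2 ^ snd z \<le> f (fst z))"
      by (intro bool_le 1 2) auto
    then show "poly_time ?D (\<lambda>(s, k). st s k) (\<lambda>(s, k). val_of_bool (2 ^ k \<le> f s))"
      by (simp add: computes_def case_prod_beta')
    show "val_of_bool (2 ^ k \<le> f s) \<noteq> VNil \<longleftrightarrow> k < floorlog 2 (f s)" for s k
      by (simp add: val_of_bool_def less)
    have "nat_c ?D' (\<lambda>(s, k). st s k) (\<lambda>z. 2 * 2 ^ snd z)" "nat_c ?D' (\<lambda>(s, k). st s k) (\<lambda>z. snd z + 1)"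
      by (intro nat_mult nat_add nat_const 1)+
    then have "poly_time ?D' (\<lambda>(s, k). st s k) (\<lambda>z. st (fst z) (Suc (snd z)))"
      unfolding st_def[of "fst _" "Suc _"] by (intro poly_time_pair 1) (simp_all add: computes_def)
    then show "poly_time ?D' (\<lambda>(s, k). st s k) (\<lambda>(s, k). st s (Suc k))" by (simp add: case_prod_beta')
    have K: "floorlog 2 (f s) \<le> vsize (enc_nat (f s))" for s
      by (simp add: enc_nat_def rat_bits_of_nat)
    show "poly_bounded D e (\<lambda>s. floorlog 2 (f s))"
      by (rule poly_bounded_mono[OF poly_time_size[OF computes_poly[OF assms]] K])
    show "poly_bounded D e (\<lambda>s. 8 + vsize (e s) + 2 * vsize (enc_nat (f s)))"
      by (intro poly_bounded_intros poly_time_size[OF computes_poly[OF assms]])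
    show "vsize (st s k) \<le> 8 + vsize (e s) + 2 * vsize (enc_nat (f s))"
      if "k \<le> floorlog 2 (f s)" for s k
    proof -
      have "floorlog 2 (2 ^ k) = k + 1" using floorlog_power[of 1 2 k] by (simp add: floorlog_def)
      then have "vsize (enc_nat (2 ^ k)) \<le> k + 3" using vsize_enc_nat[of "2 ^ k"] by simp
      moreover have "vsize (enc_nat k) \<le> k + 2" by (rule vsize_enc_nat_le)
      ultimately show ?thesis using that K[of s] by (simp add: st_def)
    qed
  qed
  then show "poly_time D e (\<lambda>s. enc_nat (floorlog 2 (f s)))"
    unfolding st_def by (rule poly_time_snd[OF poly_time_snd])
qed

section \<open>Access to the input\<close>

type_synonym input = "instance_hck \<times> xvars \<times> yvars \<times> real"

abbreviation "inst_of w \<equiv> fst (w :: input)"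
abbreviation "x_of w \<equiv> fst (snd (w :: input))"
abbreviation "y_of w \<equiv> fst (snd (snd (w :: input)))"
abbreviation "delta_of w \<equiv> snd (snd (snd (w :: input)))"

definition enc_in :: "input \<Rightarrow> val" where
  "enc_in w = enc_input (inst_of w) (x_of w) (y_of w) (delta_of w)"

definition good :: "input \<Rightarrow> bool" where
  "good w \<longleftrightarrow> wf_instance (inst_of w) \<and> feasible (inst_of w) (x_of w) (y_of w) \<and> delta_of w > 0 \<and>
     rational_input (inst_of w) (x_of w) (y_of w) (delta_of w)"

abbreviation "input_c D e W \<equiv> computes D e enc_in good W"

definition scale :: "real \<Rightarrow> nat" where
  "scale \<delta> = nat \<lceil>1 / \<delta>\<rceil>"

definition rat_of :: "real \<Rightarrow> rat" where
  "rat_of r = inv real_of_rat r"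

lemma real_of_rat_of: "r \<in> \<rat> \<Longrightarrow> real_of_rat (rat_of r) = r"
  unfolding rat_of_def by (rule f_inv_into_f) (auto elim: Rats_cases)

lemma enc_real_rat_of: "enc_real r = VNum (rat_of r)"
  by (simp add: enc_real_def rat_of_def)

lemma good_finite: "good w \<Longrightarrow> finite (facs (inst_of w))" "good w \<Longrightarrow> finite (clients (inst_of w))"
  by (auto simp: good_def wf_instance_def points_def)

context
  fixes D :: "'s set" and e :: "'s \<Rightarrow> val" and W :: "'s \<Rightarrow> input"
  assumes W: "input_c D e W"
begin

lemma W_good: "s \<in> D \<Longrightarrow> good (W s)"
  by (rule computes_ok[OF W])

lemma input_parts:
  "poly_time D e (\<lambda>s. enc_instance (inst_of (W s)))"
  "poly_time D e (\<lambda>s. enc_x (inst_of (W s)) (x_of (W s)))"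
  "poly_time D e (\<lambda>s. enc_y (inst_of (W s)) (y_of (W s)))"
  "poly_time D e (\<lambda>s. enc_real (delta_of (W s)))"
proof -
  have 1: "poly_time D e (\<lambda>s. VCons (enc_instance (inst_of (W s))) (VCons (enc_x (inst_of (W s)) (x_of (W s)))
      (VCons (enc_y (inst_of (W s)) (y_of (W s))) (VCons (enc_real (delta_of (W s))) VNil))))"
    using computes_poly[OF W] by (simp add: enc_in_def enc_input_def)
  note 2 = poly_time_snd[OF 1] note 3 = poly_time_snd[OF 2] note 4 = poly_time_snd[OF 3]
  show "poly_time D e (\<lambda>s. enc_instance (inst_of (W s)))"
    "poly_time D e (\<lambda>s. enc_x (inst_of (W s)) (x_of (W s)))"
    "poly_time D e (\<lambda>s. enc_y (inst_of (W s)) (y_of (W s)))"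
    "poly_time D e (\<lambda>s. enc_real (delta_of (W s)))"
    by (rule poly_time_fst[OF 1] poly_time_fst[OF 2] poly_time_fst[OF 3] poly_time_fst[OF 4])+
qed

lemma instance_parts:
  "poly_time D e (\<lambda>s. enc_set (facs (inst_of (W s))))"
  "poly_time D e (\<lambda>s. enc_set (clients (inst_of (W s))))"
  "poly_time D e (\<lambda>s. enc_table (points (inst_of (W s)))
     (\<lambda>u. enc_table (points (inst_of (W s))) (\<lambda>v. enc_real (distf (inst_of (W s)) u v))))"
  "poly_time D e (\<lambda>s. enc_table (types (inst_of (W s)))
     (\<lambda>p. VCons (enc_nat (copies (inst_of (W s)) p)) (enc_nat (capac (inst_of (W s)) p))))"
  "poly_time D e (\<lambda>s. enc_real (opt (inst_of (W s))))"
proof -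
  have 1: "poly_time D e (\<lambda>s. VCons (enc_set (facs (inst_of (W s)))) (VCons (enc_set (clients (inst_of (W s))))
      (VCons (enc_table (points (inst_of (W s)))
         (\<lambda>u. enc_table (points (inst_of (W s))) (\<lambda>v. enc_real (distf (inst_of (W s)) u v))))
      (VCons (enc_table (types (inst_of (W s)))
         (\<lambda>p. VCons (enc_nat (copies (inst_of (W s)) p)) (enc_nat (capac (inst_of (W s)) p))))
      (VCons (enc_real (opt (inst_of (W s)))) VNil)))))"
    using input_parts(1) by (simp add: enc_instance_def)
  note 2 = poly_time_snd[OF 1] note 3 = poly_time_snd[OF 2] note 4 = poly_time_snd[OF 3]
  note 5 = poly_time_snd[OF 4]
  show "poly_time D e (\<lambda>s. enc_set (facs (inst_of (W s))))"
    "poly_time D e (\<lambda>s. enc_set (clients (inst_of (W s))))"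
    "poly_time D e (\<lambda>s. enc_table (points (inst_of (W s)))
       (\<lambda>u. enc_table (points (inst_of (W s))) (\<lambda>v. enc_real (distf (inst_of (W s)) u v))))"
    "poly_time D e (\<lambda>s. enc_table (types (inst_of (W s)))
       (\<lambda>p. VCons (enc_nat (copies (inst_of (W s)) p)) (enc_nat (capac (inst_of (W s)) p))))"
    "poly_time D e (\<lambda>s. enc_real (opt (inst_of (W s))))"
    by (rule poly_time_fst[OF 1] poly_time_fst[OF 2] poly_time_fst[OF 3] poly_time_fst[OF 4]
        poly_time_fst[OF 5])+
qed

lemma facs_c: "set_c D e (\<lambda>s. facs (inst_of (W s)))"
  by (rule computesI, rule instance_parts(1)) (rule good_finite[OF W_good])

lemma clients_c: "set_c D e (\<lambda>s. clients (inst_of (W s)))"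
  by (rule computesI, rule instance_parts(2)) (rule good_finite[OF W_good])

lemma points_c: "set_c D e (\<lambda>s. points (inst_of (W s)))"
  unfolding points_def by (intro set_union facs_c clients_c)

text \<open>The input contains no list of types, but the table of copies and capacities has one
  entry per type. Walking along it, the list of indices is produced in reverse order.\<close>

lemma types_c: "set_c D e (\<lambda>s. types (inst_of (W s)))"
proof (rule computesI)
  define ts where "ts s = sorted_list_of_set (types (inst_of (W s)))" for s
  have len: "length (ts s) = num_types (inst_of (W s))" for s by (simp add: ts_def types_def)
  define acc where "acc s k = VCons (enc_nat k) (enc_list enc_nat (rev [1..<Suc k]))" for s :: 's and k
  have T: "poly_time D e (\<lambda>s. enc_list
      (\<lambda>p. VCons (enc_nat (copies (inst_of (W s)) p)) (enc_nat (capac (inst_of (W s)) p))) (ts s))"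
    using instance_parts(4) by (simp add: enc_table_def ts_def)
  have "poly_time D e (\<lambda>s. acc s (length (ts s)))"
  proof (rule poly_time_foldi[OF T])
    show "poly_time D e (\<lambda>s. acc s 0)" unfolding acc_def by (rule poly_time_const)
    let ?D = "Sigma D (\<lambda>s. {..<length (ts s)})"
    let ?e = "\<lambda>z. VCons (e (fst z)) (VCons (VCons (enc_nat (copies (inst_of (W (fst z))) (ts (fst z) ! snd z)))
        (enc_nat (capac (inst_of (W (fst z))) (ts (fst z) ! snd z)))) (acc (fst z) (snd z)))"
    have a: "poly_time ?D ?e (\<lambda>z. acc (fst z) (snd z))"
      by (rule poly_time_snd[OF poly_time_snd[OF poly_time_id]])
    have a': "poly_time ?D ?e (\<lambda>z. VCons (enc_nat (snd z)) (enc_list enc_nat (rev [1..<Suc (snd z)])))"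
      by (rule poly_time_cong[OF a]) (simp add: acc_def)
    have k: "nat_c ?D ?e (\<lambda>z. snd z + 1)"
      by (intro nat_add nat_const computes_plainI) (rule poly_time_fst[OF a'])
    have "poly_time ?D ?e (\<lambda>z. VCons (enc_nat (snd z + 1)) (VCons (enc_nat (snd z + 1))
        (enc_list enc_nat (rev [1..<Suc (snd z)]))))"
      by (intro poly_time_pair computes_poly[OF k] poly_time_snd[OF a'])
    then show "poly_time ?D ?e (\<lambda>z. acc (fst z) (Suc (snd z)))"
      by (rule poly_time_cong) (simp add: acc_def)
    have n: "length (ts s) \<le> vsize (enc_list
      (\<lambda>p. VCons (enc_nat (copies (inst_of (W s)) p)) (enc_nat (capac (inst_of (W s)) p))) (ts s))" for s
      by (rule length_le_vsize)
    have "poly_bounded D e (\<lambda>s. length (ts s))"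
      by (rule poly_bounded_mono[OF poly_time_size[OF T] n])
    then show "poly_bounded D e (\<lambda>s. 4 + length (ts s) + length (ts s) * (4 + length (ts s)))"
      by (intro poly_bounded_intros)
    show "vsize (acc s k) \<le> 4 + length (ts s) + length (ts s) * (4 + length (ts s))"
      if "k \<le> length (ts s)" for s k
    proof -
      have "vsize (enc_list enc_nat (rev [1..<Suc k])) \<le> 1 + length (rev [1..<Suc k]) * (1 + (k + 2))"
      proof (rule vsize_enc_list_le)
        fix a assume "a \<in> set (rev [1..<Suc k])"
        then have "a \<le> k" by auto
        then show "vsize (enc_nat a) \<le> k + 2" using vsize_enc_nat_le[of a] by linarith
      qed
      also have "\<dots> = 1 + k * (3 + k)" by (simp add: algebra_simps del: upt_Suc)
      also have "\<dots> \<le> 1 + length (ts s) * (3 + length (ts s))"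
        using that by (intro add_left_mono mult_le_mono) auto
      finally have "vsize (enc_list enc_nat (rev [1..<Suc k])) \<le> 1 + length (ts s) * (3 + length (ts s))" .
      moreover have "length (ts s) * (3 + length (ts s)) \<le> length (ts s) * (4 + length (ts s))"
        by (rule mult_le_mono2) simp
      ultimately show ?thesis using vsize_enc_nat_le[of k] that unfolding acc_def vsize.simps by linarith
    qed
  qed
  then have "poly_time D e (\<lambda>s. enc_list enc_nat (rev [1..<Suc (num_types (inst_of (W s)))]))"
    unfolding acc_def len by (rule poly_time_snd)
  from poly_time_rev[OF this] show "poly_time D e (\<lambda>s. enc_set (types (inst_of (W s))))"
    unfolding rev_rev_ident enc_set_list types_def atLeastLessThanSuc_atLeastAtMost[symmetric]
    by (simp only: sorted_list_of_set_range)
qed (simp add: types_def)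

lemma dist_c:
  assumes "nat_c D e u" "nat_c D e v"
    and "\<And>s. s \<in> D \<Longrightarrow> u s \<in> points (inst_of (W s))" "\<And>s. s \<in> D \<Longrightarrow> v s \<in> points (inst_of (W s))"
  shows "rat_c D e (\<lambda>s. rat_of (distf (inst_of (W s)) (u s) (v s)))"
proof (rule computes_plainI)
  have "poly_time D e (\<lambda>s. enc_real (distf (inst_of (W s)) (u s) (v s)))"
    by (rule computes_lookup[OF computes_lookup[OF instance_parts(3) points_c assms(1,3)] points_c assms(2,4)])
  then show "poly_time D e (\<lambda>s. VNum (rat_of (distf (inst_of (W s)) (u s) (v s))))"
    by (simp add: enc_real_rat_of)
qed

lemma opt_c: "rat_c D e (\<lambda>s. rat_of (opt (inst_of (W s))))"
  by (rule computes_plainI) (use instance_parts(5) in \<open>simp add: enc_real_rat_of\<close>)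

lemma delta_c: "rat_c D e (\<lambda>s. rat_of (delta_of (W s)))"
  by (rule computes_plainI) (use input_parts(4) in \<open>simp add: enc_real_rat_of\<close>)

lemma x_c:
  assumes "nat_c D e i" "nat_c D e j" "nat_c D e p"
    and "\<And>s. s \<in> D \<Longrightarrow> i s \<in> facs (inst_of (W s))" "\<And>s. s \<in> D \<Longrightarrow> j s \<in> clients (inst_of (W s))"
      "\<And>s. s \<in> D \<Longrightarrow> p s \<in> types (inst_of (W s))"
  shows "rat_c D e (\<lambda>s. rat_of (x_of (W s) (i s) (j s) (p s)))"
proof (rule computes_plainI)
  have "poly_time D e (\<lambda>s. enc_real (x_of (W s) (i s) (j s) (p s)))"
    by (rule computes_lookup[OF computes_lookup[OF computes_lookup[OF
            input_parts(2)[unfolded enc_x_def] facs_c assms(1,4)] clients_c assms(2,5)] types_c assms(3,6)])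
  then show "poly_time D e (\<lambda>s. VNum (rat_of (x_of (W s) (i s) (j s) (p s))))"
    by (simp add: enc_real_rat_of)
qed

lemma y_c:
  assumes "nat_c D e i" "nat_c D e p"
    and "\<And>s. s \<in> D \<Longrightarrow> i s \<in> facs (inst_of (W s))" "\<And>s. s \<in> D \<Longrightarrow> p s \<in> types (inst_of (W s))"
  shows "rat_c D e (\<lambda>s. rat_of (y_of (W s) (i s) (p s)))"
proof (rule computes_plainI)
  have "poly_time D e (\<lambda>s. enc_real (y_of (W s) (i s) (p s)))"
    by (rule computes_lookup[OF computes_lookup[OF
            input_parts(3)[unfolded enc_y_def] facs_c assms(1,3)] types_c assms(2,4)])
  then show "poly_time D e (\<lambda>s. VNum (rat_of (y_of (W s) (i s) (p s))))"
    by (simp add: enc_real_rat_of)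
qed

lemma scale_c: "nat_c D e (\<lambda>s. scale (delta_of (W s)))"
proof (rule computes_plainI)
  \<comment> \<open>The language offers floors only, so the ceiling is obtained as the negated floor
    of the negated quotient.\<close>
  have "poly_time D e (\<lambda>s. VNum (0 - of_int \<lfloor>0 - 1 / rat_of (delta_of (W s))\<rfloor>))"
    by (intro poly_time_diff poly_time_floor poly_time_divide poly_time_const computes_poly[OF delta_c])
  then show "poly_time D e (\<lambda>s. enc_nat (scale (delta_of (W s))))"
  proof (rule poly_time_cong)
    fix s assume s: "s \<in> D"
    define q where "q = rat_of (delta_of (W s))"
    have d: "delta_of (W s) = real_of_rat q" "delta_of (W s) > 0"
      using W_good[OF s] by (auto simp: q_def good_def rational_input_def real_of_rat_of)
    have "\<lceil>1 / delta_of (W s)\<rceil> = \<lceil>1 / q\<rceil>"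
      unfolding d(1) by (metis of_rat_1 of_rat_divide of_rat_ceiling)
    moreover have "0 < 1 / q" using d by simp
    then have "\<lceil>1 / q\<rceil> \<ge> 0" by linarith
    ultimately have "of_nat (scale (delta_of (W s))) = (of_int \<lceil>1 / q\<rceil> :: rat)"
      by (simp add: scale_def)
    then show "enc_nat (scale (delta_of (W s))) = VNum (0 - of_int \<lfloor>0 - 1 / rat_of (delta_of (W s))\<rfloor>)"
      by (simp add: enc_nat_def q_def ceiling_def)
  qed
qed

end

text \<open>Membership is tested first, because the distance table has entries for points of the
  instance only.\<close>

lemma adjacent_c:
  assumes W: "input_c D e W" and ij: "nat_c D e i" "nat_c D e j"
  shows "bool_c D e (\<lambda>s. adjacent (inst_of (W s)) (i s) (j s))"
proof -
  let ?c = "\<lambda>s. i s \<in> facs (inst_of (W s)) \<and> j s \<in> clients (inst_of (W s))"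
  have "bool_c D e (\<lambda>s. if ?c s
      then rat_of (distf (inst_of (W s)) (i s) (j s)) \<le> rat_of (opt (inst_of (W s))) else False)"
  proof (rule computes_cond)
    show "bool_c D e ?c" by (intro bool_conj bool_mem ij facs_c[OF W] clients_c[OF W])
    have r: "input_c {s\<in>D. ?c s} e W" "nat_c {s\<in>D. ?c s} e i" "nat_c {s\<in>D. ?c s} e j"
      by (rule computes_mono[OF W] computes_mono[OF ij(1)] computes_mono[OF ij(2)], blast)+
    show "bool_c {s\<in>D. ?c s} e (\<lambda>s. rat_of (distf (inst_of (W s)) (i s) (j s)) \<le> rat_of (opt (inst_of (W s))))"
      by (intro rat_le dist_c[OF r] opt_c[OF r(1)]) (auto simp: points_def)
  qed (rule computes_const, simp)
  then show ?thesis
  proof (rule computes_cong)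
    fix s assume s: "s \<in> D"
    have "rat_of (distf (inst_of (W s)) (i s) (j s)) \<le> rat_of (opt (inst_of (W s))) \<longleftrightarrow>
        distf (inst_of (W s)) (i s) (j s) \<le> opt (inst_of (W s))" if "?c s"
    proof -
      have "distf (inst_of (W s)) (i s) (j s) \<in> \<rat>" "opt (inst_of (W s)) \<in> \<rat>"
        using W_good[OF W s] that by (auto simp: good_def rational_input_def points_def)
      then show ?thesis by (metis real_of_rat_of of_rat_less_eq)
    qed
    then show "adjacent (inst_of (W s)) (i s) (j s) = (if ?c s
      then rat_of (distf (inst_of (W s)) (i s) (j s)) \<le> rat_of (opt (inst_of (W s))) else False)"
      by (auto simp: adjacent_def)
  qed
qed

section \<open>The algorithm runs in polynomial time\<close>

lemma linked_c:
  assumes "input_c D e W" "nat_c D e j" "nat_c D e k"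
  shows "bool_c D e (\<lambda>s. linked (inst_of (W s)) (j s) (k s))"
proof -
  note L = assms[THEN computes_lift]
  show ?thesis
    unfolding linked_def
    by (intro bool_bex facs_c[OF assms(1)] bool_conj adjacent_c L nat_var)
qed

lemma spread_c:
  assumes "input_c D e W" "set_c D e C" "set_c D e B"
  shows "set_c D e (\<lambda>s. spread (inst_of (W s)) (C s) (B s))"
proof -
  note L = assms[THEN computes_lift]
  note L2 = L[THEN computes_lift] nat_var[THEN computes_lift]
  show ?thesis
    unfolding spread_def
    by (intro set_filter assms bool_disj bool_mem L nat_var bool_bex linked_c L2)
qed

lemma nbrs_c:
  assumes "input_c D e W" "set_c D e B"
  shows "set_c D e (\<lambda>s. nbrs (inst_of (W s)) (B s))"
proof -
  note L = assms[THEN computes_lift]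
  note L2 = L[THEN computes_lift] nat_var[THEN computes_lift]
  have "set_c D e (\<lambda>s. {i\<in>facs (inst_of (W s)). \<exists>j\<in>B s. adjacent (inst_of (W s)) i j})"
    by (intro set_filter facs_c assms L bool_bex adjacent_c L2 nat_var)
  then show ?thesis by (rule computes_cong) (auto simp: nbrs_def adjacent_def)
qed

lemma thin_c:
  assumes "input_c D e W" "nat_c D e N" "set_c D e C" "set_c D e B"
  shows "bool_c D e (\<lambda>s. thin (inst_of (W s)) (N s) (C s) (B s))"
  unfolding thin_def by (intro bool_le nat_mult nat_add nat_const nat_card spread_c assms)

lemma grow_c:
  assumes "input_c D e W" "nat_c D e N" "set_c D e C" "set_c D e B"
  shows "set_c D e (\<lambda>s. grow (inst_of (W s)) (N s) (C s) (B s))"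
  unfolding grow_def by (intro computes_if thin_c spread_c assms)

text \<open>The code of a subset of \<open>U\<close> is at most as long as that of \<open>U\<close>;
  this supplies the size bound for all iterates.\<close>

lemma set_funpow:
  assumes n: "nat_c D e n" "poly_bounded D e n" and s0: "set_c D e s0" and U: "set_c D e U"
    and step: "set_c (Sigma D (\<lambda>s. {S. S \<subseteq> U s})) (extend enc_set e) (\<lambda>z. f (fst z) (snd z))"
    and sub: "\<And>s. s \<in> D \<Longrightarrow> s0 s \<subseteq> U s" "\<And>s S. s \<in> D \<Longrightarrow> S \<subseteq> U s \<Longrightarrow> f s S \<subseteq> U s"
  shows "set_c D e (\<lambda>s. (f s ^^ n s) (s0 s))"
proof (rule computes_funpow[OF n s0 step])
  show "poly_bounded D e (\<lambda>s. vsize (enc_set (U s)))"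
    by (rule poly_time_size[OF computes_poly[OF U]])
  show "vsize (enc_set S) \<le> vsize (enc_set (U s))" if "s \<in> D" "S \<in> {S. S \<subseteq> U s}" for s S
    using vsize_enc_set_mono[OF computes_ok[OF U that(1)]] that(2) by simp
qed (use sub in auto)

lemma subset_var: "set_c D e U \<Longrightarrow> set_c (Sigma D (\<lambda>s. {S. S \<subseteq> U s})) (extend enc_set e) snd"
  by (rule computes_var) (auto dest: computes_ok intro: finite_subset)

text \<open>Radii may be exponential in the input size, so the number of iterations must be cut off.\<close>

lemma spread_funpow_saturates:
  assumes "finite C"
  shows "(spread I C ^^ t) S = (spread I C ^^ min t (card C + 2)) S"
proof (cases "t \<le> card C + 2")
  case False
  define X where "X k = (spread I C ^^ k) S" for k
  have XS: "X (Suc k) = spread I C (X k)" for k by (simp add: X_def)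
  have sub: "X k \<subseteq> C" if "k \<ge> 1" for k
    using that spread_def by (cases k) (auto simp: XS spread_def)
  have inc: "X k \<subseteq> X (Suc k)" if "k \<ge> 1" for k
    using sub[OF that] by (auto simp: XS spread_def)
  \<comment> \<open>\<open>S\<close> may stick out of \<open>C\<close>, so the iterates are known to
    increase within \<open>C\<close> only from index 1 on. More than \<open>card C\<close> strict
    increases are impossible.\<close>
  have "\<exists>k\<in>{1..card C + 2}. X (Suc k) = X k"
  proof (rule ccontr)
    assume *: "\<not> ?thesis"
    have "k \<le> card (X (Suc k))" if "k \<le> card C + 2" for k
      using that
    proof (induction k)
      case (Suc k)
      have "X (Suc k) \<subset> X (Suc (Suc k))" using inc[of "Suc k"] * Suc.prems by auto
      then have "card (X (Suc k)) < card (X (Suc (Suc k)))"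
        by (rule psubset_card_mono[rotated]) (use sub[of "Suc (Suc k)"] assms finite_subset in auto)
      then show ?case using Suc by simp
    qed simp
    from this[of "card C + 2"] have "card C + 2 \<le> card (X (Suc (card C + 2)))" by simp
    moreover have "card (X (Suc (card C + 2))) \<le> card C" by (rule card_mono[OF assms sub]) simp
    ultimately show False by simp
  qed
  then obtain k where k: "k \<le> card C + 2" "X (Suc k) = X k" by auto
  have "X (k + m) = X k" for m by (induction m) (use k XS in auto)
  from this[of "t - k"] this[of "card C + 2 - k"] have "X t = X (card C + 2)" using k False by simp
  then show ?thesis using False by (simp add: X_def)
qed (simp add: min_def)

lemma client_ball_c:
  assumes W: "input_c D e W" and C: "set_c D e C" and t: "nat_c D e t" and j: "nat_c D e j"
  shows "set_c D e (\<lambda>s. client_ball (inst_of (W s)) (C s) (t s) (j s))"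
proof -
  have "set_c D e (\<lambda>s. (spread (inst_of (W s)) (C s) ^^ min (t s) (card (C s) + 2)) {j s})"
  proof (rule set_funpow)
    show "nat_c D e (\<lambda>s. min (t s) (card (C s) + 2))" by (intro nat_min nat_add nat_card nat_const C t)
    have "poly_bounded D e (\<lambda>s. card (C s) + 2)" by (intro poly_bounded_intros card_bounded C)
    then show "poly_bounded D e (\<lambda>s. min (t s) (card (C s) + 2))" by (rule poly_bounded_mono) simp
    show U: "set_c D e (\<lambda>s. insert (j s) (C s))" by (intro set_insert j C)
    show "set_c (Sigma D (\<lambda>s. {S. S \<subseteq> insert (j s) (C s)})) (extend enc_set e)
        (\<lambda>z. spread (inst_of (W (fst z))) (C (fst z)) (snd z))"
      by (intro spread_c W[THEN computes_lift] C[THEN computes_lift] subset_var U)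
  qed (use set_singleton[OF j] in \<open>auto simp: spread_def\<close>)
  then show ?thesis
    by (rule computes_cong) (unfold client_ball_def, rule spread_funpow_saturates[OF computes_ok[OF C]])
qed

lemma horizon_c: "nat_c D e N \<Longrightarrow> nat_c D e (\<lambda>s. horizon (N s))"
  unfolding horizon_def by (intro nat_add nat_mult nat_const nat_floorlog)

lemma core_c:
  assumes W: "input_c D e W" and N: "nat_c D e N" and C: "set_c D e C" and j: "nat_c D e j"
  shows "set_c D e (\<lambda>s. core (inst_of (W s)) (N s) (C s) (j s))"
  unfolding core_def
proof (rule set_funpow)
  show "nat_c D e (\<lambda>s. min (horizon (N s)) (card (clients (inst_of (W s)))))"
    by (intro nat_min horizon_c N nat_card clients_c W)
  show "poly_bounded D e (\<lambda>s. min (horizon (N s)) (card (clients (inst_of (W s)))))"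
    by (rule poly_bounded_mono[OF card_bounded[OF clients_c[OF W]]]) simp
  show U: "set_c D e (\<lambda>s. insert (j s) (C s))" by (intro set_insert j C)
  show "set_c (Sigma D (\<lambda>s. {S. S \<subseteq> insert (j s) (C s)})) (extend enc_set e)
      (\<lambda>z. grow (inst_of (W (fst z))) (N (fst z)) (C (fst z)) (snd z))"
    by (intro grow_c W[THEN computes_lift] N[THEN computes_lift] C[THEN computes_lift] subset_var U)
qed (use set_singleton[OF j] in \<open>auto simp: spread_def grow_def\<close>)

definition enc_state :: "nat set \<times> nat set list \<Rightarrow> val" where
  "enc_state v = VCons (enc_set (fst v)) (enc_list enc_set (snd v))"

abbreviation "state_c D e f \<equiv> computes D e enc_state (\<lambda>v. finite (fst v) \<and> (\<forall>J\<in>set (snd v). finite J)) f"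

lemma state_fst: "state_c D e f \<Longrightarrow> set_c D e (\<lambda>s. fst (f s))"
  unfolding computes_def enc_state_def by (auto intro: poly_time_fst)

lemma state_snd: "state_c D e f \<Longrightarrow> sets_c D e (\<lambda>s. snd (f s))"
  unfolding computes_def enc_state_def by (auto intro: poly_time_snd)

lemma state_Pair: "set_c D e f \<Longrightarrow> sets_c D e g \<Longrightarrow> state_c D e (\<lambda>s. (f s, g s))"
  unfolding computes_def enc_state_def by (auto intro: poly_time_pair)

lemma carve_c:
  assumes W: "input_c D e W" and N: "nat_c D e N" and v: "state_c D e v"
  shows "state_c D e (\<lambda>s. carve (inst_of (W s)) (N s) (v s))"
proof -
  note C = state_fst[OF v]
  have X: "set_c D e (\<lambda>s. {j\<in>fst (v s). thin (inst_of (W s)) (N s) (fst (v s))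
      (core (inst_of (W s)) (N s) (fst (v s)) j)})"
    by (intro set_filter C thin_c core_c W[THEN computes_lift] N[THEN computes_lift]
        C[THEN computes_lift] nat_var)
  show ?thesis
    unfolding carve_def Let_def
    by (intro computes_if bool_empty X v state_Pair set_diff C spread_c core_c W N nat_Min sets_Cons
        state_snd[OF v])
qed

lemma core_self: "j \<in> C \<Longrightarrow> j \<in> core I N C j"
proof -
  assume j: "j \<in> C"
  have "j \<in> (grow I N C ^^ m) {j}" for m
    by (induction m) (use j in \<open>auto simp: grow_def spread_def\<close>)
  then show ?thesis by (simp add: core_def)
qed

lemma core_sub: "j \<in> C \<Longrightarrow> core I N C j \<subseteq> C"
proof -
  assume j: "j \<in> C"
  have "(grow I N C ^^ m) {j} \<subseteq> C" for m
    by (induction m) (use j in \<open>auto simp: grow_def spread_def\<close>)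
  then show ?thesis by (simp add: core_def)
qed

text \<open>Each recorded ball costs at least one remaining client, so the list has at most
  \<open>card U\<close> entries; this bounds the code of the state during carving.\<close>

definition carve_space :: "nat set \<Rightarrow> (nat set \<times> nat set list) set" where
  "carve_space U = {v. fst v \<subseteq> U \<and> (\<forall>J\<in>set (snd v). J \<subseteq> U) \<and> card (fst v) + length (snd v) \<le> card U}"

lemma carve_space_step:
  assumes "v \<in> carve_space U" "finite U"
  shows "carve I N v \<in> carve_space U"
proof (cases "{j\<in>fst v. thin I N (fst v) (core I N (fst v) j)} = {}")
  case True
  then show ?thesis using assms by (simp add: carve_def)
next
  case False
  define j where "j = Min {j\<in>fst v. thin I N (fst v) (core I N (fst v) j)}"
  define J where "J = core I N (fst v) j"
  have v: "fst v \<subseteq> U" "\<forall>J\<in>set (snd v). J \<subseteq> U" "card (fst v) + length (snd v) \<le> card U"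
    using assms(1) by (auto simp: carve_space_def)
  have fin: "finite (fst v)" by (rule finite_subset[OF v(1) assms(2)])
  have "j \<in> {j\<in>fst v. thin I N (fst v) (core I N (fst v) j)}"
    unfolding j_def using False fin by (intro Min_in) auto
  then have j: "j \<in> fst v" by simp
  have J: "j \<in> J" "J \<subseteq> fst v" using core_self[OF j] core_sub[OF j] by (auto simp: J_def)
  have eq: "carve I N v = (fst v - spread I (fst v) J, J # snd v)"
    unfolding carve_def Let_def J_def j_def using False by (simp only: if_False)
  have "fst v - spread I (fst v) J \<subset> fst v" using j J by (auto simp: spread_def)
  then have "card (fst v - spread I (fst v) J) < card (fst v)" by (rule psubset_card_mono[OF fin])
  then show ?thesis using v J by (auto simp: eq carve_space_def)
qed

lemma carved_space: "finite (clients I) \<Longrightarrow> carved I N \<in> carve_space (clients I)"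
proof -
  assume "finite (clients I)"
  then have "(carve I N ^^ m) (clients I, []) \<in> carve_space (clients I)" for m
  proof (induction m)
    case (Suc m)
    then show ?case using carve_space_step[OF _ \<open>finite (clients I)\<close>] by simp
  qed (simp add: carve_space_def)
  then show ?thesis by (simp add: carved_def)
qed

context
  fixes D :: "'s set" and e :: "'s \<Rightarrow> val" and W :: "'s \<Rightarrow> input" and N :: "'s \<Rightarrow> nat"
  assumes W: "input_c D e W" and N: "nat_c D e N"
begin

lemma carved_c: "state_c D e (\<lambda>s. carved (inst_of (W s)) (N s))"
  unfolding carved_def
proof (rule computes_funpow[where J = "\<lambda>s. carve_space (clients (inst_of (W s)))"])
  note C = clients_c[OF W]
  have fin: "finite (clients (inst_of (W s)))" if "s \<in> D" for s by (rule computes_ok[OF C that])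
  show "nat_c D e (\<lambda>s. card (clients (inst_of (W s))))" by (intro nat_card C)
  show "poly_bounded D e (\<lambda>s. card (clients (inst_of (W s))))" by (rule card_bounded[OF C])
  show "state_c D e (\<lambda>s. (clients (inst_of (W s)), []))"
    by (intro state_Pair C computes_const) simp
  have v: "state_c (Sigma D (\<lambda>s. carve_space (clients (inst_of (W s))))) (extend enc_state e) snd"
  proof (rule computes_var)
    fix s v assume s: "s \<in> D" and v: "v \<in> carve_space (clients (inst_of (W s)))"
    show "finite (fst v) \<and> (\<forall>J\<in>set (snd v). finite J)"
      by (intro conjI ballI; rule finite_subset[OF _ fin[OF s]]) (use v in \<open>simp_all add: carve_space_def\<close>)
  qed
  show "state_c (Sigma D (\<lambda>s. carve_space (clients (inst_of (W s))))) (extend enc_state e)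
      (\<lambda>z. carve (inst_of (W (fst z))) (N (fst z)) (snd z))"
    by (intro carve_c W[THEN computes_lift] N[THEN computes_lift] v)
  show "(clients (inst_of (W s)), []) \<in> carve_space (clients (inst_of (W s)))" for s
    by (simp add: carve_space_def)
  show "carve (inst_of (W s)) (N s) v \<in> carve_space (clients (inst_of (W s)))"
    if "s \<in> D" "v \<in> carve_space (clients (inst_of (W s)))" for s v
    by (rule carve_space_step[OF that(2) fin[OF that(1)]])
  show "poly_bounded D e (\<lambda>s. 1 + vsize (enc_set (clients (inst_of (W s))))
      + (1 + card (clients (inst_of (W s))) * (1 + vsize (enc_set (clients (inst_of (W s)))))))"
    by (intro poly_bounded_intros card_bounded C poly_time_size[OF computes_poly[OF C]])
  show "vsize (enc_state v) \<le> 1 + vsize (enc_set (clients (inst_of (W s))))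
      + (1 + card (clients (inst_of (W s))) * (1 + vsize (enc_set (clients (inst_of (W s))))))"
    if s: "s \<in> D" and v: "v \<in> carve_space (clients (inst_of (W s)))" for s v
  proof -
    let ?U = "clients (inst_of (W s))"
    have v': "fst v \<subseteq> ?U" "\<forall>J\<in>set (snd v). J \<subseteq> ?U" "length (snd v) \<le> card ?U"
      using v by (auto simp: carve_space_def)
    have "vsize (enc_set (fst v)) \<le> vsize (enc_set ?U)" by (rule vsize_enc_set_mono[OF fin[OF s] v'(1)])
    moreover have "vsize (enc_list enc_set (snd v)) \<le> 1 + length (snd v) * (1 + vsize (enc_set ?U))"
      by (rule vsize_enc_list_le) (use v'(2) vsize_enc_set_mono[OF fin[OF s]] in blast)
    moreover have "length (snd v) * (1 + vsize (enc_set ?U)) \<le> card ?U * (1 + vsize (enc_set ?U))"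
      by (rule mult_le_mono1[OF v'(3)])
    ultimately show ?thesis unfolding enc_state_def vsize.simps by linarith
  qed
qed

lemma rest_c: "set_c D e (\<lambda>s. rest (inst_of (W s)) (N s))"
  unfolding rest_def by (rule state_fst[OF carved_c])

lemma cored_c: "sets_c D e (\<lambda>s. snd (carved (inst_of (W s)) (N s)))"
  by (rule state_snd[OF carved_c])

lemma rball_c:
  assumes "nat_c D e t" "nat_c D e j"
  shows "set_c D e (\<lambda>s. rball (inst_of (W s)) (N s) (t s) (j s))"
  unfolding rball_def by (intro client_ball_c W rest_c assms)

lemma weight_c:
  assumes "nat_c D e j"
  shows "nat_c D e (\<lambda>s. weight (inst_of (W s)) (N s) k (j s))"
  unfolding weight_def by (intro nat_card rball_c nat_add horizon_c N nat_const assms)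

lemma jump_const_c: "nat_c D e (\<lambda>s. jump_const (N s))"
  unfolding jump_const_def plenty_const_def load_const_def by (intro nat_mult nat_add nat_const N)

lemma plenty_const_c: "nat_c D e (\<lambda>s. plenty_const (N s))"
  unfolding plenty_const_def load_const_def by (intro nat_mult nat_add nat_const N)

end

lemma add_sink_c:
  assumes W: "input_c D e W" and N: "nat_c D e N" and A: "set_c D e A"
  shows "set_c D e (\<lambda>s. add_sink (inst_of (W s)) (N s) (A s))"
proof -
  note W1 = W[THEN computes_lift] note W2 = W1[THEN computes_lift]
  note N1 = N[THEN computes_lift] note N2 = N1[THEN computes_lift]
  note nat_var_lift1 = nat_var[THEN computes_lift]
  define X where "X s = {j\<in>rest (inst_of (W s)) (N s).
      \<forall>a\<in>A s. a \<notin> rball (inst_of (W s)) (N s) (2 * horizon (N s) + 6) j}" for s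
  have X: "set_c D e X"
    unfolding X_def
    by (intro set_filter rest_c W N bool_ball A[THEN computes_lift] bool_not bool_mem nat_var
        rball_c[OF W2 N2] nat_add nat_mult nat_const horizon_c N2 nat_var_lift1)
  have Y: "set_c D e (\<lambda>s. {j\<in>X s. \<forall>k\<in>X s. weight (inst_of (W s)) (N s) 0 k \<le> weight (inst_of (W s)) (N s) 0 j})"
    by (intro set_filter X bool_ball X[THEN computes_lift] bool_le weight_c[OF W2 N2] nat_var nat_var_lift1)
  have "set_c D e (\<lambda>s. if X s = {} then A s
      else insert (Min {j\<in>X s. \<forall>k\<in>X s. weight (inst_of (W s)) (N s) 0 k \<le> weight (inst_of (W s)) (N s) 0 j}) (A s))"
    by (intro computes_if bool_empty X A set_insert nat_Min Y)
  then show ?thesis unfolding X_def add_sink_def Let_def .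
qed

lemma add_sink_sub:
  assumes "finite (rest I N)" "A \<subseteq> rest I N"
  shows "add_sink I N A \<subseteq> rest I N"
proof -
  define X where "X = {j\<in>rest I N. \<forall>a\<in>A. a \<notin> rball I N (2 * horizon N + 6) j}"
  show ?thesis
  proof (cases "X = {}")
    case True
    then show ?thesis using assms by (simp add: add_sink_def X_def[symmetric])
  next
    case False
    let ?Y = "{j\<in>X. \<forall>k\<in>X. weight I N 0 k \<le> weight I N 0 j}"
    have fin: "finite X" using assms(1) by (simp add: X_def)
    have "Max (weight I N 0 ` X) \<in> weight I N 0 ` X" using False fin by (intro Max_in) auto
    then obtain j where j: "j \<in> X" "weight I N 0 j = Max (weight I N 0 ` X)" by (metis imageE)
    have "weight I N 0 k \<le> weight I N 0 j" if "k \<in> X" for k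
      unfolding j(2) by (rule Max_ge) (use that fin in auto)
    with j(1) have "j \<in> ?Y" by simp
    then have "?Y \<noteq> {}" by (metis empty_iff)
    then have "Min ?Y \<in> ?Y" by (intro Min_in) (use fin in simp)
    then have "Min ?Y \<in> rest I N" by (simp add: X_def)
    moreover have "add_sink I N A = insert (Min ?Y) A"
      unfolding add_sink_def Let_def X_def[symmetric] using False by (simp only: if_False)
    ultimately show ?thesis using assms(2) by simp
  qed
qed

lemmas lift1 = computes_lift
lemmas lift2 = computes_lift[THEN computes_lift]
lemmas nat_var_lift1 = nat_var[THEN computes_lift]

lemma sinks_c:
  assumes W: "input_c D e W" and N: "nat_c D e N"
  shows "set_c D e (\<lambda>s. sinks (inst_of (W s)) (N s))"
  unfolding sinks_def
proof (rule set_funpow)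
  show "nat_c D e (\<lambda>s. card (clients (inst_of (W s))))" by (intro nat_card clients_c W)
  show "poly_bounded D e (\<lambda>s. card (clients (inst_of (W s))))" by (rule card_bounded[OF clients_c[OF W]])
  show U: "set_c D e (\<lambda>s. rest (inst_of (W s)) (N s))" by (rule rest_c[OF W N])
  show "set_c (Sigma D (\<lambda>s. {S. S \<subseteq> rest (inst_of (W s)) (N s)})) (extend enc_set e)
      (\<lambda>z. add_sink (inst_of (W (fst z))) (N (fst z)) (snd z))"
    by (intro add_sink_c lift1[OF W] lift1[OF N] subset_var U)
  show "add_sink (inst_of (W s)) (N s) S \<subseteq> rest (inst_of (W s)) (N s)"
    if "s \<in> D" "S \<subseteq> rest (inst_of (W s)) (N s)" for s S
    by (rule add_sink_sub[OF computes_ok[OF U that(1)] that(2)])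
qed (auto intro: set_empty)

lemma home_c:
  assumes W: "input_c D e W" and N: "nat_c D e N" and j: "nat_c D e j"
  shows "nat_c D e (\<lambda>s. home (inst_of (W s)) (N s) (j s))"
  unfolding home_def
  by (intro nat_Min set_filter sinks_c W N bool_conj bool_mem nat_var rball_c[OF lift1[OF W] lift1[OF N]]
      nat_add nat_mult nat_const horizon_c lift1[OF N] j[THEN computes_lift] bool_le
      weight_c[OF lift1[OF W] lift1[OF N]])

lemma parents_c:
  assumes W: "input_c D e W" and N: "nat_c D e N" and j: "nat_c D e j"
  shows "set_c D e (\<lambda>s. parents (inst_of (W s)) (N s) (j s))"
  unfolding parents_def
  by (intro set_filter sinks_c W N bool_conj bool_mem nat_var rball_c[OF lift1[OF W] lift1[OF N]]
      nat_add nat_mult nat_const horizon_c lift1[OF N] j[THEN computes_lift] bool_le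
      weight_c[OF lift1[OF W] lift1[OF N]] jump_const_c[OF lift1[OF W] lift1[OF N]])

lemma children_c:
  assumes W: "input_c D e W" and N: "nat_c D e N" and j: "nat_c D e j"
  shows "set_c D e (\<lambda>s. children (inst_of (W s)) (N s) (j s))"
  unfolding children_def
  by (intro set_filter sinks_c W N bool_conj bool_not bool_empty bool_eq nat_Min
      parents_c[OF lift1[OF W] lift1[OF N]] nat_var j[THEN computes_lift])

lemma plentiful_c:
  assumes W: "input_c D e W" and N: "nat_c D e N" and j: "nat_c D e j"
  shows "bool_c D e (\<lambda>s. plentiful (inst_of (W s)) (N s) (j s))"
  unfolding plentiful_def
  by (intro bool_ball children_c W N j bool_le nat_mult plenty_const_c[OF lift1[OF W] lift1[OF N]]
      weight_c[OF lift1[OF W] lift1[OF N]] nat_var nat_sum children_c[OF lift1[OF W] lift1[OF N]] j[THEN computes_lift]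
      weight_c[OF lift2[OF W] lift2[OF N]])

lemma closed_sinks_c:
  assumes W: "input_c D e W" and N: "nat_c D e N"
  shows "set_c D e (\<lambda>s. closed_sinks (inst_of (W s)) (N s))"
  unfolding closed_sinks_def
  by (intro set_filter sinks_c W N bool_conj bool_not bool_empty parents_c[OF lift1[OF W] lift1[OF N]] nat_var
      plentiful_c[OF lift1[OF W] lift1[OF N]] nat_Min)

lemma label_c:
  assumes W: "input_c D e W" and N: "nat_c D e N" and j: "nat_c D e j"
  shows "nat_c D e (\<lambda>s. label (inst_of (W s)) (N s) (j s))"
  unfolding label_def
  by (intro computes_if bool_conj bool_not bool_empty parents_c[OF W N] plentiful_c[OF W N] nat_Min
      children_c[OF W N] j)

lemma radius_c:
  assumes W: "input_c D e W" and N: "nat_c D e N" and j: "nat_c D e j"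
  shows "nat_c D e (\<lambda>s. radius (inst_of (W s)) (N s) (j s))"
  unfolding radius_def
  by (intro nat_add horizon_c N computes_if bool_empty parents_c[OF W N] j nat_const)

lemma live_c:
  assumes W: "input_c D e W" and N: "nat_c D e N"
  shows "set_c D e (\<lambda>s. live (inst_of (W s)) (N s))"
  unfolding live_def
  by (intro set_filter rest_c W N bool_ball closed_sinks_c lift1[OF W] lift1[OF N] bool_not bool_mem
      rball_c[OF lift2[OF W] lift2[OF N]] nat_add nat_const horizon_c lift2[OF N] nat_var nat_var_lift1)

lemma open_facs_c:
  assumes W: "input_c D e W" and N: "nat_c D e N"
  shows "set_c D e (\<lambda>s. open_facs (inst_of (W s)) (N s))"
proof -
  note W3 = lift2[OF W, THEN computes_lift] note nat_var2 = nat_var_lift1[THEN computes_lift]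
  show ?thesis
    unfolding open_facs_def
    by (intro set_filter facs_c W bool_conj bool_bex bool_ball rest_c[OF lift1[OF W] lift1[OF N]]
        adjacent_c[OF lift2[OF W]] nat_var nat_var_lift1 closed_sinks_c[OF lift1[OF W] lift1[OF N]]
        rball_c[OF lift2[OF W] lift2[OF N]] horizon_c lift2[OF N] bool_not adjacent_c[OF W3] nat_var2)
qed

lemma bool_ball_sets:
  assumes "sets_c D e Js"
    and "bool_c (Sigma D (\<lambda>s. set (Js s))) (extend enc_set e) (\<lambda>z. P (fst z) (snd z))"
  shows "bool_c D e (\<lambda>s. \<forall>J\<in>set (Js s). P s J)"
  using bool_not[OF bool_bex_sets[OF assms(1) bool_not[OF assms(2)]]] by simp

lemma lone_facs_c:
  assumes W: "input_c D e W" and N: "nat_c D e N"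
  shows "set_c D e (\<lambda>s. lone_facs (inst_of (W s)) (N s))"
proof -
  note W3 = lift2[OF W, THEN computes_lift] note nat_var2 = nat_var_lift1[THEN computes_lift]
  note K = cored_c[OF lift1[OF W] lift1[OF N]]
  show ?thesis
    unfolding lone_facs_def
    by (intro set_filter facs_c W bool_conj bool_ball rest_c[OF lift1[OF W] lift1[OF N]] bool_not
        adjacent_c[OF lift2[OF W]] nat_var nat_var_lift1 bool_ball_sets K sets_var adjacent_c[OF W3] nat_var2)
qed

lemma forced_c:
  assumes W: "input_c D e W" and N: "nat_c D e N" and i: "nat_c D e i"
  shows "set_c D e (\<lambda>s. forced (inst_of (W s)) (N s) (i s))"
  unfolding forced_def
  by (intro set_filter sinks_c W N bool_conj bool_not bool_mem nat_var closed_sinks_c[OF lift1[OF W] lift1[OF N]]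
      bool_bex rball_c[OF lift1[OF W] lift1[OF N]] radius_c[OF lift1[OF W] lift1[OF N]] adjacent_c[OF lift2[OF W]]
      i[THEN computes_lift, THEN computes_lift])

lemma centre_c:
  assumes W: "input_c D e W" and N: "nat_c D e N" and i: "nat_c D e i"
  shows "nat_c D e (\<lambda>s. centre (inst_of (W s)) (N s) (i s))"
  unfolding centre_def
  by (intro computes_if bool_empty forced_c[OF W N i] home_c[OF W N] nat_Min set_filter rest_c[OF W N]
      adjacent_c[OF lift1[OF W]] i[THEN computes_lift] nat_var)

lemma cluster_c:
  assumes W: "input_c D e W" and N: "nat_c D e N" and l: "nat_c D e l"
  shows "set_c D e (\<lambda>s. cluster (inst_of (W s)) (N s) (l s))"
  unfolding cluster_def
  by (intro set_filter open_facs_c[OF W N] bool_eq label_c[OF lift1[OF W] lift1[OF N]]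
      centre_c[OF lift1[OF W] lift1[OF N]] nat_var l[THEN computes_lift])

section \<open>Exact evaluation of the thresholds over the rationals\<close>

lemma rat_of_0 [simp]: "rat_of 0 = 0"
  unfolding rat_of_def by (rule inv_f_eq) (auto simp: inj_def)

lemma rest_clients: "finite (clients I) \<Longrightarrow> rest I N \<subseteq> clients I"
  using carved_space[of I N] by (simp add: rest_def carve_space_def)

lemma live_clients: "finite (clients I) \<Longrightarrow> live I N \<subseteq> clients I"
  by (rule subset_trans[OF _ rest_clients]) (auto simp: live_def)

lemma cluster_facs: "cluster I N l \<subseteq> facs I"
  by (auto simp: cluster_def open_facs_def)

lemma good_rational:
  assumes "good w"
  shows "i \<in> facs (inst_of w) \<Longrightarrow> j \<in> clients (inst_of w) \<Longrightarrow> p \<in> types (inst_of w) \<Longrightarrow> x_of w i j p \<in> \<rat>"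
    and "i \<in> facs (inst_of w) \<Longrightarrow> p \<in> types (inst_of w) \<Longrightarrow> y_of w i p \<in> \<rat>"
  using assms by (auto simp: good_def rational_input_def rational_x_def)

text \<open>The program compares rational sums. The embedding into the reals is additive and
  respects the order in both directions, so the real comparison has the same outcome.\<close>

lemma kept_c:
  assumes W: "input_c D e W" and N: "nat_c D e N" and l: "nat_c D e l" and p: "nat_c D e p"
    and pt: "\<And>s. s \<in> D \<Longrightarrow> p s \<in> types (inst_of (W s))"
  shows "bool_c D e (\<lambda>s. kept (inst_of (W s)) (N s) (y_of (W s)) (l s) (p s))"
proof -
  have "bool_c D e (\<lambda>s. of_nat (N s) + 1 \<le>
      (\<Sum>q\<in>{q\<in>types (inst_of (W s)). p s \<le> q}. \<Sum>i\<in>cluster (inst_of (W s)) (N s) (l s). rat_of (y_of (W s) i q)))"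
  proof (intro rat_le rat_add rat_of_nat N rat_const rat_sum set_filter types_c[OF W] bool_le lift1[OF p] nat_var)
    let ?D = "SIGMA s:D. {q\<in>types (inst_of (W s)). p s \<le> q}"
    show "set_c ?D (extend enc_nat e) (\<lambda>z. cluster (inst_of (W (fst z))) (N (fst z)) (l (fst z)))"
      by (rule cluster_c[OF lift1[OF W] lift1[OF N] lift1[OF l]])
    show "rat_c (SIGMA z:?D. cluster (inst_of (W (fst z))) (N (fst z)) (l (fst z))) (extend enc_nat (extend enc_nat e))
        (\<lambda>z. rat_of (y_of (W (fst (fst z))) (snd z) (snd (fst z))))"
      by (rule y_c[OF lift2[OF W] nat_var nat_var_lift1]) (auto dest: subsetD[OF cluster_facs])
  qed
  then show ?thesis
  proof (rule computes_cong)
    fix s assume s: "s \<in> D"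
    let ?I = "inst_of (W s)"
    have g: "good (W s)" by (rule computes_ok[OF W s])
    have "{q\<in>types ?I. p s \<le> q} = {p s..num_types ?I}" using pt[OF s] by (auto simp: types_def)
    moreover have "(\<Sum>q\<in>{q\<in>types ?I. p s \<le> q}. \<Sum>i\<in>cluster ?I (N s) (l s). y_of (W s) i q)
      = real_of_rat (\<Sum>q\<in>{q\<in>types ?I. p s \<le> q}. \<Sum>i\<in>cluster ?I (N s) (l s). rat_of (y_of (W s) i q))"
      unfolding of_rat_sum
    proof (intro sum.cong refl)
      fix q i assume "q \<in> {q\<in>types ?I. p s \<le> q}" "i \<in> cluster ?I (N s) (l s)"
      then have "y_of (W s) i q \<in> \<rat>" using good_rational(2)[OF g] subsetD[OF cluster_facs] by auto
      then show "y_of (W s) i q = real_of_rat (rat_of (y_of (W s) i q))" by (simp add: real_of_rat_of)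
    qed
    moreover have "real (N s) + 1 = real_of_rat (of_nat (N s) + 1)" by (simp add: of_rat_add)
    ultimately show "kept ?I (N s) (y_of (W s)) (l s) (p s) \<longleftrightarrow> of_nat (N s) + 1 \<le>
      (\<Sum>q\<in>{q\<in>types ?I. p s \<le> q}. \<Sum>i\<in>cluster ?I (N s) (l s). rat_of (y_of (W s) i q))"
      unfolding kept_def by (simp only: of_rat_less_eq)
  qed
qed

lemma new_x_c:
  assumes W: "input_c D e W" and N: "nat_c D e N" and i: "nat_c D e i" and j: "nat_c D e j" and p: "nat_c D e p"
    and mem: "\<And>s. s \<in> D \<Longrightarrow> i s \<in> facs (inst_of (W s))" "\<And>s. s \<in> D \<Longrightarrow> j s \<in> clients (inst_of (W s))"
      "\<And>s. s \<in> D \<Longrightarrow> p s \<in> types (inst_of (W s))"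
  shows "rat_c D e (\<lambda>s. rat_of (new_x (inst_of (W s)) (N s) (x_of (W s)) (y_of (W s)) (i s) (j s) (p s)))"
proof -
  have "rat_c D e (\<lambda>s. if j s \<in> live (inst_of (W s)) (N s) \<and> i s \<in> open_facs (inst_of (W s)) (N s) \<and>
       kept (inst_of (W s)) (N s) (y_of (W s)) (label (inst_of (W s)) (N s) (centre (inst_of (W s)) (N s) (i s))) (p s)
      then rat_of (x_of (W s) (i s) (j s) (p s)) else 0)"
    by (rule computes_if[OF bool_conj[OF bool_mem[OF j live_c[OF W N]] bool_conj[OF
          bool_mem[OF i open_facs_c[OF W N]] kept_c[OF W N label_c[OF W N centre_c[OF W N i]] p mem(3)]]]
          x_c[OF W i j p mem] rat_const])
  then show ?thesis by (rule computes_cong) (auto simp: new_x_def)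
qed

lemma new_x_rational:
  assumes "good w" "i \<in> facs (inst_of w)" "j \<in> clients (inst_of w)" "p \<in> types (inst_of w)"
  shows "new_x (inst_of w) N (x_of w) (y_of w) i j p \<in> \<rat>"
  using good_rational(1)[OF assms] by (simp add: new_x_def)

lemma bad_c:
  assumes W: "input_c D e W" and N: "nat_c D e N"
  shows "set_c D e (\<lambda>s. bad (inst_of (W s)) (N s) (x_of (W s)) (y_of (W s)))"
proof -
  have fin: "finite (clients (inst_of (W s)))" if "s \<in> D" for s
    by (rule computes_ok[OF clients_c[OF W] that])
  let ?L = "SIGMA s:D. live (inst_of (W s)) (N s)"
  have 1: "rat_c ?L (extend enc_nat e) (\<lambda>z. \<Sum>i\<in>facs (inst_of (W (fst z))). \<Sum>p\<in>types (inst_of (W (fst z))).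
      rat_of (new_x (inst_of (W (fst z))) (N (fst z)) (x_of (W (fst z))) (y_of (W (fst z))) i (snd z) p))"
  proof (intro rat_sum facs_c[OF lift1[OF W]] types_c[OF lift2[OF W]])
    show "rat_c (SIGMA z:(SIGMA z:?L. facs (inst_of (W (fst z)))). types (inst_of (W (fst (fst z)))))
        (extend enc_nat (extend enc_nat (extend enc_nat e)))
        (\<lambda>z. rat_of (new_x (inst_of (W (fst (fst (fst z))))) (N (fst (fst (fst z)))) (x_of (W (fst (fst (fst z)))))
           (y_of (W (fst (fst (fst z))))) (snd (fst z)) (snd (fst (fst z))) (snd z)))"
      by (rule new_x_c[OF lift2[OF lift1[OF W]] lift2[OF lift1[OF N]] nat_var_lift1 nat_var_lift1[THEN computes_lift] nat_var])
         (auto dest: subsetD[OF live_clients[OF fin]])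
  qed
  have "set_c D e (\<lambda>s. {j\<in>live (inst_of (W s)) (N s).
      (\<Sum>i\<in>facs (inst_of (W s)). \<Sum>p\<in>types (inst_of (W s)).
        rat_of (new_x (inst_of (W s)) (N s) (x_of (W s)) (y_of (W s)) i j p)) < 1 - 1 / (100 * of_nat (N s))})"
    by (intro set_filter live_c[OF W N] rat_less 1 rat_diff rat_divide rat_mult rat_const rat_of_nat lift1[OF N])
  then show ?thesis
  proof (rule computes_cong)
    fix s assume s: "s \<in> D"
    have g: "good (W s)" by (rule computes_ok[OF W s])
    have "(\<Sum>i\<in>facs (inst_of (W s)). \<Sum>p\<in>types (inst_of (W s)).
        new_x (inst_of (W s)) (N s) (x_of (W s)) (y_of (W s)) i j p) < 1 - 1 / (100 * real (N s)) \<longleftrightarrow>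
      (\<Sum>i\<in>facs (inst_of (W s)). \<Sum>p\<in>types (inst_of (W s)).
        rat_of (new_x (inst_of (W s)) (N s) (x_of (W s)) (y_of (W s)) i j p)) < 1 - 1 / (100 * of_nat (N s))"
      if "j \<in> live (inst_of (W s)) (N s)" for j
    proof -
      have j: "j \<in> clients (inst_of (W s))" by (rule subsetD[OF live_clients[OF fin[OF s]] that])
      have 1: "(\<Sum>i\<in>facs (inst_of (W s)). \<Sum>p\<in>types (inst_of (W s)).
          new_x (inst_of (W s)) (N s) (x_of (W s)) (y_of (W s)) i j p)
        = real_of_rat (\<Sum>i\<in>facs (inst_of (W s)). \<Sum>p\<in>types (inst_of (W s)).
          rat_of (new_x (inst_of (W s)) (N s) (x_of (W s)) (y_of (W s)) i j p))"
        unfolding of_rat_sum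
        by (intro sum.cong refl) (simp add: real_of_rat_of new_x_rational[OF g _ j])
      have 2: "1 - 1 / (100 * real (N s)) = real_of_rat (1 - 1 / (100 * of_nat (N s)))"
        by (simp add: of_rat_diff of_rat_divide of_rat_mult)
      show ?thesis unfolding 1 2 of_rat_less ..
    qed
    then show "bad (inst_of (W s)) (N s) (x_of (W s)) (y_of (W s)) = {j\<in>live (inst_of (W s)) (N s).
      (\<Sum>i\<in>facs (inst_of (W s)). \<Sum>p\<in>types (inst_of (W s)).
        rat_of (new_x (inst_of (W s)) (N s) (x_of (W s)) (y_of (W s)) i j p)) < 1 - 1 / (100 * of_nat (N s))}"
      unfolding bad_def by (intro Collect_cong) auto
  qed
qed

lemma cores_c:
  assumes W: "input_c D e W" and N: "nat_c D e N"
  shows "sets_c D e (\<lambda>s. cores (inst_of (W s)) (N s))"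
  unfolding cores_def
  by (intro sets_append cored_c[OF W N] sets_map closed_sinks_c[OF W N] rball_c[OF lift1[OF W] lift1[OF N]]
      horizon_c lift1[OF N] nat_var)

lemma sets_map_list:
  assumes "sets_c D e Js" "poly_time (Sigma D (\<lambda>s. set (Js s))) (extend enc_set e) (\<lambda>z. g (fst z) (snd z))"
  shows "poly_time D e (\<lambda>s. enc_list (g s) (Js s))"
  by (rule poly_time_map[OF computes_poly[OF assms(1)]]) (use assms(2) in \<open>simp add: extend_def\<close>)

text \<open>The union of the cores is computed as a filter of the clients, which is correct by the
  assumption \<open>sub\<close>.\<close>

lemma output_c:
  assumes W: "input_c D e W" and N: "nat_c D e N"
    and sub: "\<And>s. s \<in> D \<Longrightarrow> \<Union> (set (cores (inst_of (W s)) (N s))) \<subseteq> clients (inst_of (W s))"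
  shows "poly_time D e (\<lambda>s. enc_output (inst_of (W s)) (decompose (inst_of (W s)) (N s) (x_of (W s)) (y_of (W s))))"
proof -
  note K = cores_c[OF W N]
  have x: "poly_time D e (\<lambda>s. enc_x (inst_of (W s)) (new_x (inst_of (W s)) (N s) (x_of (W s)) (y_of (W s))))"
    unfolding enc_x_def enc_real_rat_of
  proof (intro table_c facs_c[OF W] clients_c[OF lift1[OF W]] types_c[OF lift2[OF W]])
    show "poly_time (SIGMA z:(SIGMA z:(SIGMA s:D. facs (inst_of (W s))). clients (inst_of (W (fst z)))).
          types (inst_of (W (fst (fst z)))))
        (extend enc_nat (extend enc_nat (extend enc_nat e)))
        (\<lambda>z. VNum (rat_of (new_x (inst_of (W (fst (fst (fst z))))) (N (fst (fst (fst z)))) (x_of (W (fst (fst (fst z)))))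
           (y_of (W (fst (fst (fst z))))) (snd (fst (fst z))) (snd (fst z)) (snd z))))"
      by (rule computes_poly, rule new_x_c[OF lift2[OF lift1[OF W]] lift2[OF lift1[OF N]] nat_var_lift1[THEN computes_lift] nat_var_lift1 nat_var])
         auto
  qed
  have S1: "sets_c D e (\<lambda>s. map (cluster (inst_of (W s)) (N s))
      (sorted_list_of_set {l\<in>sinks (inst_of (W s)) (N s). cluster (inst_of (W s)) (N s) l \<noteq> {}}))"
    by (intro sets_map set_filter sinks_c[OF W N] bool_not bool_empty cluster_c[OF lift1[OF W] lift1[OF N]] nat_var)
  have S2: "sets_c D e (\<lambda>s. map (\<lambda>i. {i}) (sorted_list_of_set (lone_facs (inst_of (W s)) (N s))))"
    by (intro sets_map lone_facs_c[OF W N] set_singleton nat_var)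
  have S: "poly_time D e (\<lambda>s. enc_list enc_set (map (cluster (inst_of (W s)) (N s))
      (filter (\<lambda>l. cluster (inst_of (W s)) (N s) l \<noteq> {}) (sorted_list_of_set (sinks (inst_of (W s)) (N s)))) @
      map (\<lambda>i. {i}) (sorted_list_of_set (lone_facs (inst_of (W s)) (N s)))))"
    by (rule poly_time_cong[OF computes_poly[OF sets_append[OF S1 S2]]])
       (simp add: sorted_list_filter[OF computes_ok[OF sinks_c[OF W N]]])
  have "poly_time D e (\<lambda>s. enc_list (\<lambda>J. VCons (enc_set (nbrs (inst_of (W s)) J)) (enc_set J))
      (cores (inst_of (W s)) (N s)))"
    by (intro sets_map_list[OF K] poly_time_pair computes_poly[OF nbrs_c[OF lift1[OF W]]]
        computes_poly[OF sets_var[OF K]] sets_var[OF K])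
  then have T: "poly_time D e (\<lambda>s. enc_list (\<lambda>(T, J). VCons (enc_set T) (enc_set J))
      (map (\<lambda>J. (nbrs (inst_of (W s)) J, J)) (cores (inst_of (W s)) (N s))))"
    by (simp add: enc_list_map)
  have "set_c D e (\<lambda>s. {j\<in>clients (inst_of (W s)). \<exists>J\<in>set (cores (inst_of (W s)) (N s)). j \<in> J})"
    by (intro set_filter clients_c[OF W] bool_bex_sets lift1[OF K] bool_mem nat_var_lift1 nat_var lift1[OF nat_var] sets_var)
  then have U: "set_c D e (\<lambda>s. \<Union> (set (cores (inst_of (W s)) (N s))))"
    by (rule computes_cong) (use sub in blast)
  have G: "set_c D e (\<lambda>s. live (inst_of (W s)) (N s) - bad (inst_of (W s)) (N s) (x_of (W s)) (y_of (W s)))"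
    by (intro set_diff live_c[OF W N] bad_c[OF W N])
  note X = set_diff[OF set_diff[OF clients_c[OF W] U] G]
  show ?thesis
    using poly_time_pair[OF x poly_time_pair[OF S poly_time_pair[OF T poly_time_pair[OF computes_poly[OF X]
      poly_time_pair[OF computes_poly[OF U] poly_time_pair[OF computes_poly[OF G] poly_time_const[of _ _ VNil]]]]]]]
    unfolding enc_output_def decompose_def decomposition.simps by simp
qed

definition trivial_decomposition :: "instance_hck \<Rightarrow> decomposition" where
  "trivial_decomposition I =
     \<lparr>xbar = \<lambda>_ _ _. 0, S_fam = map (\<lambda>i. {i}) (sorted_list_of_set (facs I)), T_fam = [],
      C_del = {}, C_T = {}, C_S = clients I\<rparr>"

lemma trivial_output_c:
  assumes W: "input_c D e W"
  shows "poly_time D e (\<lambda>s. enc_output (inst_of (W s)) (trivial_decomposition (inst_of (W s))))"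
proof -
  have x: "poly_time D e (\<lambda>s. enc_x (inst_of (W s)) (\<lambda>_ _ _. 0))"
    unfolding enc_x_def
    by (intro table_c facs_c[OF W] clients_c[OF lift1[OF W]] types_c[OF lift2[OF W]] poly_time_const)
  have S: "sets_c D e (\<lambda>s. map (\<lambda>i. {i}) (sorted_list_of_set (facs (inst_of (W s)))))"
    by (intro sets_map facs_c[OF W] set_singleton nat_var)
  show ?thesis
    using poly_time_pair[OF x poly_time_pair[OF computes_poly[OF S] poly_time_pair[OF poly_time_const[of _ _ VNil]
      poly_time_pair[OF computes_poly[OF set_empty] poly_time_pair[OF computes_poly[OF set_empty]
        poly_time_pair[OF computes_poly[OF clients_c[OF W]] poly_time_const[of _ _ VNil]]]]]]]
    unfolding enc_output_def trivial_decomposition_def decomposition.simps by simp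
qed

section \<open>The theorem\<close>

lemma trivial_correct:
  assumes I: "wf_instance I" and f: "feasible I x y" and d: "100 \<le> \<delta>" and r: "0 \<le> r"
  shows "is_decomposition I y \<delta> r (trivial_decomposition I)"
proof -
  have fin: "finite (facs I)" using I by (simp add: wf_instance_def points_def)
  have y: "nonneg_y I y" using f by (simp add: feasible_def)
  have round: "roundable I (\<lambda>_ _ _. 0) y r (1 + \<delta>) {i}" if i: "i \<in> facs I" for i
  proof -
    have "hop_dist I (Inl i) (Inl i) \<le> enat 0"
      unfolding hop_dist_def by (rule INF_lower) simp
    then have "diam_G I {i} = 0" by (simp add: diam_G_def enat_0)
    moreover have "(0::int) \<le> \<lfloor>\<Sum>q\<in>{p..num_types I}. y i q\<rfloor>" if "p \<in> types I" for p
    proof -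
      have "0 \<le> (\<Sum>q\<in>{p..num_types I}. y i q)"
        using y i that by (intro sum_nonneg) (auto simp: nonneg_y_def types_def)
      then show ?thesis by simp
    qed
    ultimately show ?thesis
      unfolding roundable_def using i r by (intro conjI exI[of _ "\<lambda>_ _. 0"]) auto
  qed
  have "partition_on (facs I) ((\<lambda>i. {i}) ` facs I)"
    by (intro partition_onI) (auto simp: disjnt_def)
  moreover have "L2 I (\<lambda>_ _ _. 0) y" "L4 I (\<lambda>_ _ _. 0) y"
    using y by (simp_all add: L2_def L4_def nonneg_y_def)
  ultimately show ?thesis
    unfolding is_decomposition_def trivial_decomposition_def decomposition.simps
    using fin d round by (auto simp: supported_def nonneg_x_def deletable_def distinct_map)
qed

lemma scale_bounds:
  assumes "0 < \<delta>"
  shows "1 \<le> scale \<delta>" "1 / real (scale \<delta>) \<le> \<delta>" "real (scale \<delta>) \<le> 1 / \<delta> + 1"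
proof -
  have u: "0 < 1 / \<delta>" using assms by simp
  have c: "1 / \<delta> \<le> real (scale \<delta>)" unfolding scale_def by linarith
  show "real (scale \<delta>) \<le> 1 / \<delta> + 1" unfolding scale_def using u by linarith
  have p: "0 < real (scale \<delta>)" using u c by linarith
  then show "1 \<le> scale \<delta>" by simp
  show "1 / real (scale \<delta>) \<le> \<delta>" using c p assms by (simp add: field_simps)
qed

text \<open>For \<open>\<delta> < 100\<close> the summand 1 in
  \<open>N \<le> 1 / \<delta> + 1\<close> is at most \<open>100 / \<delta>\<close>, and
  \<open>L \<ge> 1 / 2\<close> turns \<open>29 + 16 * L\<close> into at most \<open>74 * L\<close>.
  The constant is then \<open>80 * 101 * 74 = 597920\<close>, rounded up.\<close>

lemma horizon_scale:
  assumes d: "0 < \<delta>" "\<delta> < 100"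
  shows "2 * real (40 * horizon (scale \<delta>)) \<le> soft_O_bound 600000 1 \<delta>"
proof -
  define u where "u = 1 / \<delta>"
  define N where "N = scale \<delta>"
  define L where "L = ln (2 + u)"
  have u: "1 \<le> 100 * u" "0 < u" using d by (simp_all add: u_def field_simps)
  have N: "1 \<le> N" "real N \<le> u + 1" using scale_bounds[OF d(1)] by (simp_all add: N_def u_def)
  have ln2: "1 / 2 \<le> ln (2::real)" using ln2_ge_two_thirds by simp
  also have "ln 2 \<le> L" using u by (simp add: L_def)
  finally have L: "1 / 2 \<le> L" .
  have "real (floorlog 2 N) = of_int \<lfloor>log 2 N\<rfloor> + 1"
    using N(1) by (simp add: floorlog_def)
  also have "\<dots> \<le> log 2 N + 1" by simp
  also have "log 2 N = ln N / ln 2" by (simp add: log_def)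
  also have "ln N / ln 2 \<le> L / (1 / 2)"
  proof (rule frac_le)
    show "ln (real N) \<le> L" using N u by (simp add: L_def)
  qed (use ln2 L in auto)
  finally have l: "real (floorlog 2 N) \<le> 2 * L + 1" by simp
  have "real (horizon N) = 1 + real N * (22 + 7 * real (floorlog 2 N))" by (simp add: horizon_def)
  also have "\<dots> \<le> real N * (2 * L) + real N * (22 + 7 * (2 * L + 1))"
  proof (intro add_mono mult_left_mono)
    have "1 * 1 \<le> real N * (2 * L)" using N(1) L by (intro mult_mono) auto
    then show "1 \<le> real N * (2 * L)" by simp
  qed (use l in auto)
  also have "\<dots> = real N * (29 + 16 * L)" by (simp add: algebra_simps)
  also have "\<dots> \<le> (101 * u) * (74 * L)"
    using N u L by (intro mult_mono) auto
  finally have "2 * real (40 * horizon N) \<le> 80 * ((101 * u) * (74 * L))" by linarith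
  also have "\<dots> = 597920 * (u * L)" by simp
  also have "\<dots> \<le> 600000 * (u * L)" using u L by (intro mult_right_mono) auto
  finally show ?thesis by (simp add: soft_O_bound_def N_def u_def L_def)
qed

text \<open>
  For large \<open>\<delta>\<close> the soft-O bound tends to \<open>0\<close>, so only singletons are admissible; but then
  nothing has to be assigned, since \<open>1 - \<delta> / 100 \<le> 0\<close>.
\<close>

definition solve :: "input \<Rightarrow> decomposition" where
  "solve w = (if delta_of w < 100 then decompose (inst_of w) (scale (delta_of w)) (x_of w) (y_of w)
     else trivial_decomposition (inst_of w))"

lemma solve_correct:
  assumes "wf_instance I" "feasible I x y" "0 < \<delta>"
  shows "is_decomposition I y \<delta> (soft_O_bound 600000 1 \<delta>) (solve (I, x, y, \<delta>))"
proof (cases "\<delta> < 100")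
  case True
  interpret setting I x y "scale \<delta>"
    using assms scale_bounds(1) by unfold_locales
  show ?thesis
    using decompose_correct[OF scale_bounds(2)[OF assms(3)] horizon_scale[OF assms(3) True]] True
    by (simp add: solve_def)
next
  case False
  then show ?thesis
    using trivial_correct[OF assms(1,2), of \<delta>] assms(3) by (simp add: solve_def soft_O_bound_def)
qed

lemma solve_rational: "good w \<Longrightarrow> rational_x (inst_of w) (xbar (solve w))"
  using new_x_rational[of w]
  by (auto simp: rational_x_def solve_def decompose_def trivial_decomposition_def)

lemma solve_poly_time: "poly_time {w. good w} enc_in (\<lambda>w. enc_output (inst_of w) (solve w))"
proof -
  have W: "input_c {w. good w} enc_in (\<lambda>w. w)" by (intro computesI poly_time_id) simp
  let ?B = "{w \<in> {w. good w}. rat_of (delta_of w) < 100}"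
  let ?C = "{w \<in> {w. good w}. \<not> rat_of (delta_of w) < 100}"
  have sub: "?B \<subseteq> {w. good w}" "?C \<subseteq> {w. good w}" by auto
  note WB = computes_mono[OF W sub(1)] and WC = computes_mono[OF W sub(2)]
  have b: "bool_c {w. good w} enc_in (\<lambda>w. rat_of (delta_of w) < 100)"
    by (rule rat_less[OF delta_c[OF W] rat_const])
  have "poly_time {w. good w} enc_in (\<lambda>w. if rat_of (delta_of w) < 100
      then enc_output (inst_of w) (decompose (inst_of w) (scale (delta_of w)) (x_of w) (y_of w))
      else enc_output (inst_of w) (trivial_decomposition (inst_of w)))"
  proof (rule poly_time_cond[OF computes_poly[OF b] output_c[OF WB scale_c[OF WB]] trivial_output_c[OF WC]])
    fix w assume "w \<in> ?B"
    then have w: "wf_instance (inst_of w)" "feasible (inst_of w) (x_of w) (y_of w)" "0 < delta_of w"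
      by (simp_all add: good_def)
    interpret setting "inst_of w" "x_of w" "y_of w" "scale (delta_of w)"
      using w scale_bounds(1) by unfold_locales
    show "\<Union> (set (cores (inst_of w) (scale (delta_of w)))) \<subseteq> clients (inst_of w)"
      by (rule Union_least) (rule cores_sub)
  qed
  then show ?thesis
  proof (rule poly_time_cong)
    fix w assume "w \<in> {w. good w}"
    then have "delta_of w = real_of_rat (rat_of (delta_of w))"
      by (simp add: good_def rational_input_def real_of_rat_of)
    then have "delta_of w < 100 \<longleftrightarrow> rat_of (delta_of w) < 100"
      by (metis of_rat_less of_rat_numeral_eq)
    then show "enc_output (inst_of w) (solve w) = (if rat_of (delta_of w) < 100
      then enc_output (inst_of w) (decompose (inst_of w) (scale (delta_of w)) (x_of w) (y_of w))
      else enc_output (inst_of w) (trivial_decomposition (inst_of w)))"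
      by (simp add: solve_def)
  qed
qed

theorem theorem14:
  shows "\<exists>(A::real) (e::nat) (P::prog) (a::nat) (b::nat).
           \<forall>(I::instance_hck) (x::xvars) (y::yvars) (\<delta>::real).
             wf_instance I \<longrightarrow> feasible I x y \<longrightarrow> \<delta> > 0 \<longrightarrow>
               (\<exists>D. is_decomposition I y \<delta> (soft_O_bound A e \<delta>) D \<and>
                    (rational_input I x y \<delta> \<longrightarrow> computes_within P a b I x y \<delta> D))"
proof -
  obtain P T where T: "poly_bounded {w. good w} enc_in T"
    and P: "\<forall>w\<in>{w. good w}. \<exists>t\<le>T w. run P (enc_in w) (enc_output (inst_of w) (solve w)) t"
    using solve_poly_time unfolding poly_time_def by (elim exE conjE)
  obtain a b where ab: "\<forall>w\<in>{w. good w}. T w \<le> a * vsize (enc_in w) ^ b"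
    using T unfolding poly_bounded_def by (elim exE)
  \<comment> \<open>\<open>solve\<close> is correct for arbitrary real data. Rationality enters here
    only, since codes represent rational numbers.\<close>
  have *: "computes_within P a b I x y \<delta> (solve (I, x, y, \<delta>))"
    if "wf_instance I" "feasible I x y" "0 < \<delta>" "rational_input I x y \<delta>" for I x y \<delta>
  proof -
    have g: "good (I, x, y, \<delta>)" using that by (simp add: good_def)
    obtain t where t: "t \<le> T (I, x, y, \<delta>)"
      "run P (enc_in (I, x, y, \<delta>)) (enc_output I (solve (I, x, y, \<delta>))) t"
      using P[rule_format, of "(I, x, y, \<delta>)"] g by auto
    moreover have "T (I, x, y, \<delta>) \<le> a * vsize (enc_in (I, x, y, \<delta>)) ^ b" using ab g by simp
    ultimately show ?thesis
      using solve_rational[OF g] unfolding computes_within_def by (auto simp: enc_in_def)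
  qed
  have "\<forall>I x y \<delta>. wf_instance I \<longrightarrow> feasible I x y \<longrightarrow> \<delta> > 0 \<longrightarrow>
      (\<exists>D. is_decomposition I y \<delta> (soft_O_bound 600000 1 \<delta>) D \<and>
        (rational_input I x y \<delta> \<longrightarrow> computes_within P a b I x y \<delta> D))"
  proof (intro allI impI)
    fix I x y and \<delta> :: real assume h: "wf_instance I" "feasible I x y" "0 < \<delta>"
    show "\<exists>D. is_decomposition I y \<delta> (soft_O_bound 600000 1 \<delta>) D \<and>
        (rational_input I x y \<delta> \<longrightarrow> computes_within P a b I x y \<delta> D)"
    proof (intro exI conjI impI)
      show "is_decomposition I y \<delta> (soft_O_bound 600000 1 \<delta>) (solve (I, x, y, \<delta>))"
        by (rule solve_correct[OF h])
    qed (rule *[OF h])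
  qed
  then show ?thesis by (intro exI)
qed

end
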